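(* With $C_\star$, $Z(t)$ and $\mathcal Z$ as defined in the context, the random variable $\mathcal Z$ has the law of each of the following: (1) the weak limit of $C_\star Z(t)$ conditional on $Z(t)>0$ as $t\downarrow0$; (2) $C_\star b^{-2}Z(U)$ conditioned on $Z(U)>0$, for $U$ Exponential with parameter $1$; (3) the weak limit (as $n\to\infty$) of the sequence $$C_\star\,b^{-2n}\sum_{x\in\mathbb L_n}\Bigl(n\sqrt{\log b}-\sqrt{\ell_{\tau_\varrho}(x)}\Bigr)^+\ell_{\tau_\varrho}(x)^{1/4}\,e^{2\sqrt{\log b}\,\sqrt{\ell_{\tau_\varrho}(x)}}$$ under $P^{x_n}$, for any $x_n\in\mathbb L_n$; where all the stated weak limits exist.
   Context: Fix an integer $b\ge2$. $\mathbb T_n$ is the regular rooted tree of depth $n$ with forward degree $b$ (every vertex at distance less than $n$ from the root has exactly $b$ children), $\varrho$ is its root, $\mathbb L_n$ is the set of its $b^n$ leaves. $\{X_t\}_{t\ge0}$ is the continuous-time random walk on $\mathbb T_n$ with unit transition rate across each edge, $P^z$ is its law started at $z$. Let $\ell_t(x):=\int_0^t1_{\{X_s=x\}}\,ds$, $\tau_\varrho:=\inf\{t\ge0:X_t=\varrho\}$, $\tilde\tau_\varrho(t):=\inf\{s\ge0:\ell_s(\varrho)>t\}$, $L_t(x):=\ell_{\tilde\tau_\varrho(t)}(x)$. For $t>0$, $Z(t)$ (with law $\mathbb P$) is the a.s.-finite, non-negative weak limit as $n\to\infty$, under $P^\varrho$, of $$Z_n(t):=b^{-2n}\sum_{x\in\mathbb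 L_n}\bigl(n\sqrt{\log b}-\sqrt{L_t(x)}\bigr)^+L_t(x)^{1/4}e^{2\sqrt{\log b}\sqrt{L_t(x)}},$$ which satisfies $\mathbb P(Z(t)>0)\in(0,1)$, and $C_\star\in(0,\infty)$ is the ($t$-independent) constant such that for all $t>0$, $u\in\mathbb R$, $$\lim_{n\to\infty}P^\varrho\Bigl(\max_{x\in\mathbb L_n}\sqrt{L_t(x)}\le n\sqrt{\log b}-\tfrac1{\sqrt{\log b}}\log n+u\Bigr)=\mathbb E\bigl(e^{-C_\star Z(t)e^{-2u\sqrt{\log b}}}\bigr).$$ For a positive random variable $T$, $Z(T)$ denotes the random variable coupled to $T$ so that $P((T,Z(T))\in\cdot)=\int\mathbb P((t,Z(t))\in\cdot)P(T\in dt)$. $\mathcal Z$ is the a.s.-positive and finite random variable such that for any $x_n\in\mathbb L_n$ and all $u\in\mathbb R$, $$\lim_{n\to\infty}P^{x_n}\Bigl(\max_{x\in\mathbb L_n}\sqrt{\ell_{\tau_\varrho}(x)}\le\sqrt{\log b}\,n-\tfrac1{\sqrt{\log b}}\log n+u\Bigr)=\mathbb E\bigl(e^{-\mathcal Ze^{-2u\sqrt{\log b}}}\bigr).$$ (The existence of $Z(t)$, $C_\star$, $Z(T)$ and $\mathcal Z$ is given by other results of the paper.) *)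

theory Defs
  imports "HOL-Probability.Probability"
begin

section \<open>The regular tree\<close>

text \<open>
  A vertex is the list of child labels (in \<open>{..<b}\<close>) on its path from the root, the most recent
  label first: the root is \<open>[]\<close>, the children of \<open>v\<close> are \<open>i # v\<close> for \<open>i < b\<close>, and the depth of
  \<open>v\<close> is \<open>length v\<close>.
\<close>

type_synonym vertex = "nat list"

definition tree_vertices :: "nat \<Rightarrow> nat \<Rightarrow> vertex set" where
  "tree_vertices b n = {v. length v \<le> n \<and> set v \<subseteq> {..<b}}"

definition leaves :: "nat \<Rightarrow> nat \<Rightarrow> vertex set" where
  "leaves b n = {v \<in> tree_vertices b n. length v = n}"

definition root :: vertex ("\<rho>") where
  "\<rho> = []"

definition neighbours :: "nat \<Rightarrow> nat \<Rightarrow> vertex \<Rightarrow> vertex set" where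
  "neighbours b n v = {w \<in> tree_vertices b n. \<exists>i. w = i # v \<or> v = i # w}"


section \<open>The continuous-time random walk\<close>

text \<open>
  The walk is built from its jump chain and holding times. With unit rate across each edge, the
  walk at \<open>v\<close> waits an exponential time with parameter \<open>deg v\<close> and then moves to a uniformly chosen
  neighbour of \<open>v\<close>. The randomness is an i.i.d. sequence of pairs \<open>(f, e)\<close>, where
  \<open>e\<close> is a standard exponential and, independently, \<open>f v\<close> is a uniform neighbour of \<open>v\<close> for every
  vertex \<open>v\<close>; only the value of \<open>f\<close> at the current vertex is used at each step. Under
  \<open>walk_space b n\<close>, the process \<open>walk b n z\<close> has law \<open>P\<^sup>z\<close>.

  The tree of depth \<open>0\<close> has no edges, so \<open>pmf_of_set\<close> is unspecified there; this depth
  is irrelevant for limits as \<open>n\<close> tends to infinity.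
\<close>

type_synonym driving = "((vertex \<Rightarrow> vertex) \<times> real) stream"

definition walk_space :: "nat \<Rightarrow> nat \<Rightarrow> driving measure" where
  "walk_space b n = stream_space
     (measure_pmf (Pi_pmf (tree_vertices b n) \<rho> (\<lambda>v. pmf_of_set (neighbours b n v)))
      \<Otimes>\<^sub>M density lborel (exponential_density 1))"

primrec jump_chain :: "vertex \<Rightarrow> driving \<Rightarrow> nat \<Rightarrow> vertex" where
  "jump_chain z \<omega> 0 = z"
| "jump_chain z \<omega> (Suc k) = fst (\<omega> !! k) (jump_chain z \<omega> k)"

definition holding_time :: "nat \<Rightarrow> nat \<Rightarrow> vertex \<Rightarrow> driving \<Rightarrow> nat \<Rightarrow> real" where
  "holding_time b n z \<omega> k = snd (\<omega> !! k) / real (card (neighbours b n (jump_chain z \<omega> k)))"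

definition jump_time :: "nat \<Rightarrow> nat \<Rightarrow> vertex \<Rightarrow> driving \<Rightarrow> nat \<Rightarrow> real" where
  "jump_time b n z \<omega> k = (\<Sum>j<k. holding_time b n z \<omega> j)"

text \<open>
  Almost surely the jump times increase to infinity, so that the walk is at \<open>jump_chain z \<omega> k\<close>
  exactly during \<open>[jump_time k, jump_time (k + 1))\<close>.
\<close>

definition walk :: "nat \<Rightarrow> nat \<Rightarrow> vertex \<Rightarrow> driving \<Rightarrow> real \<Rightarrow> vertex" where
  "walk b n z \<omega> t = jump_chain z \<omega> (LEAST k. t < jump_time b n z \<omega> (Suc k))"


section \<open>Local times\<close>

text \<open>
  The infima below are over almost surely non-empty sets, as the walk is recurrent.
\<close>

definition local_time :: "nat \<Rightarrow> nat \<Rightarrow> vertex \<Rightarrow> driving \<Rightarrow> real \<Rightarrow> vertex \<Rightarrow> real" where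
  "local_time b n z \<omega> t x = (LINT s:{0..t}|lborel. indicator {x} (walk b n z \<omega> s))"

definition root_hitting_time :: "nat \<Rightarrow> nat \<Rightarrow> vertex \<Rightarrow> driving \<Rightarrow> real" where
  "root_hitting_time b n z \<omega> = Inf {t. 0 \<le> t \<and> walk b n z \<omega> t = \<rho>}"

definition inverse_local_time :: "nat \<Rightarrow> nat \<Rightarrow> vertex \<Rightarrow> driving \<Rightarrow> real \<Rightarrow> real" where
  "inverse_local_time b n z \<omega> t = Inf {s. 0 \<le> s \<and> t < local_time b n z \<omega> s \<rho>}"

text \<open>
  \<open>root_time_field b n t \<omega>\<close> is \<open>L\<^sub>t\<close> under \<open>P\<^sup>\<rho>\<close>, and \<open>hitting_field b n z \<omega>\<close> is the local time at the
  hitting time of the root under \<open>P\<^sup>z\<close>.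
\<close>

definition root_time_field :: "nat \<Rightarrow> nat \<Rightarrow> real \<Rightarrow> driving \<Rightarrow> vertex \<Rightarrow> real" where
  "root_time_field b n t \<omega> x = local_time b n \<rho> \<omega> (inverse_local_time b n \<rho> \<omega> t) x"

definition hitting_field :: "nat \<Rightarrow> nat \<Rightarrow> vertex \<Rightarrow> driving \<Rightarrow> vertex \<Rightarrow> real" where
  "hitting_field b n z \<omega> x = local_time b n z \<omega> (root_hitting_time b n z \<omega>) x"

definition max_sqrt_leaves :: "nat \<Rightarrow> nat \<Rightarrow> (vertex \<Rightarrow> real) \<Rightarrow> real" where
  "max_sqrt_leaves b n h = Max ((\<lambda>x. sqrt (h x)) ` leaves b n)"

definition max_level :: "nat \<Rightarrow> nat \<Rightarrow> real \<Rightarrow> real" where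
  "max_level b n u = sqrt (ln (real b)) * real n - ln (real n) / sqrt (ln (real b)) + u"

definition leaf_functional :: "nat \<Rightarrow> nat \<Rightarrow> (vertex \<Rightarrow> real) \<Rightarrow> real" where
  "leaf_functional b n h =
     (1 / real b ^ (2 * n)) *
     (\<Sum>x\<in>leaves b n. max 0 (real n * sqrt (ln (real b)) - sqrt (h x)) *
        h x powr (1 / 4) * exp (2 * sqrt (ln (real b)) * sqrt (h x)))"


section \<open>Randomised parameter and conditioning\<close>

text \<open>
  \<open>W\<close> plays the role of \<open>Z(T)\<close> for a positive random variable \<open>T\<close>: the joint law of \<open>T\<close> and \<open>W\<close>
  is the mixture, over the law of \<open>T\<close>, of the laws of \<open>(t, Z(t))\<close>. Only the
  one-dimensional laws of \<open>Z\<close> enter, so \<open>Z(t)\<close> may live on its own probability space \<open>P t\<close>.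
\<close>

definition coupled_at :: "(real \<Rightarrow> 'p measure) \<Rightarrow> (real \<Rightarrow> 'p \<Rightarrow> real) \<Rightarrow>
    'c measure \<Rightarrow> ('c \<Rightarrow> real) \<Rightarrow> ('c \<Rightarrow> real) \<Rightarrow> bool" where
  "coupled_at P Z N T W \<longleftrightarrow>
     prob_space N \<and> T \<in> borel_measurable N \<and> W \<in> borel_measurable N \<and>
     (AE \<omega> in N. 0 < T \<omega>) \<and>
     (\<forall>A \<in> sets (borel \<Otimes>\<^sub>M borel).
        emeasure N {\<omega> \<in> space N. (T \<omega>, W \<omega>) \<in> A} =
        (\<integral>\<^sup>+ t. emeasure (P t) {\<omega> \<in> space (P t). (t, Z t \<omega>) \<in> A} \<partial>(distr N borel T)))"

definition law_given_pos :: "'c measure \<Rightarrow> ('c \<Rightarrow> real) \<Rightarrow> real \<Rightarrow> real measure" where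
  \<comment> \<open>the law of \<open>c W\<close> conditional on \<open>W > 0\<close>\<close>
  "law_given_pos M W c =
     distr (uniform_measure M {\<omega> \<in> space M. 0 < W \<omega>}) borel (\<lambda>\<omega>. c * W \<omega>)"

end

theory Submission
  imports Defs "HOL-Real_Asymp.Real_Asymp"
begin

text \<open>
  At small root local time \<open>t\<close> the walk makes no excursion to the leaves, or one excursion, up to an
  error of order \<open>t\<^sup>2\<close> uniform in the depth; given one excursion, the local times at the leaves have the
  law of the field under \<open>P\<^sup>x\<close>, with \<open>x\<close> a leaf, at the hitting time of the root. For the indicator that
  the maximum is below a level, the limit in the depth gives
  \<open>E (exp (- C l Z(t))) = 1 - a p (1 - E (exp (- l \<Z>))) + O(a\<^sup>2)\<close> with \<open>a = 1 - exp (- b t)\<close> and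
  \<open>p = 1 - 1 / b\<close>. Letting \<open>l \<rightarrow> \<infinity>\<close> gives the probability of \<open>Z(t) > 0\<close>, and dividing gives (1). The
  same expansion, for the Laplace transform of the leaf functional, gives (3). For (2), in depth \<open>n + 1\<close>
  a child of the root collects an exponential local time before the root is hit, so the field of
  depth \<open>n\<close> at exponential root local time is the field of depth \<open>n + 1\<close> started at that child.

  Strong Markov arguments are replaced by one-step recursions in the starting point, whose bounded
  solutions are compared through the maximum principle on the tree.
\<close>

section \<open>Laplace transforms and nonmeasurable integrands\<close>

text \<open>The limit law of a maximum at level \<open>u\<close> is a Laplace transform at
  \<open>l = exp (- 2 * u * sqrt (ln b))\<close>, and every \<open>l > 0\<close> occurs, so the
  hypotheses on maxima provide full Laplace transforms. The constant \<open>a\<close> is the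
  probability that the first sojourn at the root, exponential of rate \<open>b\<close>, ends before
  the root local time \<open>t\<close> is used up; \<open>p\<close> is the limiting probability that
  a walk at a child of the root reaches the leaves before returning. Since the error
  \<open>a ^ 2\<close> does not depend on the depth, the depth limit can be taken at fixed
  \<open>t\<close> and divided by \<open>a\<close> afterwards; this is how convergence at fixed
  \<open>t\<close> yields (3), in which no \<open>t\<close> is left. The factor
  \<open>b ^ (-2)\<close> in (2) is the effect of one generation on the level: the shift
  \<open>sqrt (ln b)\<close> multiplies \<open>l\<close> by \<open>exp (- 2 * ln b)\<close>. A test
  of the leaves depends on all local time collected so far, so a recursion in the starting vertex
  alone does not close. The collected field is therefore carried as an argument, and comparisons
  take the supremum over it.\<close>

lemma continuous_on_cts_step_neg_ln:
  assumes "a < b"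
  shows "continuous_on {0..1} (\<lambda>y. if y \<le> 0 then 0 else cts_step a b (- ln y))"
proof -
  let ?g = "\<lambda>y. if y \<le> 0 then 0 else cts_step a b (- ln y)"
  have c: "continuous_on UNIV (cts_step a b)"
    using cts_step_uniformly_continuous[OF assms] uniformly_continuous_imp_continuous by blast
  have "continuous (at y within {0..1}) ?g" if y: "y \<in> {0..1}" for y
  proof (cases "y = 0")
    case True
    \<comment> \<open>\<open>cts_step a b\<close> vanishes beyond \<open>b\<close>, and
      \<open>x < exp (- b)\<close> means \<open>- ln x > b\<close>; so the value 0 chosen at the
      image of infinity is the continuous one.\<close>
    have z: "?g x = 0" if "dist x 0 < exp (- b)" for x
    proof (cases "x \<le> 0")
      case False
      then have "x < exp (- b)" using that by (simp add: dist_real_def)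
      then have "ln x < - b" using False by (metis exp_gt_zero ln_exp ln_less_cancel_iff not_le)
      then show ?thesis using assms False by (auto simp: cts_step_def)
    qed auto
    have "eventually (\<lambda>x. ?g x = 0) (at y within {0..1})"
      unfolding eventually_at using z True by (intro exI[of _ "exp (- b)"]) fastforce
    then have "((\<lambda>x. ?g x) \<longlongrightarrow> 0) (at y within {0..1})"
      by (rule tendsto_eventually)
    then show ?thesis using True by (simp add: continuous_within)
  next
    case False
    then have y0: "y > 0" using y by auto
    have ev: "\<forall>\<^sub>F x in nhds y. cts_step a b (- ln x) = ?g x"
      using eventually_nhds_in_open[of "{0<..}" y] y0 by (auto elim!: eventually_mono)
    have "isCont (\<lambda>y. cts_step a b (- ln y)) y"
    proof (rule isCont_o2[where g = "cts_step a b"])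
      show "isCont (\<lambda>y. - ln y) y" using y0 by (intro continuous_intros) simp
      show "isCont (cts_step a b) (- ln y)" using c by (simp add: continuous_on_eq_continuous_at)
    qed
    then have "isCont ?g y" using isCont_cong[OF ev] by simp
    then show ?thesis by (rule continuous_at_imp_continuous_at_within)
  qed
  then show ?thesis by (auto simp: continuous_on_eq_continuous_within)
qed

text \<open>The substitution \<open>y = exp (- x)\<close> carries the half-line into the unit
  interval and turns transforms at integers into moments. The step functions that test weak
  convergence become continuous on \<open>{0..1}\<close>, so Weierstrass approximates them uniformly
  by polynomials, whose integrals converge.\<close>

theorem laplace_conv_imp_weak_conv:
  fixes M :: "nat \<Rightarrow> real measure" and N :: "real measure"
  assumes M: "\<And>n. real_distribution (M n)" and N: "real_distribution N"
    and Mpos: "\<And>n. AE x in M n. 0 \<le> x" and Npos: "AE x in N. 0 \<le> x"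
    and conv: "\<And>k::nat. k > 0 \<Longrightarrow>
      (\<lambda>n. \<integral>x. exp (- (real k * x)) \<partial>M n) \<longlonglongrightarrow> (\<integral>x. exp (- (real k * x)) \<partial>N)"
  shows "weak_conv_m M N"
proof (rule integral_cts_step_conv_imp_weak_conv[OF M N])
  fix a b :: real assume ab: "a < b"
  define g where "g = (\<lambda>y::real. if y \<le> 0 then 0 else cts_step a b (- ln y))"
  have gs: "cts_step a b x = g (exp (- x))" for x by (simp add: g_def)
  have cg: "continuous_on {0..1} g"
    unfolding g_def by (rule continuous_on_cts_step_neg_ln[OF ab])
  have conv': "(\<lambda>n. \<integral>x. exp (- x) ^ i \<partial>M n) \<longlonglongrightarrow> (\<integral>x. exp (- x) ^ i \<partial>N)" for i
  proof (cases "i = 0")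
    case True
    have "(\<integral>x. exp (- x) ^ i \<partial>L) = 1" if "real_distribution L" for L :: "real measure"
    proof -
      interpret real_distribution L by fact
      show ?thesis using True prob_space by simp
    qed
    then show ?thesis using M N by simp
  next
    case False
    have "exp (- x) ^ i = exp (- (real i * x))" for x :: real
      by (metis exp_of_nat_mult mult_minus_right)
    then show ?thesis using conv[of i] False by simp
  qed
  have int: "integrable L (\<lambda>x. exp (- x) ^ i)"
    if "real_distribution L" "AE x in L. 0 \<le> x" for L :: "real measure" and i
  proof -
    interpret real_distribution L by fact
    show ?thesis
    proof (rule integrable_const_bound[of _ 1])
      show "AE x in L. norm (exp (- x) ^ i) \<le> 1"
        using that(2) by (rule eventually_mono) (simp add: power_le_one)
    qed simp
  qed
  show "(\<lambda>n. integral\<^sup>L (M n) (cts_step a b)) \<longlonglongrightarrow> integral\<^sup>L N (cts_step a b)"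
  proof (rule LIMSEQ_I)
    fix r :: real assume r: "r > 0"
    obtain p where p: "real_polynomial_function p" "\<And>x. x \<in> {0..1} \<Longrightarrow> \<bar>g x - p x\<bar> < r / 4"
      using Stone_Weierstrass_real_polynomial_function[of "{0..1}" g "r / 4"] cg r by auto
    obtain c m where cm: "p = (\<lambda>x. \<Sum>i\<le>m. c i * x ^ i)"
      using p(1) real_polynomial_function_iff_sum by blast
    have ip: "integrable L (\<lambda>x. p (exp (- x)))"
      and pe: "(\<integral>x. p (exp (- x)) \<partial>L) = (\<Sum>i\<le>m. c i * (\<integral>x. exp (- x) ^ i \<partial>L))"
      if "real_distribution L" "AE x in L. 0 \<le> x" for L :: "real measure"
      unfolding cm using int[OF that] by (simp_all add: integral_sum)
    have close: "\<bar>integral\<^sup>L L (cts_step a b) - (\<integral>x. p (exp (- x)) \<partial>L)\<bar> \<le> r / 4"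
      if "real_distribution L" "AE x in L. 0 \<le> x" for L :: "real measure"
    proof -
      interpret real_distribution L by fact
      have ic: "integrable L (cts_step a b)" by (rule integrable_cts_step[OF ab])
      have "\<bar>integral\<^sup>L L (cts_step a b) - (\<integral>x. p (exp (- x)) \<partial>L)\<bar>
          = \<bar>\<integral>x. cts_step a b x - p (exp (- x)) \<partial>L\<bar>"
        using ip[OF that] ic by simp
      also have "\<dots> \<le> (\<integral>x. \<bar>cts_step a b x - p (exp (- x))\<bar> \<partial>L)"
        by (rule integral_abs_bound)
      also have "\<dots> \<le> (\<integral>x. r / 4 \<partial>L)"
      proof (rule integral_mono_AE)
        show "AE x in L. \<bar>cts_step a b x - p (exp (- x))\<bar> \<le> r / 4"
          using that(2) by (rule eventually_mono) (use p(2) in \<open>auto simp: gs less_imp_le\<close>)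
      qed (use ip[OF that] ic in auto)
      also have "\<dots> = r / 4" using prob_space by simp
      finally show ?thesis .
    qed
    have "(\<lambda>n. \<integral>x. p (exp (- x)) \<partial>M n) \<longlonglongrightarrow> (\<integral>x. p (exp (- x)) \<partial>N)"
      unfolding pe[OF M Mpos] pe[OF N Npos] by (intro tendsto_intros conv')
    from LIMSEQ_D[OF this, of "r / 4"] r obtain no where
      no: "\<And>n. n \<ge> no \<Longrightarrow> \<bar>(\<integral>x. p (exp (- x)) \<partial>M n) - (\<integral>x. p (exp (- x)) \<partial>N)\<bar> < r / 4"
      by auto
    have "norm (integral\<^sup>L (M n) (cts_step a b) - integral\<^sup>L N (cts_step a b)) < r" if "n \<ge> no" for n
      using no[OF that] close[OF M[of n] Mpos] close[OF N Npos] r unfolding real_norm_def by linarith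
    then show "\<exists>no. \<forall>n\<ge>no. norm (integral\<^sup>L (M n) (cts_step a b) - integral\<^sup>L N (cts_step a b)) < r"
      by blast
  qed
qed

text \<open>A constant sequence that converges weakly has the characteristic function of its
  limit.\<close>

corollary laplace_eq_imp_eq:
  fixes M N :: "real measure"
  assumes M: "real_distribution M" and N: "real_distribution N"
    and "AE x in M. 0 \<le> x" "AE x in N. 0 \<le> x"
    and "\<And>k::nat. k > 0 \<Longrightarrow> (\<integral>x. exp (- (real k * x)) \<partial>M) = (\<integral>x. exp (- (real k * x)) \<partial>N)"
  shows "M = N"
proof (rule Levy_uniqueness[OF M N])
  have "weak_conv_m (\<lambda>_. M) N"
    by (rule laplace_conv_imp_weak_conv) (simp_all add: assms)
  then have "(\<lambda>_. char M t) \<longlonglongrightarrow> char N t" for t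
    by (intro levy_continuity1 M N)
  then show "char M = char N"
    by (auto simp: LIMSEQ_const_iff)
qed

section \<open>Integrals of nonmeasurable nonnegative functions\<close>

text \<open>The integral is a supremum over simple functions below \<open>u\<close>, and the
  supremum of a maximising sequence is measurable and still below \<open>u\<close>. This serves for
  functions of \<open>t\<close> built from the spaces \<open>P t\<close>, whose dependence on
  \<open>t\<close> is arbitrary.\<close>

lemma nn_integral_measurable_minorant:
  "\<exists>h\<in>borel_measurable M. h \<le> u \<and> integral\<^sup>N M u = integral\<^sup>N M h"
proof -
  let ?S = "{s. simple_function M s \<and> s \<le> u}"
  have "(\<lambda>_. 0) \<in> ?S" by (auto simp: le_fun_def)
  then have "?S \<noteq> {}" by blast
  from ennreal_SUP_countable_SUP[OF this, of "integral\<^sup>S M"]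
  obtain s where s: "range s \<subseteq> integral\<^sup>S M ` ?S" "integral\<^sup>N M u = (SUP i::nat. s i)"
    unfolding nn_integral_def by auto
  then have "\<forall>i. \<exists>v. v \<in> ?S \<and> s i = integral\<^sup>S M v" by blast
  then obtain v where v: "\<And>i. v i \<in> ?S" "\<And>i. s i = integral\<^sup>S M (v i)" by metis
  define h where "h x = (SUP i. v i x)" for x
  have hm: "h \<in> borel_measurable M"
    unfolding h_def using v(1) by (intro borel_measurable_SUP borel_measurable_simple_function) auto
  have hu: "h \<le> u" unfolding h_def le_fun_def using v(1) by (intro allI SUP_least) (auto simp: le_fun_def)
  have "s i \<le> integral\<^sup>N M h" for i
  proof -
    have "s i = (\<integral>\<^sup>+x. v i x \<partial>M)" using v(2)[of i] v(1)[of i] by (simp add: nn_integral_eq_simple_integral)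
    also have "\<dots> \<le> integral\<^sup>N M h" unfolding h_def by (intro nn_integral_mono SUP_upper) simp
    finally show ?thesis .
  qed
  then have "integral\<^sup>N M u \<le> integral\<^sup>N M h" unfolding s(2) by (intro SUP_least)
  moreover have "integral\<^sup>N M h \<le> integral\<^sup>N M u" using hu by (auto intro!: nn_integral_mono simp: le_fun_def)
  ultimately show ?thesis using hm hu by auto
qed

text \<open>Measurable minorants of \<open>f\<close> and \<open>g\<close> add up to one of
  \<open>f + g\<close>. The reverse inequality can fail, for instance for the indicators of a
  nonmeasurable set and of its complement.\<close>

lemma nn_integral_superadditive:
  "(\<integral>\<^sup>+x. f x \<partial>M) + (\<integral>\<^sup>+x. g x \<partial>M) \<le> (\<integral>\<^sup>+x. f x + g x \<partial>M)"
proof -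
  obtain f' g' where *: "f' \<in> borel_measurable M" "f' \<le> f" "integral\<^sup>N M f = integral\<^sup>N M f'"
    "g' \<in> borel_measurable M" "g' \<le> g" "integral\<^sup>N M g = integral\<^sup>N M g'"
    using nn_integral_measurable_minorant[of M f] nn_integral_measurable_minorant[of M g] by blast
  have "integral\<^sup>N M f + integral\<^sup>N M g = (\<integral>\<^sup>+x. f' x + g' x \<partial>M)"
    using * by (simp add: nn_integral_add)
  also have "\<dots> \<le> (\<integral>\<^sup>+x. f x + g x \<partial>M)"
    using * by (auto intro!: nn_integral_mono add_mono simp: le_fun_def)
  finally show ?thesis .
qed

lemma nn_integral_cmult_le: "c * (\<integral>\<^sup>+x. f x \<partial>M) \<le> (\<integral>\<^sup>+x. c * f x \<partial>M)"
proof -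
  obtain f' where *: "f' \<in> borel_measurable M" "f' \<le> f" "integral\<^sup>N M f = integral\<^sup>N M f'"
    using nn_integral_measurable_minorant[of M f] by blast
  have "c * integral\<^sup>N M f = (\<integral>\<^sup>+x. c * f' x \<partial>M)"
    using * by (simp add: nn_integral_cmult)
  also have "\<dots> \<le> (\<integral>\<^sup>+x. c * f x \<partial>M)"
    using * by (auto intro!: nn_integral_mono mult_left_mono simp: le_fun_def)
  finally show ?thesis .
qed

section \<open>Harmonic functions on the tree\<close>

definition nbr_avg :: "nat \<Rightarrow> nat \<Rightarrow> vertex \<Rightarrow> (vertex \<Rightarrow> real) \<Rightarrow> real" where
  "nbr_avg b n v D = (\<Sum>w\<in>neighbours b n v. D w) / real (card (neighbours b n v))"

lemma finite_tree_vertices [simp]: "finite (tree_vertices b n)"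
  using finite_lists_length_le[of "{..<b}" n] by (simp add: tree_vertices_def conj_commute)

lemma finite_leaves [simp]: "finite (leaves b n)"
  by (simp add: leaves_def)

lemma root_in_tree [simp]: "[] \<in> tree_vertices b n"
  by (simp add: tree_vertices_def)

lemma Cons_in_tree:
  "i # v \<in> tree_vertices b n \<longleftrightarrow> i < b \<and> length v < n \<and> v \<in> tree_vertices b n"
  by (auto simp: tree_vertices_def)

lemma leaves_subset_tree: "v \<in> leaves b n \<Longrightarrow> v \<in> tree_vertices b n"
  by (simp add: leaves_def)

lemma neighbours_subset_tree: "w \<in> neighbours b n v \<Longrightarrow> w \<in> tree_vertices b n"
  by (simp add: neighbours_def)

lemma finite_neighbours [simp]: "finite (neighbours b n v)"
  by (simp add: neighbours_def)

lemma neighbours_root: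
  assumes "n \<ge> 1"
  shows "neighbours b n [] = (\<lambda>i. [i]) ` {..<b}"
  using assms by (auto simp: neighbours_def Cons_in_tree)

lemma neighbours_leaf:
  assumes "v \<in> leaves b n" "v \<noteq> []"
  shows "neighbours b n v = {tl v}"
  using assms by (cases v) (auto simp: neighbours_def leaves_def Cons_in_tree)

lemma neighbours_interior:
  assumes "v \<in> tree_vertices b n" "v \<noteq> []" "length v < n"
  shows "neighbours b n v = insert (tl v) ((\<lambda>i. i # v) ` {..<b})"
  using assms by (cases v) (auto simp: neighbours_def Cons_in_tree)

lemma card_neighbours_root: "n \<ge> 1 \<Longrightarrow> card (neighbours b n []) = b"
  by (simp add: neighbours_root card_image inj_on_def)

lemma tl_notin_children: "tl v \<notin> (\<lambda>i. i # v) ` A"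
proof
  assume "tl v \<in> (\<lambda>i. i # v) ` A"
  then obtain i where "tl v = i # v" by auto
  then have "length (tl v) = Suc (length v)" by simp
  then show False by simp
qed

lemma card_neighbours_interior:
  assumes "v \<in> tree_vertices b n" "v \<noteq> []" "length v < n"
  shows "card (neighbours b n v) = Suc b"
  by (simp add: neighbours_interior[OF assms] tl_notin_children card_image inj_on_def)

lemma nbr_avg_root: "n \<ge> 1 \<Longrightarrow> nbr_avg b n [] D = (\<Sum>i<b. D [i]) / real b"
  by (simp add: nbr_avg_def card_neighbours_root) (simp add: neighbours_root sum.reindex inj_on_def)

lemma nbr_avg_interior:
  assumes "v \<in> tree_vertices b n" "v \<noteq> []" "length v < n"
  shows "nbr_avg b n v D = (D (tl v) + (\<Sum>i<b. D (i # v))) / (real b + 1)"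
  unfolding nbr_avg_def card_neighbours_interior[OF assms]
  by (simp add: neighbours_interior[OF assms] tl_notin_children sum.reindex inj_on_def add.commute)

lemma parent_in_neighbours:
  "i # v \<in> tree_vertices b n \<Longrightarrow> v \<in> neighbours b n (i # v)"
  by (auto simp: neighbours_def Cons_in_tree)

lemma neighbours_nonempty:
  assumes "n \<ge> 1" "b \<ge> 1" "v \<in> tree_vertices b n"
  shows "neighbours b n v \<noteq> {}"
proof (cases v)
  case Nil
  have "[0] \<in> neighbours b n []" using assms by (simp add: neighbours_root)
  then show ?thesis using Nil by blast
next
  case (Cons i u)
  then show ?thesis using parent_in_neighbours assms(3) by blast
qed

lemma card_neighbours_pos:
  assumes "n \<ge> 1" "b \<ge> 1" "v \<in> tree_vertices b n"
  shows "0 < card (neighbours b n v)"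
  using neighbours_nonempty[OF assms] by (simp add: card_gt_0_iff)

section \<open>Averages over neighbours and the maximum principle\<close>

lemma nbr_avg_mono:
  assumes "\<And>w. w \<in> neighbours b n v \<Longrightarrow> D w \<le> E w"
  shows "nbr_avg b n v D \<le> nbr_avg b n v E"
  unfolding nbr_avg_def by (intro divide_right_mono sum_mono assms) auto

lemma nbr_avg_const:
  assumes "n \<ge> 1" "b \<ge> 1" "v \<in> tree_vertices b n"
  shows "nbr_avg b n v (\<lambda>_. c) = c"
  using neighbours_nonempty[OF assms] by (simp add: nbr_avg_def)

lemma nbr_avg_diff: "nbr_avg b n v (\<lambda>w. D w - E w) = nbr_avg b n v D - nbr_avg b n v E"
  by (simp add: nbr_avg_def sum_subtractf diff_divide_distrib)

lemma nbr_avg_cmult: "nbr_avg b n v (\<lambda>w. c * D w) = c * nbr_avg b n v D"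
  by (simp add: nbr_avg_def sum_distrib_left)

lemma abs_nbr_avg_le: "\<bar>nbr_avg b n v D\<bar> \<le> nbr_avg b n v (\<lambda>w. \<bar>D w\<bar>)"
  unfolding nbr_avg_def by (simp add: divide_right_mono abs_divide)

lemma nbr_avg_le:
  assumes "n \<ge> 1" "b \<ge> 1" "v \<in> tree_vertices b n" "\<And>w. w \<in> neighbours b n v \<Longrightarrow> D w \<le> c"
  shows "nbr_avg b n v D \<le> c"
  using nbr_avg_mono[of b n v D "\<lambda>_. c"] assms by (simp add: nbr_avg_const)

lemma nbr_avg_cong:
  "(\<And>w. w \<in> neighbours b n v \<Longrightarrow> D w = E w) \<Longrightarrow> nbr_avg b n v D = nbr_avg b n v E"
  by (simp add: nbr_avg_def)

text \<open>The mean inequality at a maximum forces every neighbour, in particular the parent, to be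
  a maximum too, and parents lead to the root. Leaves count as interior points, since the walk is
  reflected there; the root is the only boundary point.\<close>

theorem maximum_principle:
  fixes D :: "vertex \<Rightarrow> real"
  assumes n: "n \<ge> 1" and b: "b \<ge> 1"
    and sub: "\<And>v. v \<in> tree_vertices b n \<Longrightarrow> v \<noteq> [] \<Longrightarrow> D v \<le> nbr_avg b n v D"
    and u: "u \<in> tree_vertices b n"
  shows "D u \<le> D []"
proof -
  define m where "m = Max (D ` tree_vertices b n)"
  have le: "D v \<le> m" if "v \<in> tree_vertices b n" for v
    unfolding m_def using that by (intro Max_ge) auto
  have root: "D [] = m" if "v \<in> tree_vertices b n" "D v = m" for v
    using that
  proof (induction v)
    case (Cons i v)
    let ?N = "neighbours b n (i # v)"
    have "m \<le> nbr_avg b n (i # v) D" using sub[OF Cons.prems(1)] Cons.prems(2) by simp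
    then have "real (card ?N) * m \<le> sum D ?N"
      using card_neighbours_pos[OF n b Cons.prems(1)] by (simp add: nbr_avg_def field_simps)
    then have "(\<Sum>w\<in>?N. m - D w) \<le> 0" by (simp add: sum_subtractf)
    moreover have "\<And>w. w \<in> ?N \<Longrightarrow> 0 \<le> m - D w" using le neighbours_subset_tree by fastforce
    ultimately have "(\<Sum>w\<in>?N. m - D w) = 0" by (intro antisym sum_nonneg)
    then have "m - D v = 0"
      using sum_nonneg_eq_0_iff[of ?N "\<lambda>w. m - D w"] \<open>\<And>w. w \<in> ?N \<Longrightarrow> 0 \<le> m - D w\<close>
        parent_in_neighbours[OF Cons.prems(1)] by simp
    then show ?case using Cons by (simp add: Cons_in_tree)
  qed simp
  have "m \<in> D ` tree_vertices b n"
    unfolding m_def by (intro Max_in) (auto intro: root_in_tree)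
  then show ?thesis using root le[OF u] by auto
qed

section \<open>The field stopped at a given root local time\<close>

abbreviation std_exp :: "real measure" where
  "std_exp \<equiv> density lborel (exponential_density 1)"

abbreviation step_space :: "nat \<Rightarrow> nat \<Rightarrow> ((vertex \<Rightarrow> vertex) \<times> real) measure" where
  "step_space b n \<equiv>
    measure_pmf (Pi_pmf (tree_vertices b n) \<rho> (\<lambda>v. pmf_of_set (neighbours b n v))) \<Otimes>\<^sub>M std_exp"

interpretation std_exp: prob_space std_exp
  by (rule prob_space_exponential_density) simp

interpretation step_space: prob_space "step_space b n" for b n
proof -
  interpret pair_prob_space "measure_pmf (Pi_pmf (tree_vertices b n) \<rho> (\<lambda>v. pmf_of_set (neighbours b n v)))" std_exp
    by unfold_locales
  show "prob_space (step_space b n)" by unfold_locales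
qed

interpretation walk_space: prob_space "walk_space b n" for b n
  unfolding walk_space_def by (rule step_space.prob_space_stream_space)

lemma space_walk_space [simp]: "space (walk_space b n) = UNIV"
  by (simp add: walk_space_def space_stream_space space_pair_measure)

text \<open>Local time indexed by the number of jumps: prepending one step to the driving stream
  then amounts to adding one holding time, with no shift of continuous time.\<close>

definition chain_local_time :: "nat \<Rightarrow> nat \<Rightarrow> vertex \<Rightarrow> driving \<Rightarrow> nat \<Rightarrow> vertex \<Rightarrow> real" where
  "chain_local_time b n z \<omega> k x =
     (\<Sum>j<k. if jump_chain z \<omega> j = x then holding_time b n z \<omega> j else 0)"

text \<open>The walk is stopped when its local time at the root exceeds \<open>t\<close>; for \<open>t = 0\<close> this is almost surely
  the hitting time of the root.\<close>

definition stops :: "nat \<Rightarrow> nat \<Rightarrow> vertex \<Rightarrow> driving \<Rightarrow> real \<Rightarrow> bool" where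
  "stops b n z \<omega> t \<longleftrightarrow> (\<exists>k. t < chain_local_time b n z \<omega> (Suc k) \<rho>)"

definition stop_index :: "nat \<Rightarrow> nat \<Rightarrow> vertex \<Rightarrow> driving \<Rightarrow> real \<Rightarrow> nat" where
  "stop_index b n z \<omega> t = (LEAST k. t < chain_local_time b n z \<omega> (Suc k) \<rho>)"

text \<open>The sojourn during which the threshold is passed is left out of the sum. It takes place
  at the root, so leaves of positive depth do not see it.\<close>

definition stopped_field :: "nat \<Rightarrow> nat \<Rightarrow> vertex \<Rightarrow> driving \<Rightarrow> real \<Rightarrow> vertex \<Rightarrow> real" where
  "stopped_field b n z \<omega> t = chain_local_time b n z \<omega> (stop_index b n z \<omega> t)"

lemma jump_chain_Stream: "jump_chain z (s ## \<omega>) (Suc k) = jump_chain (fst s z) \<omega> k"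
  by (induction k) simp_all

lemma holding_time_Stream: "holding_time b n z (s ## \<omega>) (Suc k) = holding_time b n (fst s z) \<omega> k"
  unfolding holding_time_def jump_chain_Stream by simp

lemma holding_time_Stream_0:
  "holding_time b n z (s ## \<omega>) 0 = snd s / real (card (neighbours b n z))"
  by (simp add: holding_time_def)

lemma chain_local_time_Stream:
  "chain_local_time b n z (s ## \<omega>) (Suc k) x =
    (if z = x then snd s / real (card (neighbours b n z)) else 0) + chain_local_time b n (fst s z) \<omega> k x"
  unfolding chain_local_time_def sum.lessThan_Suc_shift
  by (simp only: jump_chain_Stream holding_time_Stream holding_time_Stream_0 jump_chain.simps(1))

lemma chain_local_time_0 [simp]: "chain_local_time b n z \<omega> 0 x = 0"
  by (simp add: chain_local_time_def)

lemma stops_Stream: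
  "stops b n z (s ## \<omega>) t \<longleftrightarrow>
    (let h = (if z = \<rho> then snd s / real (card (neighbours b n z)) else 0)
     in t < h \<or> stops b n (fst s z) \<omega> (t - h))"
proof -
  have "stops b n z (s ## \<omega>) t \<longleftrightarrow> t < chain_local_time b n z (s ## \<omega>) (Suc 0) \<rho> \<or>
      (\<exists>k. t < chain_local_time b n z (s ## \<omega>) (Suc (Suc k)) \<rho>)"
    unfolding stops_def by (metis old.nat.exhaust)
  then show ?thesis
    unfolding chain_local_time_Stream stops_def Let_def by (simp add: less_diff_eq algebra_simps)
qed

text \<open>A pathwise form of the Markov property at the first jump: unless the walk stops in its
  first sojourn, the least index drops by one when that step is removed. The shift of
  \<open>LEAST\<close> requires some index to exist, hence the assumption
  \<open>stops\<close>.\<close>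

lemma stopped_field_Stream:
  assumes "stops b n z (s ## \<omega>) t"
  defines "h \<equiv> snd s / real (card (neighbours b n z))"
  shows "stopped_field b n z (s ## \<omega>) t =
    (if t < (if z = \<rho> then h else 0) then (\<lambda>_. 0)
     else (\<lambda>x. (if x = z then h else 0) +
       stopped_field b n (fst s z) \<omega> (t - (if z = \<rho> then h else 0)) x))"
proof -
  let ?h0 = "if z = \<rho> then h else 0"
  let ?Q = "\<lambda>k. t < chain_local_time b n z (s ## \<omega>) (Suc k) \<rho>"
  have Q0: "?Q 0 \<longleftrightarrow> t < ?h0"
    unfolding chain_local_time_Stream h_def by simp
  have QS: "?Q (Suc k) \<longleftrightarrow> t - ?h0 < chain_local_time b n (fst s z) \<omega> (Suc k) \<rho>" for k
    by (subst chain_local_time_Stream) (auto simp: h_def algebra_simps)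
  show ?thesis
  proof (cases "t < ?h0")
    case True
    then have "stop_index b n z (s ## \<omega>) t = 0"
      unfolding stop_index_def using Q0 by (intro Least_equality) auto
    then show ?thesis using True by (simp add: stopped_field_def fun_eq_iff)
  next
    case False
    from assms obtain k where "?Q k" by (auto simp: stops_def)
    then have "stop_index b n z (s ## \<omega>) t = Suc (LEAST k. ?Q (Suc k))"
      unfolding stop_index_def using False Q0 by (intro Least_Suc) auto
    also have "(LEAST k. ?Q (Suc k)) = stop_index b n (fst s z) \<omega> (t - ?h0)"
      unfolding stop_index_def QS ..
    finally show ?thesis
      using False by (auto simp: stopped_field_def chain_local_time_Stream fun_eq_iff h_def)
  qed
qed

section \<open>Measurability of the chain and of the stopped field\<close>

lemma measurable_jump_chain [measurable]:
  "(\<lambda>\<omega>. jump_chain z \<omega> k) \<in> measurable (walk_space b n) (count_space UNIV)"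
proof (induction k)
  case (Suc k)
  have "(\<lambda>\<omega>. fst (\<omega> !! k) v) \<in> measurable (walk_space b n) (count_space UNIV)" for v
  proof -
    have [measurable]: "(\<lambda>f. f v) \<in> measurable (measure_pmf p) (count_space UNIV)" for p :: "(vertex \<Rightarrow> vertex) pmf"
      by simp
    have "(\<lambda>\<omega>. \<omega> !! k) \<in> measurable (walk_space b n) (step_space b n)"
      unfolding walk_space_def by simp
    moreover have "(\<lambda>s. fst s v) \<in> measurable (step_space b n) (count_space UNIV)"
      by measurable
    ultimately show ?thesis by (rule measurable_compose)
  qed
  then show ?case
    unfolding jump_chain.simps
    by (rule measurable_compose_countable[OF _ Suc])
qed simp

lemma measurable_holding_time [measurable]:
  "(\<lambda>\<omega>. holding_time b m z \<omega> k) \<in> borel_measurable (walk_space b' n)"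
proof -
  have 1: "(\<lambda>\<omega>. \<omega> !! k) \<in> measurable (walk_space b' n) (step_space b' n)"
    unfolding walk_space_def by simp
  have [measurable]: "(\<lambda>\<omega>. snd (\<omega> !! k)) \<in> borel_measurable (walk_space b' n)"
    by (rule measurable_compose[OF 1]) measurable
  show ?thesis unfolding holding_time_def by measurable
qed

lemma measurable_chain_local_time [measurable]:
  "(\<lambda>\<omega>. chain_local_time b m z \<omega> k x) \<in> borel_measurable (walk_space b' n)"
  unfolding chain_local_time_def by measurable

lemma measurable_stops [measurable (raw)]:
  assumes [measurable]: "W \<in> measurable N (walk_space b n)" "T \<in> borel_measurable N"
  shows "Measurable.pred N (\<lambda>x. stops b n z (W x) (T x))"
  unfolding stops_def by measurable

lemma measurable_stop_index [measurable (raw)]: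
  assumes [measurable]: "W \<in> measurable N (walk_space b n)" "T \<in> borel_measurable N"
  shows "(\<lambda>x. stop_index b n z (W x) (T x)) \<in> measurable N (count_space UNIV)"
  unfolding stop_index_def by measurable

lemma measurable_stopped_field [measurable (raw)]:
  assumes [measurable]: "W \<in> measurable N (walk_space b n)" "T \<in> borel_measurable N"
  shows "(\<lambda>x. stopped_field b n z (W x) (T x) y) \<in> borel_measurable N"
  unfolding stopped_field_def
  by (rule measurable_compose_countable[where g = "\<lambda>x. stop_index b n z (W x) (T x)"]) measurable

section \<open>Exponential variables, integrands with values in the unit interval, and the first
  step\<close>

lemma std_exp_atMost: "0 \<le> a \<Longrightarrow> measure std_exp {..a} = 1 - exp (- a)"
  by (simp add: measure_def emeasure_erlang_density erlang_CDF_0)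

lemma AE_std_exp_pos: "AE e in std_exp. 0 < e"
proof -
  have "emeasure std_exp {..0} = 0"
    by (simp add: emeasure_erlang_density erlang_CDF_0)
  then have "{..0} \<in> null_sets std_exp" by (intro null_setsI) auto
  then have "AE e in std_exp. e \<notin> {..0}" by (rule AE_not_in)
  then show ?thesis by (rule eventually_mono) simp
qed

lemma (in prob_space) integrable_unit_interval:
  assumes "f \<in> borel_measurable M" "\<And>x. 0 \<le> f x" "\<And>x. f x \<le> (1::real)"
  shows "integrable M f"
  using assms by (intro integrable_const_bound[of _ 1]) auto

text \<open>A nonintegrable function has Bochner integral 0, so the bounds are available for every
  such \<open>f\<close>, before its measurability is established.\<close>

lemma (in prob_space) integral_unit_interval:
  assumes "\<And>x. 0 \<le> f x" "\<And>x. f x \<le> (1::real)"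
  shows "0 \<le> integral\<^sup>L M f" "integral\<^sup>L M f \<le> 1"
proof -
  show "0 \<le> integral\<^sup>L M f" using assms by (intro integral_nonneg_AE) auto
  show "integral\<^sup>L M f \<le> 1"
  proof (cases "integrable M f")
    case True
    then have "integral\<^sup>L M f \<le> (\<integral>x. 1 \<partial>M)" using assms by (intro integral_mono) auto
    then show ?thesis using prob_space by simp
  qed (simp add: not_integrable_integral_eq)
qed

lemma (in prob_space) ennreal_integral_unit_interval:
  assumes "f \<in> borel_measurable M" "\<And>x. 0 \<le> f x" "\<And>x. f x \<le> (1::real)"
  shows "(\<integral>\<^sup>+x. ennreal (f x) \<partial>M) = ennreal (integral\<^sup>L M f)"
  using assms by (intro nn_integral_eq_integral integrable_unit_interval) auto

text \<open>The stream measure splits into an independent head and tail, and the component at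
  \<open>v\<close> of the product pmf is uniform on the neighbours of \<open>v\<close>. The vertices
  form a countable type, which takes care of measurability in the random next vertex.\<close>

lemma nn_integral_first_step:
  assumes n: "n \<ge> 1" and b: "b \<ge> 1" and v: "v \<in> tree_vertices b n"
    and G: "\<And>w. (\<lambda>(e, \<omega>). G w e \<omega>) \<in> borel_measurable (std_exp \<Otimes>\<^sub>M walk_space b n)"
  shows "(\<integral>\<^sup>+X. G (fst (shd X) v) (snd (shd X)) (stl X) \<partial>walk_space b n) =
    (\<Sum>w\<in>neighbours b n v. \<integral>\<^sup>+e. \<integral>\<^sup>+\<omega>. G w e \<omega> \<partial>walk_space b n \<partial>std_exp) / card (neighbours b n v)"
proof -
  let ?p = "Pi_pmf (tree_vertices b n) \<rho> (\<lambda>v. pmf_of_set (neighbours b n v))"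
  note G' = G[unfolded split_beta]
  have m1: "(\<lambda>s. fst s v) \<in> measurable (step_space b n) (count_space UNIV)"
  proof -
    have [measurable]: "(\<lambda>f. f v) \<in> measurable (measure_pmf ?p) (count_space UNIV)" by simp
    show ?thesis by measurable
  qed
  have shd: "shd \<in> measurable (walk_space b n) (step_space b n)"
    and stl: "stl \<in> measurable (walk_space b n) (walk_space b n)"
    by (simp_all add: walk_space_def)
  have mX: "(\<lambda>X. G (fst (shd X) v) (snd (shd X)) (stl X)) \<in> borel_measurable (walk_space b n)"
  proof (rule measurable_compose_countable[where g = "\<lambda>X. fst (shd X) v"])
    show "(\<lambda>X. fst (shd X) v) \<in> measurable (walk_space b n) (count_space UNIV)"
      by (rule measurable_compose[OF shd m1])
    have "(\<lambda>X. (snd (shd X), stl X)) \<in> measurable (walk_space b n) (std_exp \<Otimes>\<^sub>M walk_space b n)"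
      by (intro measurable_Pair measurable_compose[OF shd] stl) measurable
    from measurable_compose[OF this G'] show "(\<lambda>X. G w (snd (shd X)) (stl X)) \<in> borel_measurable (walk_space b n)" for w
      by simp
  qed
  define H where "H w e = (\<integral>\<^sup>+\<omega>. G w e \<omega> \<partial>walk_space b n)" for w e
  have H[measurable]: "H w \<in> borel_measurable std_exp" for w
    unfolding H_def using G[of w] by (rule walk_space.borel_measurable_nn_integral)
  have "(\<integral>\<^sup>+X. G (fst (shd X) v) (snd (shd X)) (stl X) \<partial>walk_space b n)
      = (\<integral>\<^sup>+s. H (fst s v) (snd s) \<partial>step_space b n)"
    unfolding H_def using step_space.nn_integral_stream_space[OF mX[unfolded walk_space_def]]
    by (simp add: walk_space_def)
  also have "\<dots> = (\<integral>\<^sup>+f. \<integral>\<^sup>+e. H (f v) e \<partial>std_exp \<partial>measure_pmf ?p)"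
  proof (subst std_exp.nn_integral_fst[symmetric])
    show "(\<lambda>s. H (fst s v) (snd s)) \<in> borel_measurable (step_space b n)"
      by (rule measurable_compose_countable[OF _ m1]) measurable
  qed simp
  also have "\<dots> = (\<integral>\<^sup>+w. \<integral>\<^sup>+e. H w e \<partial>std_exp \<partial>measure_pmf (map_pmf (\<lambda>f. f v) ?p))"
    by simp
  also have "map_pmf (\<lambda>f. f v) ?p = pmf_of_set (neighbours b n v)"
    using v by (simp add: Pi_pmf_component)
  also have "(\<integral>\<^sup>+w. \<integral>\<^sup>+e. H w e \<partial>std_exp \<partial>measure_pmf (pmf_of_set (neighbours b n v))) =
      (\<Sum>w\<in>neighbours b n v. \<integral>\<^sup>+e. H w e \<partial>std_exp) / card (neighbours b n v)"
    using neighbours_nonempty[OF n b v] by (simp add: nn_integral_pmf_of_set)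
  finally show ?thesis unfolding H_def .
qed

text \<open>Identity with the first-step expression is asked only almost everywhere, because the
  recursion for the stopped field holds only on paths that do stop.\<close>

lemma integral_first_step:
  fixes G :: "vertex \<Rightarrow> real \<Rightarrow> driving \<Rightarrow> real"
  assumes n: "n \<ge> 1" and b: "b \<ge> 1" and v: "v \<in> tree_vertices b n"
    and F: "F \<in> borel_measurable (walk_space b n)" "\<And>X. 0 \<le> F X" "\<And>X. F X \<le> 1"
    and G: "\<And>w. (\<lambda>(e, \<omega>). G w e \<omega>) \<in> borel_measurable (std_exp \<Otimes>\<^sub>M walk_space b n)"
      "\<And>w e \<omega>. 0 \<le> G w e \<omega>" "\<And>w e \<omega>. G w e \<omega> \<le> 1"
    and FG: "AE X in walk_space b n. F X = G (fst (shd X) v) (snd (shd X)) (stl X)"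
  shows "(\<integral>X. F X \<partial>walk_space b n) =
    nbr_avg b n v (\<lambda>w. \<integral>e. \<integral>\<omega>. G w e \<omega> \<partial>walk_space b n \<partial>std_exp)"
proof -
  let ?I = "\<lambda>w. \<integral>e. \<integral>\<omega>. G w e \<omega> \<partial>walk_space b n \<partial>std_exp"
  have Gm: "G w e \<in> borel_measurable (walk_space b n)" if "e \<in> space std_exp" for w e
    using measurable_Pair2[OF G(1)[of w] that] by simp
  have inner: "(\<integral>\<^sup>+\<omega>. ennreal (G w e \<omega>) \<partial>walk_space b n) = ennreal (\<integral>\<omega>. G w e \<omega> \<partial>walk_space b n)" for w e
    by (intro walk_space.ennreal_integral_unit_interval Gm G) simp
  have I: "(\<integral>\<^sup>+e. \<integral>\<^sup>+\<omega>. ennreal (G w e \<omega>) \<partial>walk_space b n \<partial>std_exp) = ennreal (?I w)" for w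
    unfolding inner
    by (intro std_exp.ennreal_integral_unit_interval walk_space.integral_unit_interval G
        walk_space.borel_measurable_lebesgue_integral)
  have I0: "0 \<le> ?I w" for w
    by (intro std_exp.integral_unit_interval walk_space.integral_unit_interval G)
  have Gm': "(\<lambda>(e, \<omega>). ennreal (G w e \<omega>)) \<in> borel_measurable (std_exp \<Otimes>\<^sub>M walk_space b n)" for w
    using G(1)[of w] by (simp add: split_beta)
  have "ennreal (integral\<^sup>L (walk_space b n) F) = (\<integral>\<^sup>+X. ennreal (F X) \<partial>walk_space b n)"
    by (rule walk_space.ennreal_integral_unit_interval[symmetric]) (use F in auto)
  also have "\<dots> = (\<integral>\<^sup>+X. ennreal (G (fst (shd X) v) (snd (shd X)) (stl X)) \<partial>walk_space b n)"
    using FG by (intro nn_integral_cong_AE) auto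
  also have "\<dots> = (\<Sum>w\<in>neighbours b n v. ennreal (?I w)) / card (neighbours b n v)"
    by (subst nn_integral_first_step[OF n b v Gm']) (simp add: I)
  also have "\<dots> = ennreal (nbr_avg b n v ?I)"
    unfolding nbr_avg_def using card_neighbours_pos[OF n b v] I0
    by (simp add: divide_ennreal ennreal_of_nat_eq_real_of_nat sum_nonneg)
  finally show ?thesis
    using walk_space.integral_unit_interval(1)[of F b n] F I0
    by (subst (asm) ennreal_inj) (auto simp: nbr_avg_def intro!: divide_nonneg_nonneg sum_nonneg)
qed

lemma stops_antimono: "stops b n z \<omega> t \<Longrightarrow> s \<le> t \<Longrightarrow> stops b n z \<omega> s"
  unfolding stops_def by (meson le_less_trans)

text \<open>Recurrence by the maximum principle. The probability \<open>D\<close> of never stopping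
  is subharmonic off the root, hence largest at the root; there, one sojourn bounds it by
  \<open>1 - exp (- b * t)\<close> times an average of its own values. A factor below 1 forces it to
  vanish.\<close>

theorem AE_stops:
  assumes n: "n \<ge> 1" and b: "b \<ge> 1" and v: "v \<in> tree_vertices b n" and t: "0 \<le> t"
  shows "AE \<omega> in walk_space b n. stops b n v \<omega> t"
proof -
  let ?W = "walk_space b n"
  define d where "d u s \<omega> = (if stops b n u \<omega> s then 0 else 1 :: real)" for u s \<omega>
  define D where "D u = (\<integral>\<omega>. d u t \<omega> \<partial>?W)" for u
  have [measurable]: "(\<lambda>x. d u (T x) (W x)) \<in> borel_measurable N"
    if [measurable]: "T \<in> borel_measurable N" "W \<in> measurable N ?W" for T W u N
    unfolding d_def by measurable
  have d01: "0 \<le> d u s \<omega>" "d u s \<omega> \<le> 1" for u s \<omega> by (auto simp: d_def)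
  have D01: "0 \<le> D u" for u unfolding D_def by (intro walk_space.integral_unit_interval d01)
  have d_Stream: "d u t X =
      (let h = (if u = \<rho> then snd (shd X) / real (card (neighbours b n u)) else 0)
       in if t < h then 0 else d (fst (shd X) u) (t - h) (stl X))" for u X
    unfolding d_def Let_def by (subst stream.collapse[symmetric], subst stops_Stream) (simp add: Let_def)
  have 1: "D u \<le> nbr_avg b n u D" if u: "u \<in> tree_vertices b n" "u \<noteq> []" for u
  proof -
    have "D u = nbr_avg b n u (\<lambda>w. \<integral>e. \<integral>\<omega>. d w t \<omega> \<partial>?W \<partial>std_exp)"
      unfolding D_def
    proof (rule integral_first_step[OF n b u(1)])
      show "(\<lambda>(e, \<omega>). d w t \<omega>) \<in> borel_measurable (std_exp \<Otimes>\<^sub>M ?W)" for w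
        unfolding split_beta by measurable
      show "AE X in ?W. d u t X = d (fst (shd X) u) t (stl X)"
        using u(2) t by (subst d_Stream) (auto simp: root_def)
    qed (auto intro: d01)
    then show ?thesis
      using std_exp.prob_space by (simp add: D_def[abs_def])
  qed
  \<comment> \<open>With probability \<open>exp (- b * t)\<close> the first sojourn at the root
    already exceeds \<open>t\<close>. Otherwise the remaining threshold \<open>t - e / b\<close> is
    smaller than \<open>t\<close>, so failing to stop is no more likely than with threshold
    \<open>t\<close>.\<close>
  have 2: "D [] \<le> (1 - exp (- real b * t)) * nbr_avg b n [] D"
  proof -
    have "D [] = nbr_avg b n [] (\<lambda>w. \<integral>e. \<integral>\<omega>. (if t < e / real b then 0 else d w (t - e / b) \<omega>) \<partial>?W \<partial>std_exp)"
      unfolding D_def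
    proof (rule integral_first_step[OF n b])
      show "(\<lambda>(e, \<omega>). if t < e / real b then 0 else d w (t - e / b) \<omega>) \<in> borel_measurable (std_exp \<Otimes>\<^sub>M ?W)" for w
        unfolding split_beta by measurable
      show "AE X in ?W. d [] t X = (if t < snd (shd X) / real b then 0
          else d (fst (shd X) []) (t - snd (shd X) / b) (stl X))"
        using n by (subst d_Stream) (auto simp: root_def card_neighbours_root Let_def)
    qed (auto intro: d01)
    also have "\<dots> \<le> nbr_avg b n [] (\<lambda>w. (1 - exp (- real b * t)) * D w)"
    proof (rule nbr_avg_mono)
      fix w
      have "(\<integral>e. \<integral>\<omega>. (if t < e / real b then 0 else d w (t - e / b) \<omega>) \<partial>?W \<partial>std_exp)
          \<le> (\<integral>e. indicator {..real b * t} e * D w \<partial>std_exp)"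
      proof (rule integral_mono_AE)
        show "AE e in std_exp. (\<integral>\<omega>. (if t < e / real b then 0 else d w (t - e / b) \<omega>) \<partial>?W)
            \<le> indicator {..real b * t} e * D w"
        proof (rule eventually_mono[OF AE_std_exp_pos])
          fix e :: real assume e: "0 < e"
          show "(\<integral>\<omega>. (if t < e / real b then 0 else d w (t - e / b) \<omega>) \<partial>?W)
            \<le> indicator {..real b * t} e * D w"
          proof (cases "t < e / real b")
            case False
            then have "e \<le> real b * t" using b by (simp add: field_simps)
            moreover have "(\<integral>\<omega>. d w (t - e / b) \<omega> \<partial>?W) \<le> D w"
              unfolding D_def
              by (intro integral_mono walk_space.integrable_unit_interval)
                (use e b in \<open>auto simp: d_def intro: stops_antimono\<close>)
            ultimately show ?thesis using False by simp
          qed (use D01 in auto)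
        qed
        show "integrable std_exp (\<lambda>e. \<integral>\<omega>. (if t < e / real b then 0 else d w (t - e / b) \<omega>) \<partial>?W)"
          by (intro std_exp.integrable_unit_interval walk_space.integral_unit_interval
              walk_space.borel_measurable_lebesgue_integral) (auto intro: d01)
        show "integrable std_exp (\<lambda>e. indicator {..real b * t} e * D w)"
          by (intro integrable_mult_left std_exp.integrable_unit_interval) (auto simp: indicator_def)
      qed
      also have "\<dots> = (1 - exp (- real b * t)) * D w"
        using t by (simp add: std_exp_atMost)
      finally show "(\<integral>e. \<integral>\<omega>. (if t < e / real b then 0 else d w (t - e / b) \<omega>) \<partial>?W \<partial>std_exp)
          \<le> (1 - exp (- real b * t)) * D w" .
    qed
    finally show ?thesis by (simp add: nbr_avg_cmult)
  qed
  have max: "D u \<le> D []" if "u \<in> tree_vertices b n" for u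
    using maximum_principle[OF n b 1 that] by blast
  have "nbr_avg b n [] D \<le> D []"
    using max neighbours_subset_tree by (intro nbr_avg_le[OF n b]) auto
  then have "(1 - exp (- real b * t)) * nbr_avg b n [] D \<le> (1 - exp (- real b * t)) * D []"
    using t by (intro mult_left_mono) auto
  then have "D [] \<le> (1 - exp (- real b * t)) * D []" using 2 by linarith
  then have "exp (- real b * t) * D [] \<le> 0" by (simp add: algebra_simps)
  then have "D [] \<le> 0" using exp_gt_zero[of "- real b * t"] by (simp add: mult_le_0_iff)
  then have "D v = 0" using max[OF v] D01[of v] by simp
  then have "AE \<omega> in ?W. d v t \<omega> = 0"
    unfolding D_def by (subst (asm) integral_nonneg_eq_0_iff_AE)
      (auto intro!: walk_space.integrable_unit_interval d01)
  then show ?thesis by (rule eventually_mono) (simp add: d_def split: if_splits)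
qed

section \<open>Means of tests of the leaf field and their first-step recursion\<close>

definition stopped_mean ::
  "nat \<Rightarrow> nat \<Rightarrow> ((vertex \<Rightarrow> real) \<Rightarrow> real) \<Rightarrow> vertex \<Rightarrow> real \<Rightarrow> (vertex \<Rightarrow> real) \<Rightarrow> real" where
  "stopped_mean b n f v t h = (\<integral>\<omega>. f (\<lambda>x. h x + stopped_field b n v \<omega> t x) \<partial>walk_space b n)"

text \<open>Dependence on the leaves alone hides the time spent at inner vertices and at the root;
  this makes the recursion harmonic between root and leaves. The unit interval as range gives
  integrability and an a priori bound on differences.\<close>

definition leaf_test :: "nat \<Rightarrow> nat \<Rightarrow> ((vertex \<Rightarrow> real) \<Rightarrow> real) \<Rightarrow> bool" where
  "leaf_test b n f \<longleftrightarrow> f \<in> borel_measurable (PiM UNIV (\<lambda>_. borel)) \<and>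
     (\<forall>h. 0 \<le> f h \<and> f h \<le> 1) \<and> (\<forall>h h'. (\<forall>x\<in>leaves b n. h x = h' x) \<longrightarrow> f h = f h')"

lemma leaf_test_bounds: "leaf_test b n f \<Longrightarrow> 0 \<le> f h" "leaf_test b n f \<Longrightarrow> f h \<le> 1"
  by (auto simp: leaf_test_def)

lemma leaf_test_cong: "leaf_test b n f \<Longrightarrow> (\<And>x. x \<in> leaves b n \<Longrightarrow> h x = h' x) \<Longrightarrow> f h = f h'"
  by (auto simp: leaf_test_def)

lemma measurable_leaf_test:
  assumes "leaf_test b n f" "\<And>x. (\<lambda>\<omega>. H \<omega> x) \<in> borel_measurable N"
  shows "(\<lambda>\<omega>. f (H \<omega>)) \<in> borel_measurable N"
proof (rule measurable_compose[where f = H and g = f])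
  show "H \<in> measurable N (PiM UNIV (\<lambda>_. borel))"
    by (rule measurable_PiM_single') (use assms in auto)
qed (use assms in \<open>simp add: leaf_test_def\<close>)

lemma measurable_stopped_mean:
  assumes f: "leaf_test b n f" and [measurable]: "T \<in> borel_measurable N"
    and [measurable]: "\<And>x. (\<lambda>y. H y x) \<in> borel_measurable N"
  shows "(\<lambda>y. stopped_mean b n f v (T y) (H y)) \<in> borel_measurable N"
  unfolding stopped_mean_def
  by (intro walk_space.borel_measurable_lebesgue_integral)
    (unfold split_beta, intro measurable_leaf_test[OF f], measurable)

lemma stopped_mean_bounds:
  assumes "leaf_test b n f"
  shows "0 \<le> stopped_mean b n f v t h" "stopped_mean b n f v t h \<le> 1"
  unfolding stopped_mean_def by (intro walk_space.integral_unit_interval leaf_test_bounds[OF assms])+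

lemma stopped_mean_cong:
  assumes "leaf_test b n f" "\<And>x. x \<in> leaves b n \<Longrightarrow> h x = h' x"
  shows "stopped_mean b n f v t h = stopped_mean b n f v t h'"
  unfolding stopped_mean_def
  by (intro Bochner_Integration.integral_cong leaf_test_cong[OF assms(1)]) (auto simp: assms(2))

text \<open>\<open>h\<close> is the field collected before the present step. The holding time at
  \<open>v\<close> is added to it, and at the root it is also taken off the threshold; if it exceeds
  the threshold there, the walk stops with \<open>h\<close> unchanged.\<close>

lemma stopped_mean_step:
  assumes n: "n \<ge> 1" and b: "b \<ge> 1" and v: "v \<in> tree_vertices b n" and t: "t \<ge> 0"
    and f: "leaf_test b n f"
  defines "c \<equiv> \<lambda>e. e / real (card (neighbours b n v))"
  shows "stopped_mean b n f v t h = nbr_avg b n v (\<lambda>w. \<integral>e.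
    (if t < (if v = \<rho> then c e else 0) then f h
     else stopped_mean b n f w (t - (if v = \<rho> then c e else 0)) (\<lambda>x. h x + (if x = v then c e else 0))) \<partial>std_exp)"
proof -
  let ?W = "walk_space b n"
  let ?h0 = "\<lambda>e. if v = \<rho> then c e else 0"
  define G where "G w e \<omega> = (if t < ?h0 e then f h else
    f (\<lambda>x. h x + (if x = v then c e else 0) + stopped_field b n w \<omega> (t - ?h0 e) x))" for w e \<omega>
  have "stopped_mean b n f v t h = nbr_avg b n v (\<lambda>w. \<integral>e. \<integral>\<omega>. G w e \<omega> \<partial>?W \<partial>std_exp)"
    unfolding stopped_mean_def
  proof (rule integral_first_step[OF n b v])
    show "(\<lambda>X. f (\<lambda>x. h x + stopped_field b n v X t x)) \<in> borel_measurable ?W"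
      by (intro measurable_leaf_test[OF f]) measurable
    show "(\<lambda>(e, \<omega>). G w e \<omega>) \<in> borel_measurable (std_exp \<Otimes>\<^sub>M ?W)" for w
    proof -
      have c: "(\<lambda>x. c (fst x)) \<in> borel_measurable (std_exp \<Otimes>\<^sub>M ?W)"
        unfolding c_def by measurable
      note [measurable] = c
      have "(\<lambda>x. f (\<lambda>y. h y + (if y = v then c (fst x) else 0) +
          stopped_field b n w (snd x) (t - ?h0 (fst x)) y)) \<in> borel_measurable (std_exp \<Otimes>\<^sub>M ?W)"
        by (intro measurable_leaf_test[OF f]) measurable
      note [measurable] = this
      show ?thesis unfolding G_def split_beta by measurable
    qed
    show "0 \<le> G w e \<omega>" "G w e \<omega> \<le> 1" for w e \<omega>
      by (auto simp: G_def leaf_test_bounds[OF f])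
    show "AE X in ?W. f (\<lambda>x. h x + stopped_field b n v X t x) = G (fst (shd X) v) (snd (shd X)) (stl X)"
    proof (rule eventually_mono[OF AE_stops[OF n b v t]])
      fix X assume "stops b n v X t"
      then have "stopped_field b n v X t = (if t < ?h0 (snd (shd X)) then (\<lambda>_. 0)
        else (\<lambda>x. (if x = v then c (snd (shd X)) else 0) +
           stopped_field b n (fst (shd X) v) (stl X) (t - ?h0 (snd (shd X))) x))"
        using stopped_field_Stream[of b n v "shd X" "stl X" t] unfolding c_def by simp
      then show "f (\<lambda>x. h x + stopped_field b n v X t x) = G (fst (shd X) v) (snd (shd X)) (stl X)"
        by (simp add: G_def add.assoc)
    qed
  qed (simp_all add: leaf_test_bounds[OF f])
  also have "\<dots> = nbr_avg b n v (\<lambda>w. \<integral>e.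
    (if t < ?h0 e then f h
     else stopped_mean b n f w (t - ?h0 e) (\<lambda>x. h x + (if x = v then c e else 0))) \<partial>std_exp)"
  proof (rule nbr_avg_cong, rule Bochner_Integration.integral_cong[OF refl])
    fix w e
    show "(\<integral>\<omega>. G w e \<omega> \<partial>?W) = (if t < ?h0 e then f h
     else stopped_mean b n f w (t - ?h0 e) (\<lambda>x. h x + (if x = v then c e else 0)))"
      using walk_space.prob_space[of b n] by (simp add: G_def stopped_mean_def)
  qed
  finally show ?thesis .
qed

lemma stopped_mean_nonroot:
  assumes "n \<ge> 1" "b \<ge> 1" "v \<in> tree_vertices b n" "v \<noteq> []" "t \<ge> 0" "leaf_test b n f"
  shows "stopped_mean b n f v t h = nbr_avg b n v (\<lambda>w. \<integral>e.
    stopped_mean b n f w t (\<lambda>x. h x + (if x = v then e / real (card (neighbours b n v)) else 0)) \<partial>std_exp)"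
  using stopped_mean_step[OF assms(1-3,5,6), of h] assms(4,5) by (simp add: root_def cong: if_cong)

lemma root_notin_leaves: "n \<ge> 1 \<Longrightarrow> [] \<notin> leaves b n"
  by (simp add: leaves_def)

lemma stopped_mean_root:
  assumes "n \<ge> 1" "b \<ge> 1" "t \<ge> 0" "leaf_test b n f"
  shows "stopped_mean b n f [] t h = nbr_avg b n [] (\<lambda>w. \<integral>e.
    (if t < e / real b then f h else stopped_mean b n f w (t - e / real b) h) \<partial>std_exp)"
proof -
  have "stopped_mean b n f w s (\<lambda>x. h x + (if x = [] then c else 0)) = stopped_mean b n f w s h" for w s c
    by (rule stopped_mean_cong[OF assms(4)]) (use root_notin_leaves[OF assms(1)] in auto)
  then show ?thesis
    using stopped_mean_step[OF assms(1,2) root_in_tree assms(3,4), of h] assms(1)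
    by (simp add: root_def card_neighbours_root cong: if_cong)
qed

text \<open>The supremum over \<open>h\<close> of the difference is subharmonic in \<open>v\<close>
  off the root, since a supremum does not notice how \<open>inc\<close> moves \<open>h\<close>. The
  map \<open>inc\<close> is left abstract so that trees of different depths can be compared under
  one common way of collecting local time.\<close>

theorem field_comparison:
  fixes A B :: "vertex \<Rightarrow> 'h \<Rightarrow> real" and inc :: "vertex \<Rightarrow> 'h \<Rightarrow> real \<Rightarrow> 'h"
  assumes n: "n \<ge> 1" and b: "b \<ge> 1"
    and A01: "\<And>v h. 0 \<le> A v h" "\<And>v h. A v h \<le> 1"
    and B01: "\<And>v h. 0 \<le> B v h" "\<And>v h. B v h \<le> 1"
    and Am: "\<And>v w h. (\<lambda>e. A w (inc v h e)) \<in> borel_measurable std_exp"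
    and Bm: "\<And>v w h. (\<lambda>e. B w (inc v h e)) \<in> borel_measurable std_exp"
    and A: "\<And>v h. v \<in> tree_vertices b n \<Longrightarrow> v \<noteq> [] \<Longrightarrow>
      A v h = nbr_avg b n v (\<lambda>w. \<integral>e. A w (inc v h e) \<partial>std_exp)"
    and B: "\<And>v h. v \<in> tree_vertices b n \<Longrightarrow> v \<noteq> [] \<Longrightarrow>
      B v h = nbr_avg b n v (\<lambda>w. \<integral>e. B w (inc v h e) \<partial>std_exp)"
    and root: "\<And>h. \<bar>A [] h - B [] h\<bar> \<le> a"
    and v: "v \<in> tree_vertices b n"
  shows "\<bar>A v h - B v h\<bar> \<le> a"
proof -
  define D where "D v = (SUP h. \<bar>A v h - B v h\<bar>)" for v
  have "\<bar>A v h - B v h\<bar> \<le> 1" for v h using A01[of v h] B01[of v h] by linarith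
  then have bdd: "bdd_above (range (\<lambda>h. \<bar>A v h - B v h\<bar>))" for v by (intro bdd_aboveI2)
  have le: "\<bar>A v h - B v h\<bar> \<le> D v" for v h
    unfolding D_def by (rule cSUP_upper[OF _ bdd]) simp
  have "D u \<le> D []" if u: "u \<in> tree_vertices b n" for u
  proof (rule maximum_principle[OF n b _ u])
    fix v assume v: "v \<in> tree_vertices b n" "v \<noteq> []"
    show "D v \<le> nbr_avg b n v D"
      unfolding D_def[of v]
    proof (rule cSUP_least)
      fix h
      have "\<bar>A v h - B v h\<bar> =
          \<bar>nbr_avg b n v (\<lambda>w. (\<integral>e. A w (inc v h e) \<partial>std_exp) - (\<integral>e. B w (inc v h e) \<partial>std_exp))\<bar>"
        unfolding A[OF v] B[OF v] nbr_avg_diff ..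
      also have "\<dots> \<le> nbr_avg b n v (\<lambda>w. \<bar>(\<integral>e. A w (inc v h e) \<partial>std_exp) - (\<integral>e. B w (inc v h e) \<partial>std_exp)\<bar>)"
        by (rule abs_nbr_avg_le)
      also have "\<dots> \<le> nbr_avg b n v D"
      proof (rule nbr_avg_mono)
        fix w
        have i: "integrable std_exp (\<lambda>e. A w (inc v h e))" "integrable std_exp (\<lambda>e. B w (inc v h e))"
          by (intro std_exp.integrable_unit_interval Am Bm A01 B01)+
        have "\<bar>(\<integral>e. A w (inc v h e) \<partial>std_exp) - (\<integral>e. B w (inc v h e) \<partial>std_exp)\<bar>
          = \<bar>\<integral>e. A w (inc v h e) - B w (inc v h e) \<partial>std_exp\<bar>" using i by simp
        also have "\<dots> \<le> (\<integral>e. \<bar>A w (inc v h e) - B w (inc v h e)\<bar> \<partial>std_exp)"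
          by (rule integral_abs_bound)
        also have "\<dots> \<le> (\<integral>e. D w \<partial>std_exp)" using i le by (intro integral_mono) auto
        also have "\<dots> = D w" using std_exp.prob_space by simp
        finally show "\<bar>(\<integral>e. A w (inc v h e) \<partial>std_exp) - (\<integral>e. B w (inc v h e) \<partial>std_exp)\<bar> \<le> D w" .
      qed
      finally show "\<bar>A v h - B v h\<bar> \<le> nbr_avg b n v D" .
    qed simp
  qed
  moreover have "D [] \<le> a" unfolding D_def by (rule cSUP_least) (use root in auto)
  ultimately show ?thesis using le[of v h] v by fastforce
qed

section \<open>Expansion for short root local time\<close>

lemma stopped_mean_root_close:
  assumes n: "n \<ge> 1" and b: "b \<ge> 1" and t: "t \<ge> 0" and f: "leaf_test b n f"
  shows "\<bar>stopped_mean b n f [] t h - f h\<bar> \<le> 1 - exp (- real b * t)"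
proof -
  let ?I = "\<lambda>w e. if t < e / real b then f h else stopped_mean b n f w (t - e / real b) h"
  have Im: "?I w \<in> borel_measurable std_exp" for w
  proof -
    have [measurable]: "(\<lambda>e. stopped_mean b n f w (t - e / real b) h) \<in> borel_measurable std_exp"
      by (intro measurable_stopped_mean[OF f]) measurable
    show ?thesis by measurable
  qed
  have I01: "0 \<le> ?I w e" "?I w e \<le> 1" for w e
    by (auto simp: leaf_test_bounds[OF f] stopped_mean_bounds[OF f])
  have "\<bar>(\<integral>e. ?I w e \<partial>std_exp) - f h\<bar> \<le> 1 - exp (- real b * t)" for w
  proof -
    have int: "integrable std_exp (?I w)" by (intro std_exp.integrable_unit_interval Im I01)
    have "\<bar>(\<integral>e. ?I w e \<partial>std_exp) - f h\<bar> = \<bar>\<integral>e. ?I w e - f h \<partial>std_exp\<bar>"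
      using std_exp.prob_space int by simp
    also have "\<dots> \<le> (\<integral>e. \<bar>?I w e - f h\<bar> \<partial>std_exp)" by (rule integral_abs_bound)
    also have "\<dots> \<le> (\<integral>e. indicator {..real b * t} e \<partial>std_exp)"
    proof (intro integral_mono)
      show "integrable std_exp (\<lambda>e. \<bar>?I w e - f h\<bar>)" using int by auto
      show "integrable std_exp (\<lambda>e. indicator {..real b * t} e :: real)"
        by (intro std_exp.integrable_unit_interval) (auto simp: indicator_def)
      show "\<bar>?I w e - f h\<bar> \<le> indicator {..real b * t} e" for e
      proof (cases "t < e / real b")
        case False
        then have "e \<le> real b * t" using b by (simp add: field_simps)
        then show ?thesis using I01[of e w] leaf_test_bounds[OF f, of h] by (auto simp: abs_le_iff)
      qed simp
    qed
    also have "\<dots> = 1 - exp (- real b * t)" using t by (simp add: std_exp_atMost)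
    finally show ?thesis .
  qed
  then have *: "nbr_avg b n [] (\<lambda>w. \<bar>(\<integral>e. ?I w e \<partial>std_exp) - f h\<bar>) \<le> 1 - exp (- real b * t)"
    by (intro nbr_avg_le[OF n b]) auto
  have "stopped_mean b n f [] t h - f h = nbr_avg b n [] (\<lambda>w. (\<integral>e. ?I w e \<partial>std_exp) - f h)"
    unfolding nbr_avg_diff stopped_mean_root[OF n b t f] using nbr_avg_const[OF n b root_in_tree] by simp
  then show ?thesis using * abs_nbr_avg_le[of b n "[]" "\<lambda>w. (\<integral>e. ?I w e \<partial>std_exp) - f h"] by linarith
qed

lemma stopped_mean_root_0:
  assumes "n \<ge> 1" "b \<ge> 1" "leaf_test b n f"
  shows "stopped_mean b n f [] 0 h = f h"
  using stopped_mean_root_close[OF assms(1,2) order.refl assms(3), of h] by simp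

text \<open>Off the root the recursion does not touch the threshold, so the means for
  \<open>t\<close> and for 0 obey the same one and differ by at most their difference at the root.
  There the mean for 0 is \<open>f h\<close> itself.\<close>

lemma stopped_mean_time_0:
  assumes n: "n \<ge> 1" and b: "b \<ge> 1" and t: "t \<ge> 0" and f: "leaf_test b n f"
    and v: "v \<in> tree_vertices b n"
  shows "\<bar>stopped_mean b n f v t h - stopped_mean b n f v 0 h\<bar> \<le> 1 - exp (- real b * t)"
proof (rule field_comparison[OF n b, where A = "\<lambda>v. stopped_mean b n f v t" and B = "\<lambda>v. stopped_mean b n f v 0"
      and inc = "\<lambda>v h e x. h x + (if x = v then e / real (card (neighbours b n v)) else 0)"])
  show "\<bar>stopped_mean b n f [] t h - stopped_mean b n f [] 0 h\<bar> \<le> 1 - exp (- real b * t)" for h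
    using stopped_mean_root_close[OF n b t f] by (simp add: stopped_mean_root_0[OF n b f])
qed (use n b t f v in \<open>auto intro!: stopped_mean_nonroot stopped_mean_bounds measurable_stopped_mean\<close>)

text \<open>With probability \<open>a\<close> the first sojourn at the root ends before
  \<open>t\<close>. Then the remaining threshold is replaced by 0, which means returning to the root
  stops the walk; this costs at most another factor \<open>a\<close>, the chance of a further
  departure from the root.\<close>

theorem stopped_mean_small_time:
  assumes n: "n \<ge> 1" and b: "b \<ge> 1" and t: "t \<ge> 0" and f: "leaf_test b n f"
  defines "a \<equiv> 1 - exp (- real b * t)"
  shows "\<bar>stopped_mean b n f [] t h - ((1 - a) * f h + a * nbr_avg b n [] (\<lambda>w. stopped_mean b n f w 0 h))\<bar> \<le> a\<^sup>2"
proof -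
  have a: "0 \<le> a" using t by (simp add: a_def)
  let ?I = "\<lambda>w e. if t < e / real b then f h else stopped_mean b n f w (t - e / real b) h"
  let ?J = "\<lambda>w e. if t < e / real b then f h else stopped_mean b n f w 0 h"
  have Im: "?I w \<in> borel_measurable std_exp" for w
  proof -
    have [measurable]: "(\<lambda>e. stopped_mean b n f w (t - e / real b) h) \<in> borel_measurable std_exp"
      by (intro measurable_stopped_mean[OF f]) measurable
    show ?thesis by measurable
  qed
  have I: "integrable std_exp (?I w)" for w
    by (intro std_exp.integrable_unit_interval Im) (auto simp: leaf_test_bounds[OF f] stopped_mean_bounds[OF f])
  have J: "integrable std_exp (?J w)" for w
    by (intro std_exp.integrable_unit_interval) (auto simp: leaf_test_bounds[OF f] stopped_mean_bounds[OF f])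
  have ind: "integrable std_exp (\<lambda>e. indicator {..real b * t} e :: real)"
    by (intro std_exp.integrable_unit_interval) (auto simp: indicator_def)
  have i: "(\<integral>e. indicator {..real b * t} e \<partial>std_exp) = a"
    using t by (simp add: std_exp_atMost a_def)
  have J_eq: "(\<integral>e. ?J w e \<partial>std_exp) = (1 - a) * f h + a * stopped_mean b n f w 0 h" for w
  proof -
    have "?J w e = f h + indicator {..real b * t} e * (stopped_mean b n f w 0 h - f h)" for e
      using b by (auto simp: indicator_def field_simps)
    then have "(\<integral>e. ?J w e \<partial>std_exp) = f h + a * (stopped_mean b n f w 0 h - f h)"
      using ind std_exp.prob_space by (simp add: i[symmetric])
    then show ?thesis by (simp add: algebra_simps)
  qed
  have close: "\<bar>(\<integral>e. ?I w e \<partial>std_exp) - (\<integral>e. ?J w e \<partial>std_exp)\<bar> \<le> a\<^sup>2" if w: "w \<in> neighbours b n []" for w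
  proof -
    have "\<bar>(\<integral>e. ?I w e \<partial>std_exp) - (\<integral>e. ?J w e \<partial>std_exp)\<bar> = \<bar>\<integral>e. ?I w e - ?J w e \<partial>std_exp\<bar>"
      using I J by simp
    also have "\<dots> \<le> (\<integral>e. \<bar>?I w e - ?J w e\<bar> \<partial>std_exp)" by (rule integral_abs_bound)
    also have "\<dots> \<le> (\<integral>e. indicator {..real b * t} e * a \<partial>std_exp)"
    proof (rule integral_mono_AE)
      show "integrable std_exp (\<lambda>e. \<bar>?I w e - ?J w e\<bar>)" using I J by auto
      show "integrable std_exp (\<lambda>e. indicator {..real b * t} e * a)" using ind by simp
      show "AE e in std_exp. \<bar>?I w e - ?J w e\<bar> \<le> indicator {..real b * t} e * a"
      proof (rule eventually_mono[OF AE_std_exp_pos])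
        fix e :: real assume e: "0 < e"
        show "\<bar>?I w e - ?J w e\<bar> \<le> indicator {..real b * t} e * a"
        proof (cases "t < e / real b")
          case False
          then have le: "e \<le> real b * t" "0 \<le> t - e / real b" using b by (simp_all add: field_simps)
          have "\<bar>?I w e - ?J w e\<bar> \<le> 1 - exp (- real b * (t - e / real b))"
            using False stopped_mean_time_0[OF n b le(2) f neighbours_subset_tree[OF w]] by simp
          also have "\<dots> \<le> a" using e b by (simp add: a_def algebra_simps)
          finally show ?thesis using le by simp
        qed (use a in simp)
      qed
    qed
    also have "\<dots> = a\<^sup>2" using ind by (simp add: i[symmetric] power2_eq_square)
    finally show ?thesis .
  qed
  have "stopped_mean b n f [] t h - ((1 - a) * f h + a * nbr_avg b n [] (\<lambda>w. stopped_mean b n f w 0 h))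
      = nbr_avg b n [] (\<lambda>w. (\<integral>e. ?I w e \<partial>std_exp) - (\<integral>e. ?J w e \<partial>std_exp))"
  proof -
    have "nbr_avg b n [] (\<lambda>w. \<integral>e. ?J w e \<partial>std_exp)
        = (1 - a) * f h + a * nbr_avg b n [] (\<lambda>w. stopped_mean b n f w 0 h)"
      using nbr_avg_const[OF n b root_in_tree, of "- ((1 - a) * f h)"]
        nbr_avg_diff[of b n "[]" "\<lambda>w. a * stopped_mean b n f w 0 h" "\<lambda>_. - ((1 - a) * f h)"]
      unfolding J_eq by (simp add: nbr_avg_cmult add.commute)
    then show ?thesis unfolding nbr_avg_diff stopped_mean_root[OF n b t f] by simp
  qed
  moreover have "nbr_avg b n [] (\<lambda>w. \<bar>(\<integral>e. ?I w e \<partial>std_exp) - (\<integral>e. ?J w e \<partial>std_exp)\<bar>) \<le> a\<^sup>2"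
    by (rule nbr_avg_le[OF n b root_in_tree close])
  ultimately show ?thesis
    using abs_nbr_avg_le[of b n "[]" "\<lambda>w. (\<integral>e. ?I w e \<partial>std_exp) - (\<integral>e. ?J w e \<partial>std_exp)"] by linarith
qed

section \<open>Symmetry and the probability of escaping to the leaves\<close>

text \<open>Tree automorphisms that permute child labels in a way depending only on the depth of the
  parent. These already act transitively on the leaves.\<close>

primrec relabel :: "(nat \<Rightarrow> nat \<Rightarrow> nat) \<Rightarrow> vertex \<Rightarrow> vertex" where
  "relabel \<pi> [] = []"
| "relabel \<pi> (i # v) = \<pi> (length v) i # relabel \<pi> v"

lemma length_relabel [simp]: "length (relabel \<pi> v) = length v"
  by (induction v) auto

lemma relabel_eq_Nil [simp]: "relabel \<pi> v = [] \<longleftrightarrow> v = []"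
  by (cases v) auto

text \<open>At each depth the labels of the two paths are swapped by a transposition, so the
  resulting map is its own inverse. The reversal is due to lists storing the most recent label
  first.\<close>

lemma exists_relabel:
  assumes "x \<in> leaves b n" "y \<in> leaves b n"
  shows "\<exists>\<pi>. (\<forall>k i. \<pi> k (\<pi> k i) = i) \<and> (\<forall>k. \<forall>i<b. \<pi> k i < b) \<and> relabel \<pi> x = y"
proof -
  define \<pi> where "\<pi> k = (if k < n then Transposition.transpose (rev x ! k) (rev y ! k) else id)" for k
  have len: "length x = n" "length y = n" and x: "set x \<subseteq> {..<b}" and y: "set y \<subseteq> {..<b}"
    using assms by (auto simp: leaves_def tree_vertices_def)
  have "rev x ! k < b" "rev y ! k < b" if "k < n" for k
    using that len x y nth_mem[of k "rev x"] nth_mem[of k "rev y"] by auto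
  then have "\<pi> k i < b" if "i < b" for k i
    using that by (auto simp: \<pi>_def Transposition.transpose_def)
  moreover have "\<pi> k (\<pi> k i) = i" for k i
    by (auto simp: \<pi>_def)
  moreover have "relabel \<pi> u = v" if "length u = length v" "length u \<le> n"
      "\<forall>k<length u. rev x ! k = rev u ! k \<and> rev y ! k = rev v ! k" for u v
    using that
  proof (induction u v rule: list_induct2)
    case (Cons i u j v)
    have "relabel \<pi> u = v"
    proof (rule Cons.IH)
      show "\<forall>k<length u. rev x ! k = rev u ! k \<and> rev y ! k = rev v ! k"
      proof (intro allI impI)
        fix k assume k: "k < length u"
        then show "rev x ! k = rev u ! k \<and> rev y ! k = rev v ! k"
          using Cons.prems(2) Cons.hyps by (simp add: nth_append less_Suc_eq)
      qed
    qed (use Cons.prems in simp)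
    moreover have "rev x ! length u = i \<and> rev y ! length u = j"
      using Cons.prems(2)[rule_format, of "length u"] Cons.hyps by (simp add: nth_append)
    then have "\<pi> (length u) i = j"
      using Cons.prems(1) by (auto simp: \<pi>_def)
    ultimately show ?case by simp
  qed simp
  then have "relabel \<pi> x = y" using len by simp
  ultimately show ?thesis by blast
qed

lemma relabel_involution:
  assumes "\<And>k i. \<pi> k (\<pi> k i) = i"
  shows "relabel \<pi> (relabel \<pi> v) = v"
  using assms by (induction v) auto

lemma relabel_in_tree:
  assumes "\<And>k i. i < b \<Longrightarrow> \<pi> k i < b" "v \<in> tree_vertices b n"
  shows "relabel \<pi> v \<in> tree_vertices b n"
  using assms(2) by (induction v) (auto simp: Cons_in_tree assms(1))

lemma neighbours_relabel:
  assumes inv: "\<And>k i. \<pi> k (\<pi> k i) = i" and lt: "\<And>k i. i < b \<Longrightarrow> \<pi> k i < b"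
  shows "neighbours b n (relabel \<pi> v) = relabel \<pi> ` neighbours b n v"
proof -
  have sub: "relabel \<pi> ` neighbours b n v \<subseteq> neighbours b n (relabel \<pi> v)" for v
    using relabel_in_tree[of b \<pi>, OF lt] by (fastforce simp: neighbours_def)
  have "w \<in> relabel \<pi> ` neighbours b n v" if "w \<in> neighbours b n (relabel \<pi> v)" for w
  proof
    show "w = relabel \<pi> (relabel \<pi> w)" by (simp add: relabel_involution inv)
    show "relabel \<pi> w \<in> neighbours b n v"
      using sub[of "relabel \<pi> v"] that by (auto simp: relabel_involution inv)
  qed
  then show ?thesis using sub[of v] by blast
qed

text \<open>An automorphism carries the recursion to itself once the collected field is moved along
  with the vertex. At the root the two sides agree by the symmetry of \<open>f\<close>, so
  \<open>field_comparison\<close> applies with bound 0.\<close>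

theorem stopped_mean_leaf_symmetric:
  assumes n: "n \<ge> 1" and b: "b \<ge> 1" and f: "leaf_test b n f"
    and sym: "\<And>h \<sigma>. bij_betw \<sigma> (leaves b n) (leaves b n) \<Longrightarrow> f (h \<circ> \<sigma>) = f h"
    and x: "x \<in> leaves b n" and y: "y \<in> leaves b n"
  shows "stopped_mean b n f x 0 (\<lambda>_. 0) = stopped_mean b n f y 0 (\<lambda>_. 0)"
proof -
  obtain \<pi> where inv: "\<And>k i. \<pi> k (\<pi> k i) = i" and lt: "\<And>k i. i < b \<Longrightarrow> \<pi> k i < b"
    and xy: "relabel \<pi> x = y"
    using exists_relabel[OF x y] by blast
  let ?\<sigma> = "relabel \<pi>"
  have inv\<sigma>: "?\<sigma> (?\<sigma> v) = v" for v by (rule relabel_involution[OF inv])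
  have inj: "inj_on ?\<sigma> A" for A by (rule inj_on_inverseI[of _ ?\<sigma>]) (rule inv\<sigma>)
  have tree: "?\<sigma> v \<in> tree_vertices b n" if "v \<in> tree_vertices b n" for v
    using that by (intro relabel_in_tree lt)
  have leaf: "?\<sigma> v \<in> leaves b n" if "v \<in> leaves b n" for v
    using that tree[of v] by (simp add: leaves_def)
  have "bij_betw ?\<sigma> (leaves b n) (leaves b n)"
    by (rule bij_betw_byWitness[where f' = ?\<sigma>]) (use leaf in \<open>auto simp: inv\<sigma>\<close>)
  then have f\<sigma>: "f (h \<circ> ?\<sigma>) = f h" for h by (rule sym)
  have card: "card (neighbours b n (?\<sigma> v)) = card (neighbours b n v)" for v
    by (simp add: neighbours_relabel[OF inv lt] card_image[OF inj])
  have avg: "nbr_avg b n (?\<sigma> v) D = nbr_avg b n v (\<lambda>w. D (?\<sigma> w))" for v D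
    unfolding nbr_avg_def card by (simp add: neighbours_relabel[OF inv lt] sum.reindex[OF inj])
  have "\<bar>stopped_mean b n f x 0 (\<lambda>_. 0) - stopped_mean b n f (?\<sigma> x) 0 ((\<lambda>_. 0) \<circ> ?\<sigma>)\<bar> \<le> 0"
  proof (rule field_comparison[OF n b, where A = "\<lambda>v. stopped_mean b n f v 0"
        and B = "\<lambda>v h. stopped_mean b n f (?\<sigma> v) 0 (h \<circ> ?\<sigma>)"
        and inc = "\<lambda>v h e x. h x + (if x = v then e / real (card (neighbours b n v)) else 0)"])
    fix v and h :: "vertex \<Rightarrow> real" assume v: "v \<in> tree_vertices b n" "v \<noteq> []"
    have eq: "(\<lambda>x. (h \<circ> ?\<sigma>) x + (if x = ?\<sigma> v then c else 0)) = (\<lambda>x. h x + (if x = v then c else 0)) \<circ> ?\<sigma>" for c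
      using inv\<sigma> by (auto simp: fun_eq_iff)
    show "stopped_mean b n f (?\<sigma> v) 0 (h \<circ> ?\<sigma>) = nbr_avg b n v (\<lambda>w. \<integral>e.
        stopped_mean b n f (?\<sigma> w) 0 ((\<lambda>x. h x + (if x = v then e / real (card (neighbours b n v)) else 0)) \<circ> ?\<sigma>) \<partial>std_exp)"
      using stopped_mean_nonroot[OF n b tree[OF v(1)] _ order.refl f, of "h \<circ> ?\<sigma>"] v(2)
      unfolding avg card eq by simp
  next
    show "\<bar>stopped_mean b n f [] 0 h - stopped_mean b n f (?\<sigma> []) 0 (h \<circ> ?\<sigma>)\<bar> \<le> 0" for h
      by (simp add: stopped_mean_root_0[OF n b f] f\<sigma>)
  next
    show "(\<lambda>e. stopped_mean b n f (?\<sigma> w) 0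
       ((\<lambda>x. h x + (if x = v then e / real (card (neighbours b n v)) else 0)) \<circ> ?\<sigma>)) \<in> borel_measurable std_exp" for v w h
      by (intro measurable_stopped_mean[OF f]) (simp_all add: comp_def)
  qed (use n b f x in \<open>auto intro!: stopped_mean_nonroot stopped_mean_bounds measurable_stopped_mean leaves_subset_tree\<close>)
  then show ?thesis by (simp add: xy comp_def)
qed

text \<open>The weight of \<open>\<theta>\<close> is the probability, from depth \<open>length v\<close>, of reaching the leaves before
  the root.\<close>

theorem stopped_mean_harmonic:
  assumes n: "n \<ge> 1" and b: "b \<ge> 2" and f: "leaf_test b n f"
    and leaf: "\<And>x. x \<in> leaves b n \<Longrightarrow> stopped_mean b n f x 0 h = \<theta>"
    and v: "v \<in> tree_vertices b n"
  defines "g \<equiv> \<lambda>k. (1 - (1 / real b) ^ k) / (1 - (1 / real b) ^ n)"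
  shows "stopped_mean b n f v 0 h = (1 - g (length v)) * f h + g (length v) * \<theta>"
proof -
  have b1: "b \<ge> 1" using b by simp
  define r where "r = 1 / real b"
  have r: "0 < r" "r < 1" "real b * r = 1" using b by (auto simp: r_def)
  have rn: "1 - r ^ n > 0" using r n by (simp add: power_less_one_iff)
  define D where "D v = stopped_mean b n f v 0 h - ((1 - g (length v)) * f h + g (length v) * \<theta>)" for v
  have g: "g k = (1 - r ^ k) / (1 - r ^ n)" for k by (simp add: g_def r_def)
  \<comment> \<open>The gambler's ruin for a walk in depth that moves away from the root with weight
    \<open>b\<close> and back with weight 1: \<open>r ^ k\<close> is harmonic because
    \<open>b * r = 1\<close>, and \<open>g\<close> is the affine image of it with
    \<open>g 0 = 0\<close> and \<open>g n = 1\<close>.\<close>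
  have ghar: "(g k + real b * g (Suc (Suc k))) / (real b + 1) = g (Suc k)" for k
  proof -
    have "(1 - o') + x * (1 - q) = (x + 1) * (1 - p)" if "x * q = p" "o' = x * p" for x o' p q :: real
      unfolding that(2) using that(1) by (simp add: ring_distribs)
    moreover have "real b * r ^ Suc m = r ^ m" for m
      by (simp only: power_Suc mult.assoc[symmetric] r(3) mult_1_left)
    ultimately have "(1 - r ^ k) + real b * (1 - r ^ Suc (Suc k)) = (real b + 1) * (1 - r ^ Suc k)"
      by metis
    moreover have "(g k + real b * g (Suc (Suc k))) / (real b + 1)
        = ((1 - r ^ k) + real b * (1 - r ^ Suc (Suc k))) / (1 - r ^ n) / (real b + 1)"
      by (simp only: g times_divide_eq_right add_divide_distrib)
    ultimately show ?thesis unfolding g by simp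
  qed
  have D0: "D [] = 0" by (simp add: D_def g_def stopped_mean_root_0[OF n b1 f])
  have Dleaf: "D x = 0" if "x \<in> leaves b n" for x
    using leaf[OF that] that rn by (simp add: D_def g leaves_def)
  have Dint: "nbr_avg b n u D = D u" if u: "u \<in> tree_vertices b n" "u \<noteq> []" "length u < n" for u
  proof -
    \<comment> \<open>Time spent at an inner vertex is invisible to a leaf test, so here the
      recursion is plain harmonicity with \<open>h\<close> fixed.\<close>
    have "stopped_mean b n f w 0 (\<lambda>x. h x + (if x = u then c else 0)) = stopped_mean b n f w 0 h" for w c
      by (rule stopped_mean_cong[OF f]) (use u(3) in \<open>auto simp: leaves_def\<close>)
    then have 1: "stopped_mean b n f u 0 h = nbr_avg b n u (\<lambda>w. stopped_mean b n f w 0 h)"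
      using stopped_mean_nonroot[OF n b1 u(1,2) order.refl f, of h] std_exp.prob_space by simp
    obtain k where k: "length u = Suc k" using u(2) by (cases u) auto
    have "nbr_avg b n u (\<lambda>w. g (length w)) = g (length u)"
      unfolding nbr_avg_interior[OF u] using ghar[of k] by (simp add: k)
    then have 2: "nbr_avg b n u (\<lambda>w. (\<theta> - f h) * g (length w) - (- f h))
        = (\<theta> - f h) * g (length u) + f h"
      unfolding nbr_avg_diff nbr_avg_cmult nbr_avg_const[OF n b1 u(1)] by simp
    have D: "D w = stopped_mean b n f w 0 h - ((\<theta> - f h) * g (length w) - (- f h))" for w
      by (simp add: D_def algebra_simps)
    show ?thesis unfolding D[abs_def] nbr_avg_diff[of _ _ _ "\<lambda>w. stopped_mean b n f w 0 h"] 1[symmetric] 2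
      by simp
  qed
  \<comment> \<open>The maximum principle has no boundary at the leaves; as \<open>D\<close>
    vanishes there, its absolute value is subharmonic at the leaves too.\<close>
  have "\<bar>D v\<bar> \<le> \<bar>D []\<bar>"
  proof (rule maximum_principle[OF n b1 _ v])
    fix u assume u: "u \<in> tree_vertices b n" "u \<noteq> []"
    show "\<bar>D u\<bar> \<le> nbr_avg b n u (\<lambda>w. \<bar>D w\<bar>)"
    proof (cases "length u < n")
      case True
      then show ?thesis using Dint[OF u True] abs_nbr_avg_le[of b n u D] by simp
    next
      case False
      then have "u \<in> leaves b n" using u(1) by (auto simp: leaves_def tree_vertices_def)
      then show ?thesis using Dleaf by (auto simp: nbr_avg_def intro!: divide_nonneg_nonneg sum_nonneg)
    qed
  qed
  then have "D v = 0" using D0 by simp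
  then show ?thesis by (simp add: D_def)
qed

section \<open>Tilting and lack of memory of exponential variables\<close>

lemma integral_exp_std_exp:
  assumes "0 \<le> c"
  shows "(\<integral>e. exp (- (c * e)) \<partial>std_exp) = 1 / (1 + c)"
proof -
  interpret E: prob_space "density lborel (exponential_density (1 + c))"
    using assms by (intro prob_space_exponential_density) simp
  have "(\<integral>e. exp (- (c * e)) \<partial>std_exp) = (\<integral>e. exponential_density 1 e * exp (- (c * e)) \<partial>lborel)"
    by (subst integral_density) (auto simp: exponential_density_nonneg)
  also have "\<dots> = (\<integral>e. exponential_density (1 + c) e * (1 / (1 + c)) \<partial>lborel)"
    using assms by (intro Bochner_Integration.integral_cong)
      (auto simp: exponential_density_def exp_add[symmetric] field_simps)
  also have "\<dots> = (\<integral>e. 1 / (1 + c) \<partial>density lborel (exponential_density (1 + c)))"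
    using assms by (subst integral_density) (auto simp: exponential_density_nonneg)
  also have "\<dots> = 1 / (1 + c)" using E.prob_space by simp
  finally show ?thesis .
qed

text \<open>Lack of memory: moving the density by \<open>c\<close> multiplies it by
  \<open>exp (- c)\<close>. The endpoint \<open>c\<close> is a null set, which reconciles the strict
  inequality with the distribution function.\<close>

lemma integral_std_exp_shift:
  fixes X :: "real \<Rightarrow> real"
  assumes X: "X \<in> borel_measurable borel" "\<And>t. 0 \<le> X t" "\<And>t. X t \<le> 1" and c: "0 \<le> c"
  shows "(\<integral>t. (if t < c then A else X (t - c)) \<partial>std_exp) = (1 - exp (- c)) * A + exp (- c) * (\<integral>t. X t \<partial>std_exp)"
proof -
  note [measurable] = X(1)
  have indc: "integrable std_exp (\<lambda>t. indicator {..<c} t :: real)"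
    by (intro std_exp.integrable_unit_interval) (auto simp: indicator_def)
  have iX: "integrable std_exp (\<lambda>t. indicator {c..} t * X (t - c))"
    using X by (intro std_exp.integrable_unit_interval) (auto simp: indicator_def)
  have "(if t < c then A else X (t - c)) = indicator {..<c} t * A + indicator {c..} t * X (t - c)" for t
    by (auto simp: indicator_def)
  then have "(\<integral>t. (if t < c then A else X (t - c)) \<partial>std_exp)
      = (\<integral>t. indicator {..<c} t \<partial>std_exp) * A + (\<integral>t. indicator {c..} t * X (t - c) \<partial>std_exp)"
    using indc iX by simp
  also have "(\<integral>t. indicator {..<c} t \<partial>std_exp) = (\<integral>t. (indicator {..c} t :: real) \<partial>std_exp)"
  proof (rule integral_cong_AE)
    have "AE t in lborel. t \<noteq> c" by (rule AE_lborel_singleton)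
    then have "AE t in std_exp. t \<noteq> c"
      by (subst AE_density) auto
    then show "AE t in std_exp. indicator {..<c} t = (indicator {..c} t :: real)"
      by (rule eventually_mono) (auto simp: indicator_def)
  qed auto
  also have "\<dots> = 1 - exp (- c)" using c by (simp add: std_exp_atMost)
  also have "(\<integral>t. indicator {c..} t * X (t - c) \<partial>std_exp)
      = (\<integral>t. exponential_density 1 t * (indicator {c..} t * X (t - c)) \<partial>lborel)"
    by (subst integral_density) (auto simp: exponential_density_nonneg)
  also have "\<dots> = (\<integral>s. exponential_density 1 (c + 1 * s) * (indicator {c..} (c + 1 * s) * X (c + 1 * s - c)) \<partial>lborel)"
    by (subst lborel_integral_real_affine[of 1 _ c]) auto
  also have "\<dots> = (\<integral>s. exponential_density 1 s * (exp (- c) * X s) \<partial>lborel)"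
    using c by (intro Bochner_Integration.integral_cong)
      (auto simp: exponential_density_def indicator_def exp_add[symmetric] exp_diff[symmetric])
  also have "\<dots> = (\<integral>s. exp (- c) * X s \<partial>std_exp)"
    by (subst integral_density) (auto simp: exponential_density_nonneg)
  finally show ?thesis by simp
qed

section \<open>Exponential root local time\<close>

interpretation std_exp_pair: pair_prob_space std_exp std_exp
  by unfold_locales

lemma integral_swap_std_exp:
  fixes F :: "real \<Rightarrow> real \<Rightarrow> real"
  assumes "(\<lambda>x. F (fst x) (snd x)) \<in> borel_measurable (std_exp \<Otimes>\<^sub>M std_exp)"
    "\<And>s t. 0 \<le> F s t" "\<And>s t. F s t \<le> 1"
  shows "(\<integral>s. \<integral>t. F s t \<partial>std_exp \<partial>std_exp) = (\<integral>t. \<integral>s. F s t \<partial>std_exp \<partial>std_exp)"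
proof (rule std_exp_pair.Fubini_integral[symmetric])
  show "integrable (std_exp \<Otimes>\<^sub>M std_exp) (case_prod F)"
    using assms by (intro std_exp_pair.P.integrable_unit_interval) (auto simp: split_beta')
qed

text \<open>A race between clocks of rates 1 and \<open>b\<close>: the threshold \<open>t\<close>
  rings first with probability \<open>1 / (b + 1)\<close>; otherwise what remains of it after
  \<open>e / b\<close> is again standard exponential.\<close>

lemma integral_memoryless:
  fixes X :: "real \<Rightarrow> real"
  assumes X: "X \<in> borel_measurable borel" "\<And>t. 0 \<le> X t" "\<And>t. X t \<le> 1"
    and A: "0 \<le> A" "A \<le> 1" and b: "b \<ge> 1"
  shows "(\<integral>t. \<integral>e. (if t < e / real b then A else X (t - e / real b)) \<partial>std_exp \<partial>std_exp)
    = (A + real b * (\<integral>t. X t \<partial>std_exp)) / (real b + 1)"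
proof -
  note [measurable] = X(1)
  let ?I = "\<integral>t. X t \<partial>std_exp"
  have "(\<integral>t. \<integral>e. (if t < e / real b then A else X (t - e / real b)) \<partial>std_exp \<partial>std_exp)
      = (\<integral>e. \<integral>t. (if t < e / real b then A else X (t - e / real b)) \<partial>std_exp \<partial>std_exp)"
    using X A by (intro integral_swap_std_exp) auto
  also have "\<dots> = (\<integral>e. A + exp (- (1 / real b * e)) * (?I - A) \<partial>std_exp)"
  proof (rule integral_cong_AE)
    show "AE e in std_exp. (\<integral>t. (if t < e / real b then A else X (t - e / real b)) \<partial>std_exp)
        = A + exp (- (1 / real b * e)) * (?I - A)"
    proof (rule eventually_mono[OF AE_std_exp_pos])
      fix e :: real assume "0 < e"
      then show "(\<integral>t. (if t < e / real b then A else X (t - e / real b)) \<partial>std_exp)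
          = A + exp (- (1 / real b * e)) * (?I - A)"
        using integral_std_exp_shift[OF X, of "e / real b" A] by (simp add: algebra_simps)
    qed
  qed (intro std_exp.borel_measurable_lebesgue_integral, measurable)
  also have "\<dots> = A + (?I - A) / (1 + 1 / real b)"
  proof -
    have "integrable std_exp (\<lambda>e. exp (- (1 / real b * e)))"
    proof (rule std_exp.integrable_const_bound[of _ 1])
      show "AE e in std_exp. norm (exp (- (1 / real b * e))) \<le> 1"
        by (rule eventually_mono[OF AE_std_exp_pos]) simp
    qed simp
    then show ?thesis
      using integral_exp_std_exp[of "1 / real b"] std_exp.prob_space by simp
  qed
  also have "\<dots> = (A + real b * ?I) / (real b + 1)"
    using b by (simp add: field_simps)
  finally show ?thesis .
qed

text \<open>The last entry of a list is the first step away from the root, so the subtree below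
  child \<open>i\<close> is reached by \<open>v @ [i]\<close> from the shallower tree; the field is
  transported there and extended by 0.\<close>

definition subtree_field :: "nat \<Rightarrow> (vertex \<Rightarrow> real) \<Rightarrow> vertex \<Rightarrow> real" where
  "subtree_field i h y = (if y \<noteq> [] \<and> last y = i then h (butlast y) else 0)"

lemma append_in_tree: "v \<in> tree_vertices b n \<Longrightarrow> i < b \<Longrightarrow> v @ [i] \<in> tree_vertices b (Suc n)"
  by (auto simp: tree_vertices_def)

lemma butlast_in_leaves:
  assumes "y \<in> leaves b (Suc n)"
  shows "butlast y \<in> leaves b n"
  using assms by (auto simp: leaves_def tree_vertices_def dest!: in_set_butlastD)

lemma leaf_test_subtree:
  assumes f: "leaf_test b (Suc n) f"
  shows "leaf_test b n (\<lambda>h. f (\<lambda>y. k y + subtree_field i h y))"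
  unfolding leaf_test_def
proof (intro conjI allI impI)
  show "(\<lambda>h. f (\<lambda>y. k y + subtree_field i h y)) \<in> borel_measurable (PiM UNIV (\<lambda>_. borel))"
    by (intro measurable_leaf_test[OF f]) (auto simp: subtree_field_def)
next
  fix h h' :: "vertex \<Rightarrow> real" assume "\<forall>x\<in>leaves b n. h x = h' x"
  then show "f (\<lambda>y. k y + subtree_field i h y) = f (\<lambda>y. k y + subtree_field i h' y)"
    by (intro leaf_test_cong[OF f]) (auto simp: subtree_field_def butlast_in_leaves)
qed (auto simp: leaf_test_bounds[OF f])

text \<open>It moves the collected field to the deeper tree, so that the walks in both depths are
  run with the same field argument and the same increments.\<close>

lemma stopped_mean_subtree_increment:
  "stopped_mean b n (\<lambda>h. f (\<lambda>y. k y + subtree_field i h y)) w t (\<lambda>x. 0 + (if x = v then c else 0))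
    = stopped_mean b n (\<lambda>h. f (\<lambda>y. (k y + (if y = v @ [i] then c else 0)) + subtree_field i h y)) w t (\<lambda>_. 0)"
proof -
  have "k y + subtree_field i (\<lambda>x. 0 + (if x = v then c else 0) + L x) y
      = (k y + (if y = v @ [i] then c else 0)) + subtree_field i (\<lambda>x. 0 + L x) y" for L y
    using append_butlast_last_id[of y] by (auto simp: subtree_field_def)
  then show ?thesis unfolding stopped_mean_def by (simp only:)
qed

text \<open>The root of the shallower tree is excluded: \<open>[i]\<close> has the true root as an
  additional neighbour, and this is where the exponential threshold comes from.\<close>

lemma neighbours_append:
  assumes v: "v \<in> tree_vertices b n" "v \<noteq> []" and i: "i < b"
  shows "neighbours b (Suc n) (v @ [i]) = (\<lambda>w. w @ [i]) ` neighbours b n v"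
proof (cases "length v < n")
  case True
  then show ?thesis
    using neighbours_interior[OF append_in_tree[OF v(1) i]] neighbours_interior[OF v True] v(2)
    by (auto simp: image_image)
next
  case False
  then have "v \<in> leaves b n" "v @ [i] \<in> leaves b (Suc n)"
    using v append_in_tree[OF v(1) i] by (auto simp: leaves_def tree_vertices_def)
  then show ?thesis using neighbours_leaf v(2) by (simp add: neighbours_leaf)
qed

lemma integral_nbr_avg:
  assumes "\<And>w. integrable M (F w)"
  shows "(\<integral>t. nbr_avg b n v (\<lambda>w. F w t) \<partial>M) = nbr_avg b n v (\<lambda>w. \<integral>t. F w t \<partial>M)"
  unfolding nbr_avg_def using assms by (simp add: integral_sum)

text \<open>Started in the subtree of a child of the root, the walk in depth \<open>n + 1\<close> spends an independent
  exponential local time at this child before it hits the root.\<close>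

theorem stopped_mean_exponential_time:
  assumes n: "n \<ge> 1" and b: "b \<ge> 1" and i: "i < b" and f: "leaf_test b (Suc n) f"
    and v: "v \<in> tree_vertices b n"
  shows "stopped_mean b (Suc n) f (v @ [i]) 0 k =
    (\<integral>t. stopped_mean b n (\<lambda>h. f (\<lambda>y. k y + subtree_field i h y)) v t (\<lambda>_. 0) \<partial>std_exp)"
proof -
  define F where "F k = (\<lambda>h. f (\<lambda>y. k y + subtree_field i h y))" for k
  have F: "leaf_test b n (F k)" for k unfolding F_def by (rule leaf_test_subtree[OF f])
  define \<Phi> where "\<Phi> v k = (\<integral>t. stopped_mean b n (F k) v t (\<lambda>_. 0) \<partial>std_exp)" for v k
  define \<Psi> where "\<Psi> v k = stopped_mean b (Suc n) f (v @ [i]) 0 k" for v k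
  define c where "c v e = e / real (card (neighbours b n v))" for v e
  define inc where "inc v k e y = k y + (if y = v @ [i] then c v e else 0)" for v k e y
  have n1: "Suc n \<ge> 1" by simp
  have inc_F: "stopped_mean b n (F k) w t (\<lambda>x. 0 + (if x = v then c v e else 0))
      = stopped_mean b n (F (inc v k e)) w t (\<lambda>_. 0)" for v w k e t
    unfolding F_def inc_def by (rule stopped_mean_subtree_increment)
  have mF: "(\<lambda>x. stopped_mean b n (F (inc v k (E x))) w (T x) (\<lambda>_. 0)) \<in> borel_measurable N"
    if [measurable]: "E \<in> borel_measurable N" "T \<in> borel_measurable N" for E T v w k N
    unfolding inc_F[symmetric] c_def by (intro measurable_stopped_mean[OF F]) measurable
  have m0: "(\<lambda>t. stopped_mean b n (F k) w t (\<lambda>_. 0)) \<in> borel_measurable borel" for w k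
    by (intro measurable_stopped_mean[OF F]) measurable
  have \<Phi>01: "0 \<le> \<Phi> v k" "\<Phi> v k \<le> 1" for v k
    unfolding \<Phi>_def by (intro std_exp.integral_unit_interval stopped_mean_bounds[OF F])+
  have \<Psi>01: "0 \<le> \<Psi> v k" "\<Psi> v k \<le> 1" for v k
    unfolding \<Psi>_def by (intro stopped_mean_bounds[OF f])+
  have \<Phi>m: "(\<lambda>e. \<Phi> w (inc v k e)) \<in> borel_measurable std_exp" for v w k
    unfolding \<Phi>_def
    by (intro std_exp.borel_measurable_lebesgue_integral) (unfold split_beta', intro mF, measurable)
  have \<Psi>m: "(\<lambda>e. \<Psi> w (inc v k e)) \<in> borel_measurable std_exp" for v w k
    unfolding \<Psi>_def inc_def c_def by (intro measurable_stopped_mean[OF f]) measurable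
  have \<Phi>_rec: "\<Phi> v k = nbr_avg b n v (\<lambda>w. \<integral>e. \<Phi> w (inc v k e) \<partial>std_exp)"
    if v: "v \<in> tree_vertices b n" "v \<noteq> []" for v k
  proof -
    have "\<Phi> v k = (\<integral>t. nbr_avg b n v (\<lambda>w. \<integral>e. stopped_mean b n (F (inc v k e)) w t (\<lambda>_. 0) \<partial>std_exp) \<partial>std_exp)"
      unfolding \<Phi>_def
    proof (rule integral_cong_AE)
      show "AE t in std_exp. stopped_mean b n (F k) v t (\<lambda>_. 0) =
          nbr_avg b n v (\<lambda>w. \<integral>e. stopped_mean b n (F (inc v k e)) w t (\<lambda>_. 0) \<partial>std_exp)"
      proof (rule eventually_mono[OF AE_std_exp_pos])
        fix t :: real assume "0 < t"
        then show "stopped_mean b n (F k) v t (\<lambda>_. 0) =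
            nbr_avg b n v (\<lambda>w. \<integral>e. stopped_mean b n (F (inc v k e)) w t (\<lambda>_. 0) \<partial>std_exp)"
          unfolding inc_F[symmetric] c_def by (intro stopped_mean_nonroot[OF n b v _ F]) simp
      qed
      show "(\<lambda>t. nbr_avg b n v (\<lambda>w. \<integral>e. stopped_mean b n (F (inc v k e)) w t (\<lambda>_. 0) \<partial>std_exp)) \<in> borel_measurable std_exp"
        unfolding nbr_avg_def
        by (intro borel_measurable_divide borel_measurable_sum std_exp.borel_measurable_lebesgue_integral)
          (unfold split_beta', auto intro!: mF)
    qed (use m0 in simp)
    also have "\<dots> = nbr_avg b n v (\<lambda>w. \<integral>t. \<integral>e. stopped_mean b n (F (inc v k e)) w t (\<lambda>_. 0) \<partial>std_exp \<partial>std_exp)"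
    proof (rule integral_nbr_avg)
      fix w
      show "integrable std_exp (\<lambda>t. \<integral>e. stopped_mean b n (F (inc v k e)) w t (\<lambda>_. 0) \<partial>std_exp)"
        by (intro std_exp.integrable_unit_interval std_exp.integral_unit_interval stopped_mean_bounds[OF F]
            std_exp.borel_measurable_lebesgue_integral) (unfold split_beta', intro mF, measurable)
    qed
    also have "\<dots> = nbr_avg b n v (\<lambda>w. \<integral>e. \<Phi> w (inc v k e) \<partial>std_exp)"
    proof (rule nbr_avg_cong)
      fix w
      show "(\<integral>t. \<integral>e. stopped_mean b n (F (inc v k e)) w t (\<lambda>_. 0) \<partial>std_exp \<partial>std_exp) = (\<integral>e. \<Phi> w (inc v k e) \<partial>std_exp)"
        unfolding \<Phi>_def by (intro integral_swap_std_exp mF stopped_mean_bounds[OF F]) measurable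
    qed
    finally show ?thesis .
  qed
  have \<Psi>_rec: "\<Psi> v k = nbr_avg b n v (\<lambda>w. \<integral>e. \<Psi> w (inc v k e) \<partial>std_exp)"
    if v: "v \<in> tree_vertices b n" "v \<noteq> []" for v k
  proof -
    have inj: "inj_on (\<lambda>w. w @ [i]) A" for A by (simp add: inj_on_def)
    have card: "card (neighbours b (Suc n) (v @ [i])) = card (neighbours b n v)"
      by (simp add: neighbours_append[OF v i] card_image[OF inj])
    have avg: "nbr_avg b (Suc n) (v @ [i]) D = nbr_avg b n v (\<lambda>w. D (w @ [i]))" for D
      unfolding nbr_avg_def card by (simp add: neighbours_append[OF v i] sum.reindex[OF inj])
    show ?thesis
      using stopped_mean_nonroot[OF n1 b append_in_tree[OF v(1) i] _ order.refl f, of k]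
      unfolding \<Psi>_def avg card inc_def c_def by simp
  qed
  \<comment> \<open>The first sojourn at the root of the shallower tree races against the
    exponential threshold, as in \<open>integral_memoryless\<close>.\<close>
  have \<Phi>_root: "\<Phi> [] k = (f k + real b * nbr_avg b n [] (\<lambda>w. \<Phi> w k)) / (real b + 1)" for k
  proof -
    have Fk0: "F k (\<lambda>_. 0) = f k" by (simp add: F_def subtree_field_def)
    let ?Y = "\<lambda>w t e. if t < e / real b then f k else stopped_mean b n (F k) w (t - e / real b) (\<lambda>_. 0)"
    have Ym: "(\<lambda>x. ?Y w (fst x) (snd x)) \<in> borel_measurable (borel \<Otimes>\<^sub>M std_exp)" for w
    proof -
      have [measurable]: "(\<lambda>x. stopped_mean b n (F k) w (fst x - snd x / real b) (\<lambda>_. 0)) \<in> borel_measurable (borel \<Otimes>\<^sub>M std_exp)"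
        by (intro measurable_stopped_mean[OF F]) measurable
      show ?thesis by measurable
    qed
    have Y01: "0 \<le> ?Y w t e" "?Y w t e \<le> 1" for w t e
      by (auto simp: leaf_test_bounds[OF f] stopped_mean_bounds[OF F])
    have Yi: "(\<lambda>t. \<integral>e. ?Y w t e \<partial>std_exp) \<in> borel_measurable borel" for w
      by (intro std_exp.borel_measurable_lebesgue_integral) (use Ym in \<open>simp add: split_beta'\<close>)
    have "\<Phi> [] k = (\<integral>t. nbr_avg b n [] (\<lambda>w. \<integral>e. ?Y w t e \<partial>std_exp) \<partial>std_exp)"
      unfolding \<Phi>_def
    proof (rule integral_cong_AE)
      show "AE t in std_exp. stopped_mean b n (F k) [] t (\<lambda>_. 0) = nbr_avg b n [] (\<lambda>w. \<integral>e. ?Y w t e \<partial>std_exp)"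
        unfolding Fk0[symmetric]
        by (rule eventually_mono[OF AE_std_exp_pos]) (intro stopped_mean_root[OF n b _ F], simp)
      show "(\<lambda>t. nbr_avg b n [] (\<lambda>w. \<integral>e. ?Y w t e \<partial>std_exp)) \<in> borel_measurable std_exp"
        unfolding nbr_avg_def by (intro borel_measurable_divide borel_measurable_sum) (use Yi in auto)
    qed (use m0 in simp)
    also have "\<dots> = nbr_avg b n [] (\<lambda>w. \<integral>t. \<integral>e. ?Y w t e \<partial>std_exp \<partial>std_exp)"
      by (rule integral_nbr_avg, intro std_exp.integrable_unit_interval std_exp.integral_unit_interval Y01)
        (use Yi in simp)
    also have "\<dots> = nbr_avg b n [] (\<lambda>w. (f k + real b * \<Phi> w k) / (real b + 1))"
      unfolding \<Phi>_def
      by (intro nbr_avg_cong integral_memoryless m0 stopped_mean_bounds[OF F] leaf_test_bounds[OF f] b)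
    also have "\<dots> = (f k + real b * nbr_avg b n [] (\<lambda>w. \<Phi> w k)) / (real b + 1)"
    proof -
      have "(f k + real b * \<Phi> w k) / (real b + 1) = (real b / (real b + 1)) * \<Phi> w k - (- f k / (real b + 1))" for w
        by (simp add: add_divide_distrib)
      then show ?thesis
        by (simp only: nbr_avg_diff nbr_avg_cmult nbr_avg_const[OF n b root_in_tree]) (simp add: add_divide_distrib)
    qed
    finally show ?thesis .
  qed
  \<comment> \<open>In the deeper tree \<open>[i]\<close> has \<open>b + 1\<close> neighbours, one
    of them the root, where the walk stops: the same weights as in the race.\<close>
  have \<Psi>_root: "\<Psi> [] k = (f k + real b * nbr_avg b n [] (\<lambda>w. \<Psi> w k)) / (real b + 1)" for k
  proof -
    have iT: "[i] \<in> tree_vertices b (Suc n)" using append_in_tree[OF root_in_tree i] by simp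
    have "stopped_mean b (Suc n) f w 0 (\<lambda>x. k x + (if x = [i] then d else 0)) = stopped_mean b (Suc n) f w 0 k" for w d
      by (rule stopped_mean_cong[OF f]) (use n in \<open>auto simp: leaves_def\<close>)
    then have "\<Psi> [] k = nbr_avg b (Suc n) [i] (\<lambda>w. stopped_mean b (Suc n) f w 0 k)"
      using stopped_mean_nonroot[OF n1 b iT _ order.refl f, of k] std_exp.prob_space by (simp add: \<Psi>_def)
    also have "\<dots> = (f k + (\<Sum>j<b. \<Psi> [j] k)) / (real b + 1)"
      using nbr_avg_interior[OF iT] n by (simp add: stopped_mean_root_0[OF n1 b f] \<Psi>_def)
    also have "(\<Sum>j<b. \<Psi> [j] k) = real b * nbr_avg b n [] (\<lambda>w. \<Psi> w k)"
      using b by (simp add: nbr_avg_root[OF n])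
    finally show ?thesis .
  qed
  \<comment> \<open>The two recursions at \<open>[]\<close> involve the values at its children, so a
    single comparison does not determine the difference. It does contract it by the factor
    \<open>q\<close>, the weight not given to stopping; the bound is then spread over the tree by
    \<open>field_comparison\<close> and iterated.\<close>
  define q where "q = real b / (real b + 1)"
  have q: "0 \<le> q" "q < 1" by (auto simp: q_def)
  have bound: "\<bar>\<Psi> v k - \<Phi> v k\<bar> \<le> q ^ m" if "v \<in> tree_vertices b n" for m v k
    using that
  proof (induction m arbitrary: v k)
    case 0
    then show ?case using \<Phi>01[of v k] \<Psi>01[of v k] by (simp add: abs_le_iff)
  next
    case (Suc m)
    have "\<bar>\<Psi> [] k - \<Phi> [] k\<bar> \<le> q ^ Suc m" for k
    proof -
      have "\<Psi> [] k - \<Phi> [] k = q * nbr_avg b n [] (\<lambda>w. \<Psi> w k - \<Phi> w k)"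
        unfolding \<Psi>_root[of k] \<Phi>_root[of k] nbr_avg_diff q_def
        by (simp add: diff_divide_distrib[symmetric] right_diff_distrib)
      moreover have "\<bar>nbr_avg b n [] (\<lambda>w. \<Psi> w k - \<Phi> w k)\<bar> \<le> q ^ m"
        using Suc.IH neighbours_subset_tree
        by (intro order.trans[OF abs_nbr_avg_le] nbr_avg_le[OF n b root_in_tree]) auto
      ultimately show ?thesis using q by (simp add: abs_mult mult_left_mono)
    qed
    note root = this
    show ?case
      by (rule field_comparison[OF n b, where A = \<Psi> and B = \<Phi> and inc = inc])
        (fact \<Psi>01 \<Phi>01 \<Psi>m \<Phi>m \<Psi>_rec \<Phi>_rec root Suc.prems)+
  qed
  have "(\<lambda>m. q ^ m) \<longlonglongrightarrow> 0" using q by (intro LIMSEQ_realpow_zero) auto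
  then have "\<bar>\<Psi> v k - \<Phi> v k\<bar> \<le> 0"
    by (rule LIMSEQ_le_const) (use bound[OF v] in auto)
  then show ?thesis by (simp add: \<Psi>_def \<Phi>_def F_def)
qed

section \<open>Local times of the continuous-time walk\<close>

text \<open>Both \<open>distr\<close> and \<open>measure\<close> are junk on nonmeasurable arguments, so the fields have to be
  measurable everywhere, also on the null set where the walk explodes or misses the root.\<close>

lemma borel_measurable_Inf_right_open:
  fixes R :: "'a \<Rightarrow> real \<Rightarrow> bool"
  assumes [measurable]: "\<And>s. Measurable.pred N (\<lambda>\<omega>. R \<omega> s)"
    and right: "\<And>\<omega> s. 0 \<le> s \<Longrightarrow> R \<omega> s \<Longrightarrow> \<exists>e>0. \<forall>r. s \<le> r \<longrightarrow> r < s + e \<longrightarrow> R \<omega> r"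
  shows "(\<lambda>\<omega>. Inf {s. 0 \<le> s \<and> R \<omega> s}) \<in> borel_measurable N"
proof -
  have rat: "(\<exists>s. 0 \<le> s \<and> s < a \<and> R \<omega> s) \<longleftrightarrow>
      (\<exists>q::rat. 0 \<le> real_of_rat q \<and> real_of_rat q < a \<and> R \<omega> (real_of_rat q))" for \<omega> a
  proof
    assume "\<exists>s. 0 \<le> s \<and> s < a \<and> R \<omega> s"
    then obtain s where s: "0 \<le> s" "s < a" "R \<omega> s" by blast
    obtain e where e: "e > 0" "\<forall>r. s \<le> r \<longrightarrow> r < s + e \<longrightarrow> R \<omega> r" using right[OF s(1,3)] by blast
    have "s < min a (s + e)" using s e by simp
    then obtain q where "s < real_of_rat q" "real_of_rat q < min a (s + e)" using of_rat_dense by blast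
    then show "\<exists>q::rat. 0 \<le> real_of_rat q \<and> real_of_rat q < a \<and> R \<omega> (real_of_rat q)"
      using s e by (intro exI[of _ q]) (auto simp del: zero_le_of_rat_iff)
  qed blast
  have ne: "{s. 0 \<le> s \<and> R \<omega> s} \<noteq> {} \<longleftrightarrow> (\<exists>q::rat. 0 \<le> real_of_rat q \<and> R \<omega> (real_of_rat q))" for \<omega>
  proof
    assume "{s. 0 \<le> s \<and> R \<omega> s} \<noteq> {}"
    then obtain s where "0 \<le> s" "s < s + 1" "R \<omega> s" by auto
    then show "\<exists>q::rat. 0 \<le> real_of_rat q \<and> R \<omega> (real_of_rat q)"
      using rat[of "s + 1" \<omega>] by blast
  qed blast
  have "Inf {s. 0 \<le> s \<and> R \<omega> s} < a \<longleftrightarrow>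
      (if \<exists>q::rat. 0 \<le> real_of_rat q \<and> R \<omega> (real_of_rat q)
       then \<exists>q::rat. 0 \<le> real_of_rat q \<and> real_of_rat q < a \<and> R \<omega> (real_of_rat q)
       else Inf {} < a)" for \<omega> a
  proof (cases "{s. 0 \<le> s \<and> R \<omega> s} = {}")
    case True
    then have "\<not> (\<exists>q::rat. 0 \<le> real_of_rat q \<and> R \<omega> (real_of_rat q))" using ne[of \<omega>] by blast
    then show ?thesis unfolding True by (simp only: if_False)
  next
    case False
    have "bdd_below {s. 0 \<le> s \<and> R \<omega> s}" by (intro bdd_belowI[of _ 0]) auto
    then have "Inf {s. 0 \<le> s \<and> R \<omega> s} < a \<longleftrightarrow> (\<exists>s. 0 \<le> s \<and> s < a \<and> R \<omega> s)"
      using cInf_less_iff[OF False] by auto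
    moreover have "\<exists>q::rat. 0 \<le> real_of_rat q \<and> R \<omega> (real_of_rat q)" using False ne[of \<omega>] by blast
    ultimately show ?thesis using rat[of a \<omega>] by (simp only: if_True)
  qed
  then show ?thesis
    unfolding borel_measurable_iff_less by simp
qed

lemma measurable_jump_time [measurable]:
  "(\<lambda>\<omega>. jump_time b m z \<omega> k) \<in> borel_measurable (walk_space b' n)"
  unfolding jump_time_def by measurable

lemma measurable_walk [measurable (raw)]:
  assumes [measurable]: "W \<in> measurable N (walk_space b' n)" "T \<in> borel_measurable N"
  shows "(\<lambda>x. walk b m z (W x) (T x)) \<in> measurable N (count_space UNIV)"
  unfolding walk_def
  by (rule measurable_compose_countable[where g = "\<lambda>x. LEAST k. T x < jump_time b m z (W x) (Suc k)"]) measurable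

lemma measurable_local_time [measurable (raw)]:
  assumes [measurable]: "W \<in> measurable N (walk_space b' n)" "T \<in> borel_measurable N"
  shows "(\<lambda>x. local_time b m z (W x) (T x) y) \<in> borel_measurable N"
proof -
  have "(\<lambda>p. if 0 \<le> snd p \<and> snd p \<le> T (fst p) \<and> walk b m z (W (fst p)) (snd p) = y then 1 else 0 :: real)
      \<in> borel_measurable (N \<Otimes>\<^sub>M lborel)"
    by measurable
  also have "(\<lambda>p. if 0 \<le> snd p \<and> snd p \<le> T (fst p) \<and> walk b m z (W (fst p)) (snd p) = y then 1 else 0 :: real)
      = (\<lambda>p. indicator {0..T (fst p)} (snd p) *\<^sub>R indicator {y} (walk b m z (W (fst p)) (snd p)))"
    by (auto simp: indicator_def)
  finally show ?thesis
    unfolding local_time_def set_lebesgue_integral_def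
    by (intro lborel.borel_measurable_lebesgue_integral) (simp add: split_beta')
qed

lemma measurable_walk_time:
  "(\<lambda>s. walk b m z \<omega> s) \<in> measurable borel (count_space UNIV)"
  unfolding walk_def
  by (rule measurable_compose[of "\<lambda>s. LEAST k. s < jump_time b m z \<omega> (Suc k)" _ "count_space UNIV"]) measurable

text \<open>On paths where no jump time exceeds \<open>s\<close>, none exceeds a later
  \<open>r\<close> either; then both \<open>LEAST\<close> terms have the same predicate and the
  same, if unspecified, value.\<close>

lemma walk_right_constant:
  "\<exists>e>0. \<forall>r. s \<le> r \<longrightarrow> r < s + e \<longrightarrow> walk b n z \<omega> r = walk b n z \<omega> s"
proof (cases "\<exists>k. s < jump_time b n z \<omega> (Suc k)")
  case True
  define k where "k = (LEAST k. s < jump_time b n z \<omega> (Suc k))"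
  have k: "s < jump_time b n z \<omega> (Suc k)" unfolding k_def using True by (rule LeastI_ex)
  have "(LEAST k. r < jump_time b n z \<omega> (Suc k)) = k" if "s \<le> r" "r < jump_time b n z \<omega> (Suc k)" for r
  proof (rule Least_equality)
    show "r < jump_time b n z \<omega> (Suc k)" by (rule that(2))
    fix j assume "r < jump_time b n z \<omega> (Suc j)"
    then show "k \<le> j" unfolding k_def using that(1) by (intro Least_le) auto
  qed
  then show ?thesis using k
    by (intro exI[of _ "jump_time b n z \<omega> (Suc k) - s"]) (auto simp: walk_def k_def[symmetric])
next
  case False
  then have eq: "(\<lambda>k. r < jump_time b n z \<omega> (Suc k)) = (\<lambda>k. s < jump_time b n z \<omega> (Suc k))" if "s \<le> r" for r
    using that by (auto simp: fun_eq_iff) (meson less_le_trans not_less)+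
  have "walk b n z \<omega> r = walk b n z \<omega> s" if "s \<le> r" for r
    unfolding walk_def by (simp only: eq[OF that])
  then show ?thesis using zero_less_one by blast
qed

lemma set_integrable_walk:
  "set_integrable lborel {s..t} (\<lambda>r. indicator {x} (walk b n z \<omega> r) :: real)"
proof -
  have [measurable]: "(\<lambda>r. indicator {x} (walk b n z \<omega> r) :: real) \<in> borel_measurable borel"
    by (rule measurable_compose[OF measurable_walk_time]) simp
  have "integrable lborel (indicator {s..t} :: real \<Rightarrow> real)"
    by (rule integrable_real_indicator) (auto simp: emeasure_lborel_Icc_eq)
  then show ?thesis
    unfolding set_integrable_def
    by (rule Bochner_Integration.integrable_bound) (auto simp: indicator_def)
qed

lemma local_time_split:
  assumes "0 \<le> s" "s \<le> t"
  shows "local_time b n z \<omega> t x = local_time b n z \<omega> s x + (LINT r:{s<..t}|lborel. indicator {x} (walk b n z \<omega> r))"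
proof -
  have "{0..t} = {0..s} \<union> {s<..t}" using assms by auto
  then show ?thesis
    unfolding local_time_def
    by (simp only:, intro set_integral_Un set_integrable_walk)
      (auto intro: set_integrable_subset[OF set_integrable_walk[of s t]])
qed

lemma local_time_mono:
  assumes "0 \<le> s" "s \<le> t"
  shows "local_time b n z \<omega> s x \<le> local_time b n z \<omega> t x"
proof -
  have "0 \<le> (LINT r:{s<..t}|lborel. indicator {x} (walk b n z \<omega> r) :: real)"
    unfolding set_lebesgue_integral_def by (intro integral_nonneg_AE) (auto simp: indicator_def)
  then show ?thesis using local_time_split[OF assms, of b n z \<omega> x] by simp
qed

lemma measurable_root_hitting_time [measurable]:
  "root_hitting_time b m z \<in> borel_measurable (walk_space b' n)"
  unfolding root_hitting_time_def
proof (rule borel_measurable_Inf_right_open)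
  fix \<omega> s assume "walk b m z \<omega> s = \<rho>"
  then show "\<exists>e>0. \<forall>r. s \<le> r \<longrightarrow> r < s + e \<longrightarrow> walk b m z \<omega> r = \<rho>"
    using walk_right_constant[of s b m z \<omega>] by simp
qed measurable

lemma measurable_inverse_local_time [measurable]:
  "(\<lambda>\<omega>. inverse_local_time b m z \<omega> t) \<in> borel_measurable (walk_space b' n)"
  unfolding inverse_local_time_def
proof (rule borel_measurable_Inf_right_open)
  fix \<omega> s assume s: "0 \<le> s" "t < local_time b m z \<omega> s \<rho>"
  then have "t < local_time b m z \<omega> r \<rho>" if "s \<le> r" for r
    using local_time_mono[OF s(1) that, of b m z \<omega> \<rho>] by linarith
  then show "\<exists>e>0. \<forall>r. s \<le> r \<longrightarrow> r < s + e \<longrightarrow> t < local_time b m z \<omega> r \<rho>"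
    by (intro exI[of _ 1]) auto
qed measurable

lemma measurable_root_time_field [measurable]:
  "(\<lambda>\<omega>. root_time_field b m t \<omega> x) \<in> borel_measurable (walk_space b' n)"
  unfolding root_time_field_def by measurable

lemma measurable_hitting_field [measurable]:
  "(\<lambda>\<omega>. hitting_field b m z \<omega> x) \<in> borel_measurable (walk_space b' n)"
  unfolding hitting_field_def by measurable

section \<open>Local times along the jump chain\<close>

lemma jump_time_Suc: "jump_time b n z \<omega> (Suc k) = jump_time b n z \<omega> k + holding_time b n z \<omega> k"
  by (simp add: jump_time_def)

lemma jump_time_0 [simp]: "jump_time b n z \<omega> 0 = 0"
  by (simp add: jump_time_def)

lemma chain_local_time_Suc:
  "chain_local_time b n z \<omega> (Suc k) x =
    chain_local_time b n z \<omega> k x + (if jump_chain z \<omega> k = x then holding_time b n z \<omega> k else 0)"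
  by (simp add: chain_local_time_def)

context
  fixes b n :: nat and z :: vertex and \<omega> :: driving
  assumes pos: "\<And>k. 0 < holding_time b n z \<omega> k"
begin

lemma strict_mono_jump_time: "strict_mono (jump_time b n z \<omega>)"
  by (rule strict_monoI_Suc) (simp add: jump_time_Suc pos)

lemma jump_time_nonneg: "0 \<le> jump_time b n z \<omega> k"
  unfolding jump_time_def using pos by (intro sum_nonneg) (simp add: less_imp_le)

lemma walk_eq_jump_chain:
  assumes "jump_time b n z \<omega> k \<le> s" "s < jump_time b n z \<omega> (Suc k)"
  shows "walk b n z \<omega> s = jump_chain z \<omega> k"
proof -
  have "(LEAST k. s < jump_time b n z \<omega> (Suc k)) = k"
  proof (rule Least_equality)
    show "s < jump_time b n z \<omega> (Suc k)" by (rule assms(2))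
    fix j assume "s < jump_time b n z \<omega> (Suc j)"
    then have "jump_time b n z \<omega> k < jump_time b n z \<omega> (Suc j)" using assms(1) by simp
    then show "k \<le> j" using strict_mono_less[OF strict_mono_jump_time] by simp
  qed
  then show ?thesis by (simp add: walk_def)
qed

lemma local_time_increment:
  assumes "jump_time b n z \<omega> k \<le> t" "t \<le> jump_time b n z \<omega> (Suc k)"
  shows "local_time b n z \<omega> t x = local_time b n z \<omega> (jump_time b n z \<omega> k) x +
    (if jump_chain z \<omega> k = x then t - jump_time b n z \<omega> k else 0)"
proof -
  let ?s = "jump_time b n z \<omega> k"
  have "(LINT r:{?s<..t}|lborel. indicator {x} (walk b n z \<omega> r) :: real)
      = (\<integral>r. indicator {?s<..<t} r * (indicator {x} (jump_chain z \<omega> k) :: real) \<partial>lborel)"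
    unfolding set_lebesgue_integral_def
  proof (rule integral_cong_AE)
    have [measurable]: "(\<lambda>r. indicator {x} (walk b n z \<omega> r) :: real) \<in> borel_measurable borel"
      by (rule measurable_compose[OF measurable_walk_time]) simp
    show "(\<lambda>r. indicator {?s<..t} r *\<^sub>R (indicator {x} (walk b n z \<omega> r) :: real)) \<in> borel_measurable lborel"
      by measurable
    show "AE r in lborel. indicator {?s<..t} r *\<^sub>R (indicator {x} (walk b n z \<omega> r) :: real)
        = indicator {?s<..<t} r * indicator {x} (jump_chain z \<omega> k)"
      by (rule eventually_mono[OF AE_lborel_singleton[of t]])
        (use assms(2) in \<open>auto simp: indicator_def walk_eq_jump_chain[of k]\<close>)
  qed measurable
  also have "\<dots> = (if jump_chain z \<omega> k = x then t - ?s else 0)"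
    using assms(1) by simp
  finally show ?thesis
    using local_time_split[OF jump_time_nonneg assms(1)] by simp
qed

lemma local_time_jump_time: "local_time b n z \<omega> (jump_time b n z \<omega> k) x = chain_local_time b n z \<omega> k x"
proof (induction k)
  case 0
  have "(LINT s:{0..0}|lborel. (indicator {x} (walk b n z \<omega> s) :: real)) = (\<integral>s. (0::real) \<partial>(lborel :: real measure))"
    unfolding set_lebesgue_integral_def
  proof (rule integral_cong_AE)
    have [measurable]: "(\<lambda>r. indicator {x} (walk b n z \<omega> r) :: real) \<in> borel_measurable borel"
      by (rule measurable_compose[OF measurable_walk_time]) simp
    show "(\<lambda>r. indicator {0..0} r *\<^sub>R (indicator {x} (walk b n z \<omega> r) :: real)) \<in> borel_measurable lborel"
      by measurable
    show "AE s in lborel. indicator {0..0} s *\<^sub>R (indicator {x} (walk b n z \<omega> s) :: real) = 0"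
      by (rule eventually_mono[OF AE_lborel_singleton[of 0]]) simp
  qed simp
  then show ?case by (simp add: local_time_def)
next
  case (Suc k)
  then show ?case
    using local_time_increment[of k "jump_time b n z \<omega> (Suc k)" x] pos[of k]
    by (simp add: jump_time_Suc chain_local_time_Suc)
qed

lemma exists_jump_interval:
  assumes "0 \<le> s" "s < jump_time b n z \<omega> k"
  shows "\<exists>j<k. jump_time b n z \<omega> j \<le> s \<and> s < jump_time b n z \<omega> (Suc j)"
  using assms
proof (induction k)
  case (Suc k)
  then show ?case by (cases "s < jump_time b n z \<omega> k") (auto simp: less_Suc_eq)
qed simp

lemma stop_index:
  assumes "stops b n z \<omega> t" "0 \<le> t"
  defines "k \<equiv> stop_index b n z \<omega> t"
  shows "jump_chain z \<omega> k = \<rho>" "chain_local_time b n z \<omega> k \<rho> \<le> t" "t < chain_local_time b n z \<omega> (Suc k) \<rho>"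
proof -
  show 1: "t < chain_local_time b n z \<omega> (Suc k) \<rho>"
    using assms(1) unfolding k_def stop_index_def stops_def by (rule LeastI_ex)
  show 2: "chain_local_time b n z \<omega> k \<rho> \<le> t"
  proof (cases k)
    case (Suc j)
    then have "j < (LEAST k. t < chain_local_time b n z \<omega> (Suc k) \<rho>)"
      unfolding k_def stop_index_def by simp
    then show ?thesis using Suc not_less_Least by fastforce
  qed (use assms(2) in simp)
  show "jump_chain z \<omega> k = \<rho>"
    using 1 2 by (auto simp: chain_local_time_Suc split: if_splits)
qed

text \<open>With positive holding times, local time at the root first exceeds 0 in the first root
  sojourn of the chain, so \<open>stop_index\<close> is the first visit and its jump time is the
  hitting time.\<close>

lemma hitting_field_eq:
  assumes "stops b n z \<omega> 0"
  shows "hitting_field b n z \<omega> = stopped_field b n z \<omega> 0"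
proof -
  let ?k = "stop_index b n z \<omega> 0"
  note k = stop_index[OF assms order.refl]
  have not_root: "jump_chain z \<omega> j \<noteq> \<rho>" if "j < ?k" for j
  proof
    assume "jump_chain z \<omega> j = \<rho>"
    moreover have "0 \<le> chain_local_time b n z \<omega> j \<rho>"
      unfolding chain_local_time_def using pos by (intro sum_nonneg) (simp add: less_imp_le)
    ultimately have "0 < chain_local_time b n z \<omega> (Suc j) \<rho>" using pos[of j] by (simp add: chain_local_time_Suc)
    then show False using not_less_Least that unfolding stop_index_def by blast
  qed
  have "root_hitting_time b n z \<omega> = jump_time b n z \<omega> ?k"
    unfolding root_hitting_time_def
  proof (rule cInf_eq_minimum)
    have "walk b n z \<omega> (jump_time b n z \<omega> ?k) = \<rho>"
      using walk_eq_jump_chain[of ?k] k(1) pos[of ?k] by (simp add: jump_time_Suc)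
    then show "jump_time b n z \<omega> ?k \<in> {t. 0 \<le> t \<and> walk b n z \<omega> t = \<rho>}" by (simp add: jump_time_nonneg)
    fix s assume s: "s \<in> {t. 0 \<le> t \<and> walk b n z \<omega> t = \<rho>}"
    show "jump_time b n z \<omega> ?k \<le> s"
    proof (rule ccontr)
      assume "\<not> jump_time b n z \<omega> ?k \<le> s"
      then obtain j where "j < ?k" "jump_time b n z \<omega> j \<le> s" "s < jump_time b n z \<omega> (Suc j)"
        using exists_jump_interval[of s ?k] s by auto
      then show False using not_root walk_eq_jump_chain[of j s] s by auto
    qed
  qed
  then show ?thesis
    by (simp add: fun_eq_iff hitting_field_def stopped_field_def local_time_jump_time)
qed

end

text \<open>The inverse local time falls inside the root sojourn numbered by
  \<open>stop_index\<close>, at the time \<open>\<sigma>\<close> when exactly \<open>t\<close> has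
  been collected. During that sojourn the local times at all other vertices stand still.\<close>

lemma root_time_field_eq:
  assumes pos: "\<And>k. 0 < holding_time b n \<rho> \<omega> k"
    and stops: "stops b n \<rho> \<omega> t" "0 \<le> t" and x: "x \<noteq> \<rho>"
  shows "root_time_field b n t \<omega> x = stopped_field b n \<rho> \<omega> t x"
proof -
  let ?k = "stop_index b n \<rho> \<omega> t" and ?J = "jump_time b n \<rho> \<omega>"
  note k = stop_index[OF pos stops]
  define \<sigma> where "\<sigma> = ?J ?k + (t - chain_local_time b n \<rho> \<omega> ?k \<rho>)"
  have lt: "local_time b n \<rho> \<omega> s y = chain_local_time b n \<rho> \<omega> ?k y + (if y = \<rho> then s - ?J ?k else 0)"
    if "?J ?k \<le> s" "s \<le> ?J (Suc ?k)" for s y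
    using local_time_increment[OF pos that] local_time_jump_time[OF pos] k(1) by simp
  have \<sigma>: "?J ?k \<le> \<sigma>" "\<sigma> < ?J (Suc ?k)"
    using k by (auto simp: \<sigma>_def chain_local_time_Suc jump_time_Suc)
  have \<sigma>0: "0 \<le> \<sigma>" using \<sigma>(1) jump_time_nonneg[OF pos, of ?k] by linarith
  have "inverse_local_time b n \<rho> \<omega> t = \<sigma>"
    unfolding inverse_local_time_def
  proof (rule cInf_eq)
    fix s assume s: "s \<in> {s. 0 \<le> s \<and> t < local_time b n \<rho> \<omega> s \<rho>}"
    show "\<sigma> \<le> s"
    proof (rule ccontr)
      assume "\<not> \<sigma> \<le> s"
      then have "local_time b n \<rho> \<omega> s \<rho> \<le> local_time b n \<rho> \<omega> \<sigma> \<rho>" using s by (intro local_time_mono) auto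
      also have "\<dots> = t" using lt[of \<sigma> \<rho>] \<sigma> by (simp add: \<sigma>_def)
      finally show False using s by simp
    qed
  next
    fix y assume y: "\<And>s. s \<in> {s. 0 \<le> s \<and> t < local_time b n \<rho> \<omega> s \<rho>} \<Longrightarrow> y \<le> s"
    show "y \<le> \<sigma>"
    proof (rule ccontr)
      assume "\<not> y \<le> \<sigma>"
      then obtain s where s: "\<sigma> < s" "s < min y (?J (Suc ?k))" using dense[of \<sigma> "min y (?J (Suc ?k))"] \<sigma>(2) by auto
      then have "t < local_time b n \<rho> \<omega> s \<rho>" using lt[of s \<rho>] \<sigma>(1) by (simp add: \<sigma>_def)
      then have "y \<le> s" using s \<sigma>0 by (intro y) auto
      then show False using s by simp
    qed
  qed
  then show ?thesis
    using lt[of \<sigma> x] \<sigma> x by (simp add: root_time_field_def stopped_field_def)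
qed

section \<open>Almost sure regularity of paths and transfer to the continuous-time fields\<close>

lemma AE_step_space:
  assumes "n \<ge> 1" "b \<ge> 1"
  shows "AE s in step_space b n. 0 < snd s \<and> (\<forall>v\<in>tree_vertices b n. fst s v \<in> neighbours b n v)"
proof -
  let ?p = "Pi_pmf (tree_vertices b n) \<rho> (\<lambda>v. pmf_of_set (neighbours b n v))"
  interpret pair_prob_space "measure_pmf ?p" std_exp
    by unfold_locales
  have 1: "AE f in measure_pmf ?p. \<forall>v\<in>tree_vertices b n. f v \<in> neighbours b n v"
    using neighbours_nonempty[OF assms]
    by (auto simp: AE_measure_pmf_iff set_Pi_pmf PiE_dflt_def)
  show ?thesis
  proof (rule AE_pair_measure)
    have [measurable]: "Measurable.pred (measure_pmf ?p) (\<lambda>f. \<forall>v\<in>tree_vertices b n. f v \<in> neighbours b n v)"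
      by simp
    show "{s \<in> space (step_space b n). 0 < snd s \<and> (\<forall>v\<in>tree_vertices b n. fst s v \<in> neighbours b n v)}
        \<in> sets (step_space b n)"
      by measurable
    show "AE f in measure_pmf ?p. AE e in std_exp. 0 < snd (f, e) \<and> (\<forall>v\<in>tree_vertices b n. fst (f, e) v \<in> neighbours b n v)"
      using 1 by (rule eventually_mono) (auto intro: eventually_mono[OF AE_std_exp_pos])
  qed
qed

text \<open>A vertex without neighbours would have holding time 0 by division by zero; hence the
  chain is shown to stay in the tree, where all degrees are positive.\<close>

lemma AE_holding_time_pos:
  assumes n: "n \<ge> 1" and b: "b \<ge> 1" and z: "z \<in> tree_vertices b n"
  shows "AE \<omega> in walk_space b n. \<forall>k. 0 < holding_time b n z \<omega> k"
proof -
  let ?p = "Pi_pmf (tree_vertices b n) \<rho> (\<lambda>v. pmf_of_set (neighbours b n v))"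
  let ?P = "\<lambda>s :: (vertex \<Rightarrow> vertex) \<times> real. 0 < snd s \<and> (\<forall>v\<in>tree_vertices b n. fst s v \<in> neighbours b n v)"
  have [measurable]: "Measurable.pred (measure_pmf ?p) (\<lambda>f. \<forall>v\<in>tree_vertices b n. f v \<in> neighbours b n v)"
    by simp
  have "AE \<omega> in walk_space b n. stream_all ?P \<omega>"
    unfolding walk_space_def by (intro step_space.AE_stream_all AE_step_space n b) measurable
  then show ?thesis
  proof (rule eventually_mono)
    fix \<omega> assume "stream_all ?P \<omega>"
    then have P: "?P (\<omega> !! k)" for k by (simp add: stream_all_def)
    have "jump_chain z \<omega> k \<in> tree_vertices b n" for k
      by (induction k) (use z P in \<open>auto intro: neighbours_subset_tree\<close>)
    then show "\<forall>k. 0 < holding_time b n z \<omega> k"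
      using P card_neighbours_pos[OF n b] by (simp add: holding_time_def)
  qed
qed

theorem integral_hitting_field:
  assumes n: "n \<ge> 1" and b: "b \<ge> 1" and z: "z \<in> tree_vertices b n" and f: "leaf_test b n f"
  shows "(\<integral>\<omega>. f (hitting_field b n z \<omega>) \<partial>walk_space b n) = stopped_mean b n f z 0 (\<lambda>_. 0)"
  unfolding stopped_mean_def
proof (rule integral_cong_AE)
  show "AE \<omega> in walk_space b n. f (hitting_field b n z \<omega>) = f (\<lambda>x. 0 + stopped_field b n z \<omega> 0 x)"
    using AE_holding_time_pos[OF n b z] AE_stops[OF n b z order.refl]
    by eventually_elim (simp add: hitting_field_eq)
qed (intro measurable_leaf_test[OF f]; measurable)+

theorem integral_root_time_field:
  assumes n: "n \<ge> 1" and b: "b \<ge> 1" and t: "0 \<le> t" and f: "leaf_test b n f"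
  shows "(\<integral>\<omega>. f (root_time_field b n t \<omega>) \<partial>walk_space b n) = stopped_mean b n f [] t (\<lambda>_. 0)"
  unfolding stopped_mean_def
proof (rule integral_cong_AE)
  show "AE \<omega> in walk_space b n. f (root_time_field b n t \<omega>) = f (\<lambda>x. 0 + stopped_field b n [] \<omega> t x)"
    using AE_holding_time_pos[OF n b root_in_tree] AE_stops[OF n b root_in_tree t]
  proof eventually_elim
    case (elim \<omega>)
    have "root_time_field b n t \<omega> x = stopped_field b n [] \<omega> t x" if "x \<in> leaves b n" for x
      using root_time_field_eq[of b n \<omega> t x] elim t that root_notin_leaves[OF n] by (auto simp: root_def)
    then show ?case by (intro leaf_test_cong[OF f]) simp
  qed
qed (intro measurable_leaf_test[OF f]; measurable)+

section \<open>Conditioning and mixtures\<close>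

text \<open>For indicators this is the definition of the coupling; it extends to \<open>u\<close> by
  monotone class induction. The inner integral may be nonmeasurable in \<open>t\<close>, so sums and
  multiples use the one-sided rules for such integrands, and only an inequality survives.\<close>

lemma coupled_nn_integral_le:
  fixes u :: "real \<Rightarrow> ennreal"
  assumes c: "coupled_at P Z N T W"
    and Z: "\<And>t. t > 0 \<Longrightarrow> Z t \<in> borel_measurable (P t)"
    and u: "u \<in> borel_measurable borel"
  shows "(\<integral>\<^sup>+\<omega>. u (W \<omega>) \<partial>N) \<le> (\<integral>\<^sup>+t. \<integral>\<^sup>+\<omega>. u (Z t \<omega>) \<partial>P t \<partial>distr N borel T)"
proof -
  interpret prob_space N using c by (simp add: coupled_at_def)
  have [measurable]: "T \<in> borel_measurable N" "W \<in> borel_measurable N"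
    using c by (simp_all add: coupled_at_def)
  let ?\<mu> = "distr N borel T"
  have pos: "AE t in ?\<mu>. 0 < t" using c by (simp add: AE_distr_iff coupled_at_def)
  show ?thesis
    using u
  proof (induction rule: borel_measurable_induct)
    case (cong f g)
    then have "f = g" by (intro ext) simp
    then show ?case using cong by simp
  next
    case (set A)
    then have A: "UNIV \<times> A \<in> sets (borel \<Otimes>\<^sub>M borel)" by simp
    note [measurable] = set
    have "(\<integral>\<^sup>+\<omega>. indicator A (W \<omega>) \<partial>N) = (\<integral>\<^sup>+\<omega>. indicator {\<omega> \<in> space N. (T \<omega>, W \<omega>) \<in> UNIV \<times> A} \<omega> \<partial>N)"
      by (intro nn_integral_cong) (simp add: indicator_def)
    also have "\<dots> = emeasure N {\<omega> \<in> space N. (T \<omega>, W \<omega>) \<in> UNIV \<times> A}"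
      by (intro nn_integral_indicator) simp
    also have "\<dots> = (\<integral>\<^sup>+t. emeasure (P t) {\<omega> \<in> space (P t). (t, Z t \<omega>) \<in> UNIV \<times> A} \<partial>?\<mu>)"
      using c A unfolding coupled_at_def by blast
    also have "\<dots> \<le> (\<integral>\<^sup>+t. \<integral>\<^sup>+\<omega>. indicator A (Z t \<omega>) \<partial>P t \<partial>?\<mu>)"
    proof (rule nn_integral_mono_AE, rule eventually_mono[OF pos])
      fix t :: real assume "0 < t"
      note [measurable] = Z[OF this]
      have "emeasure (P t) {\<omega> \<in> space (P t). (t, Z t \<omega>) \<in> UNIV \<times> A}
          = (\<integral>\<^sup>+\<omega>. indicator {\<omega> \<in> space (P t). (t, Z t \<omega>) \<in> UNIV \<times> A} \<omega> \<partial>P t)"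
        by (intro nn_integral_indicator[symmetric]) simp
      also have "\<dots> = (\<integral>\<^sup>+\<omega>. indicator A (Z t \<omega>) \<partial>P t)"
        by (intro nn_integral_cong) (simp add: indicator_def)
      finally show "emeasure (P t) {\<omega> \<in> space (P t). (t, Z t \<omega>) \<in> UNIV \<times> A} \<le> (\<integral>\<^sup>+\<omega>. indicator A (Z t \<omega>) \<partial>P t)"
        by simp
    qed
    finally show ?case .
  next
    case (mult u k)
    note [measurable] = mult.hyps(2)
    have "(\<integral>\<^sup>+\<omega>. k * u (W \<omega>) \<partial>N) = k * (\<integral>\<^sup>+\<omega>. u (W \<omega>) \<partial>N)"
      by (intro nn_integral_cmult) measurable
    also have "\<dots> \<le> k * (\<integral>\<^sup>+t. \<integral>\<^sup>+\<omega>. u (Z t \<omega>) \<partial>P t \<partial>?\<mu>)"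
      using mult.IH by (intro mult_left_mono) auto
    also have "\<dots> \<le> (\<integral>\<^sup>+t. k * (\<integral>\<^sup>+\<omega>. u (Z t \<omega>) \<partial>P t) \<partial>?\<mu>)"
      by (rule nn_integral_cmult_le)
    also have "\<dots> \<le> (\<integral>\<^sup>+t. \<integral>\<^sup>+\<omega>. k * u (Z t \<omega>) \<partial>P t \<partial>?\<mu>)"
      by (intro nn_integral_mono nn_integral_cmult_le)
    finally show ?case .
  next
    case (add u v)
    note [measurable] = add.hyps(1,3)
    have "(\<integral>\<^sup>+\<omega>. v (W \<omega>) + u (W \<omega>) \<partial>N) = (\<integral>\<^sup>+\<omega>. v (W \<omega>) \<partial>N) + (\<integral>\<^sup>+\<omega>. u (W \<omega>) \<partial>N)"
      by (intro nn_integral_add) measurable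
    also have "\<dots> \<le> (\<integral>\<^sup>+t. \<integral>\<^sup>+\<omega>. v (Z t \<omega>) \<partial>P t \<partial>?\<mu>) + (\<integral>\<^sup>+t. \<integral>\<^sup>+\<omega>. u (Z t \<omega>) \<partial>P t \<partial>?\<mu>)"
      using add.IH by (intro add_mono)
    also have "\<dots> \<le> (\<integral>\<^sup>+t. (\<integral>\<^sup>+\<omega>. v (Z t \<omega>) \<partial>P t) + (\<integral>\<^sup>+\<omega>. u (Z t \<omega>) \<partial>P t) \<partial>?\<mu>)"
      by (rule nn_integral_superadditive)
    also have "\<dots> \<le> (\<integral>\<^sup>+t. \<integral>\<^sup>+\<omega>. v (Z t \<omega>) + u (Z t \<omega>) \<partial>P t \<partial>?\<mu>)"
      by (intro nn_integral_mono nn_integral_superadditive)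
    finally show ?case .
  next
    case (seq U)
    note [measurable] = seq.hyps(1)
    have inc: "incseq (\<lambda>i \<omega>. U i (W \<omega>))"
      using seq.hyps(3) by (auto simp: incseq_def le_fun_def)
    have "(\<integral>\<^sup>+\<omega>. Sup (range U) (W \<omega>) \<partial>N) = (\<integral>\<^sup>+\<omega>. (SUP i. U i (W \<omega>)) \<partial>N)"
      by (simp add: image_comp)
    also have "\<dots> = (SUP i. \<integral>\<^sup>+\<omega>. U i (W \<omega>) \<partial>N)"
      using inc by (intro nn_integral_monotone_convergence_SUP) measurable
    also have "\<dots> \<le> (\<integral>\<^sup>+t. \<integral>\<^sup>+\<omega>. Sup (range U) (Z t \<omega>) \<partial>P t \<partial>?\<mu>)"
    proof (rule SUP_least)
      fix i
      have "(\<integral>\<^sup>+t. \<integral>\<^sup>+\<omega>. U i (Z t \<omega>) \<partial>P t \<partial>?\<mu>) \<le> (\<integral>\<^sup>+t. \<integral>\<^sup>+\<omega>. Sup (range U) (Z t \<omega>) \<partial>P t \<partial>?\<mu>)"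
        by (intro nn_integral_mono le_funD[OF Sup_upper]) simp
      then show "(\<integral>\<^sup>+\<omega>. U i (W \<omega>) \<partial>N) \<le> (\<integral>\<^sup>+t. \<integral>\<^sup>+\<omega>. Sup (range U) (Z t \<omega>) \<partial>P t \<partial>?\<mu>)"
        using seq.IH[of i] by (rule order.trans[rotated])
    qed
    finally show ?case .
  qed
qed

text \<open>The law of \<open>Z t\<close> is not assumed to be measurable in \<open>t\<close>: upper and lower bounds on the mixture
  come from applying the previous inequality to \<open>g\<close> and to \<open>1 - g\<close>.\<close>

lemma coupled_integral:
  fixes g :: "real \<Rightarrow> real" and G :: "real \<Rightarrow> real"
  assumes c: "coupled_at P Z N T W"
    and Z: "\<And>t. t > 0 \<Longrightarrow> prob_space (P t) \<and> Z t \<in> borel_measurable (P t)"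
    and g: "g \<in> borel_measurable borel" "\<And>x. 0 \<le> g x" "\<And>x. g x \<le> 1"
    and G: "G \<in> borel_measurable borel" "\<And>t. t > 0 \<Longrightarrow> G t = (\<integral>\<omega>. g (Z t \<omega>) \<partial>P t)"
  shows "(\<integral>\<omega>. g (W \<omega>) \<partial>N) = (\<integral>t. G t \<partial>distr N borel T)"
proof -
  interpret prob_space N using c by (simp add: coupled_at_def)
  have [measurable]: "T \<in> borel_measurable N" "W \<in> borel_measurable N"
    using c by (simp_all add: coupled_at_def)
  note [measurable] = g(1) G(1)
  let ?\<mu> = "distr N borel T"
  interpret \<mu>: prob_space ?\<mu> by (rule prob_space_distr) measurable
  have pos: "AE t in ?\<mu>. 0 < t" using c by (simp add: AE_distr_iff coupled_at_def)
  have le: "(\<integral>\<omega>. h (W \<omega>) \<partial>N) \<le> (\<integral>t. H t \<partial>?\<mu>)"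
    if [measurable]: "h \<in> borel_measurable borel" "H \<in> borel_measurable borel"
      and h: "\<And>x. 0 \<le> h x" "\<And>x. h x \<le> 1" and H: "\<And>t. t > 0 \<Longrightarrow> H t = (\<integral>\<omega>. h (Z t \<omega>) \<partial>P t)" for h H :: "real \<Rightarrow> real"
  proof -
    have H01: "0 \<le> H t" "H t \<le> 1" "(\<integral>\<^sup>+\<omega>. ennreal (h (Z t \<omega>)) \<partial>P t) = ennreal (H t)" if t: "t > 0" for t
    proof -
      interpret Pt: prob_space "P t" using Z t by blast
      have [measurable]: "Z t \<in> borel_measurable (P t)" using Z t by blast
      show "0 \<le> H t" "H t \<le> 1" unfolding H[OF t] by (intro Pt.integral_unit_interval h)+
      show "(\<integral>\<^sup>+\<omega>. ennreal (h (Z t \<omega>)) \<partial>P t) = ennreal (H t)"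
        unfolding H[OF t] by (intro Pt.ennreal_integral_unit_interval h) measurable
    qed
    have AEH: "AE t in ?\<mu>. 0 \<le> H t" using pos by (rule eventually_mono) (rule H01)
    have int: "integrable ?\<mu> H"
      by (rule \<mu>.integrable_const_bound[of _ 1]) (auto intro!: eventually_mono[OF pos] simp: H01)
    have "ennreal (\<integral>\<omega>. h (W \<omega>) \<partial>N) = (\<integral>\<^sup>+\<omega>. ennreal (h (W \<omega>)) \<partial>N)"
      by (intro ennreal_integral_unit_interval[symmetric] h) measurable
    also have "\<dots> \<le> (\<integral>\<^sup>+t. \<integral>\<^sup>+\<omega>. ennreal (h (Z t \<omega>)) \<partial>P t \<partial>?\<mu>)"
      by (rule coupled_nn_integral_le[OF c]) (use Z in auto)
    also have "\<dots> = (\<integral>\<^sup>+t. ennreal (H t) \<partial>?\<mu>)"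
      by (rule nn_integral_cong_AE, rule eventually_mono[OF pos]) (simp add: H01)
    also have "\<dots> = ennreal (\<integral>t. H t \<partial>?\<mu>)"
      by (rule nn_integral_eq_integral[OF int AEH])
    finally show ?thesis
      using integral_nonneg_AE[OF AEH] by (subst (asm) ennreal_le_iff) auto
  qed
  have 1: "(\<integral>\<omega>. g (W \<omega>) \<partial>N) \<le> (\<integral>t. G t \<partial>?\<mu>)"
    by (rule le) (use g G in auto)
  have "(\<integral>\<omega>. 1 - g (W \<omega>) \<partial>N) \<le> (\<integral>t. 1 - G t \<partial>?\<mu>)"
  proof (rule le[of "\<lambda>x. 1 - g x" "\<lambda>t. 1 - G t"])
    fix t :: real assume t: "0 < t"
    interpret Pt: prob_space "P t" using Z t by blast
    have [measurable]: "Z t \<in> borel_measurable (P t)" using Z t by blast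
    have "integrable (P t) (\<lambda>\<omega>. g (Z t \<omega>))" by (intro Pt.integrable_unit_interval g) measurable
    then show "1 - G t = (\<integral>\<omega>. 1 - g (Z t \<omega>) \<partial>P t)" using G(2)[OF t] Pt.prob_space by simp
  qed (use g in auto)
  moreover have "integrable N (\<lambda>\<omega>. g (W \<omega>))" by (intro integrable_unit_interval g) measurable
  moreover have "integrable ?\<mu> G"
  proof (rule \<mu>.integrable_const_bound[of _ 1])
    show "AE t in ?\<mu>. norm (G t) \<le> 1"
    proof (rule eventually_mono[OF pos])
      fix t :: real assume t: "0 < t"
      interpret Pt: prob_space "P t" using Z t by blast
      show "norm (G t) \<le> 1" using Pt.integral_unit_interval[of "\<lambda>\<omega>. g (Z t \<omega>)"] g by (simp add: G(2)[OF t])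
    qed
  qed simp
  ultimately have "(\<integral>t. G t \<partial>?\<mu>) \<le> (\<integral>\<omega>. g (W \<omega>) \<partial>N)"
    using prob_space \<mu>.prob_space by simp
  then show ?thesis using 1 by simp
qed

lemma coupled_nonneg:
  assumes c: "coupled_at P Z N T W" and Z: "\<And>t. t > 0 \<Longrightarrow> Z t \<in> borel_measurable (P t)"
    and nn: "\<And>t. t > 0 \<Longrightarrow> AE \<omega> in P t. 0 \<le> Z t \<omega>"
  shows "AE \<omega> in N. 0 \<le> W \<omega>"
proof -
  interpret prob_space N using c by (simp add: coupled_at_def)
  have [measurable]: "T \<in> borel_measurable N" "W \<in> borel_measurable N"
    using c by (simp_all add: coupled_at_def)
  have pos: "AE t in distr N borel T. 0 < t" using c by (simp add: AE_distr_iff coupled_at_def)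
  have "UNIV \<times> {..<0} \<in> sets (borel \<Otimes>\<^sub>M borel :: (real \<times> real) measure)" by simp
  then have "emeasure N {\<omega> \<in> space N. (T \<omega>, W \<omega>) \<in> UNIV \<times> {..<0}}
      = (\<integral>\<^sup>+t. emeasure (P t) {\<omega> \<in> space (P t). (t, Z t \<omega>) \<in> UNIV \<times> {..<0}} \<partial>distr N borel T)"
    using c unfolding coupled_at_def by blast
  also have "\<dots> = (\<integral>\<^sup>+t. 0 \<partial>distr N borel T)"
  proof (rule nn_integral_cong_AE, rule eventually_mono[OF pos])
    fix t :: real assume t: "0 < t"
    note [measurable] = Z[OF t]
    have "AE \<omega> in P t. \<not> (t, Z t \<omega>) \<in> UNIV \<times> {..<0}" using nn[OF t] by (rule eventually_mono) simp
    then show "emeasure (P t) {\<omega> \<in> space (P t). (t, Z t \<omega>) \<in> UNIV \<times> {..<0}} = 0"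
      by (subst (asm) AE_iff_measurable[OF _ refl]) auto
  qed
  finally have "emeasure N {\<omega> \<in> space N. \<not> 0 \<le> W \<omega>} = 0" by (simp add: not_le)
  then show ?thesis by (subst AE_iff_measurable[OF _ refl]) auto
qed

section \<open>Laplace transforms under conditioning on positivity\<close>

context prob_space
begin

text \<open>The exponentials decrease to the indicator of \<open>W = 0\<close> and are dominated by
  1. This reads off a survival probability from a Laplace transform.\<close>

lemma laplace_at_infinity:
  assumes [measurable]: "W \<in> borel_measurable M" and nn: "AE \<omega> in M. 0 \<le> W \<omega>" and c: "c > 0"
  shows "(\<lambda>m. \<integral>\<omega>. exp (- (c * W \<omega> * real m)) \<partial>M) \<longlonglongrightarrow> 1 - prob {\<omega> \<in> space M. 0 < W \<omega>}"
proof -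
  have "(\<lambda>m. \<integral>\<omega>. exp (- (c * W \<omega> * real m)) \<partial>M) \<longlonglongrightarrow> (\<integral>\<omega>. indicator {\<omega> \<in> space M. \<not> 0 < W \<omega>} \<omega> \<partial>M)"
  proof (rule integral_dominated_convergence[where w = "\<lambda>_. 1"])
    show "AE \<omega> in M. (\<lambda>m. exp (- (c * W \<omega> * real m))) \<longlonglongrightarrow> indicator {\<omega> \<in> space M. \<not> 0 < W \<omega>} \<omega>"
      using nn AE_space
    proof eventually_elim
      case (elim \<omega>)
      show ?case
      proof (cases "0 < W \<omega>")
        case True
        then have "filterlim (\<lambda>m. c * W \<omega> * real m) at_top sequentially"
          using c by (intro filterlim_tendsto_pos_mult_at_top[OF tendsto_const] filterlim_real_sequentially) auto
        then have "(\<lambda>m. exp (- (c * W \<omega> * real m))) \<longlonglongrightarrow> 0"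
          by (intro filterlim_compose[OF exp_at_bot] filterlim_compose[OF filterlim_uminus_at_bot_at_top])
        then show ?thesis using True by simp
      next
        case False
        then have "W \<omega> = 0" using elim by simp
        then show ?thesis using elim by simp
      qed
    qed
    show "AE \<omega> in M. norm (exp (- (c * W \<omega> * real m))) \<le> 1" for m
      using nn by (rule eventually_mono) (use c in simp)
  qed auto
  also have "(\<integral>\<omega>. indicator {\<omega> \<in> space M. \<not> 0 < W \<omega>} \<omega> \<partial>M) = prob {\<omega> \<in> space M. \<not> 0 < W \<omega>}"
    by (simp add: Int_absorb1 Int_commute)
  also have "\<dots> = 1 - prob {\<omega> \<in> space M. 0 < W \<omega>}"
    by (rule prob_neg) measurable
  finally show ?thesis .
qed

lemma law_given_pos:
  assumes [measurable]: "W \<in> borel_measurable M" and nn: "AE \<omega> in M. 0 \<le> W \<omega>" and c: "c > 0"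
    and pos: "prob {\<omega> \<in> space M. 0 < W \<omega>} > 0"
  shows "real_distribution (law_given_pos M W c)"
    and "AE x in law_given_pos M W c. 0 \<le> x"
    and "k \<ge> 0 \<Longrightarrow> (\<integral>x. exp (- (k * x)) \<partial>law_given_pos M W c) =
      ((\<integral>\<omega>. exp (- (k * (c * W \<omega>))) \<partial>M) - (1 - prob {\<omega> \<in> space M. 0 < W \<omega>})) / prob {\<omega> \<in> space M. 0 < W \<omega>}"
proof -
  let ?A = "{\<omega> \<in> space M. 0 < W \<omega>}"
  have A: "?A \<in> sets M" by measurable
  have e: "emeasure M ?A \<noteq> 0" "emeasure M ?A \<noteq> \<infinity>"
    using pos by (auto simp: emeasure_eq_measure)
  let ?U = "uniform_measure M ?A"
  interpret U: prob_space ?U by (rule prob_space_uniform_measure[OF e])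
  have m: "(\<lambda>\<omega>. c * W \<omega>) \<in> borel_measurable ?U" by simp
  show "real_distribution (law_given_pos M W c)"
    unfolding law_given_pos_def real_distribution_def real_distribution_axioms_def
    using U.prob_space_distr[OF m] by simp
  show "AE x in law_given_pos M W c. 0 \<le> x"
    unfolding law_given_pos_def
    by (subst AE_distr_iff[OF m]) (use A e c in \<open>auto intro!: AE_uniform_measureI\<close>)
  assume k: "k \<ge> 0"
  have int: "integrable M (\<lambda>\<omega>. exp (- (k * (c * W \<omega>))))"
    by (rule integrable_const_bound[of _ 1], rule eventually_mono[OF nn]) (use k c in auto)
  have i2: "integrable M (indicator (space M - ?A) :: _ \<Rightarrow> real)"
    using A by (intro integrable_real_indicator) (auto simp: emeasure_eq_measure)
  have "(\<integral>x. exp (- (k * x)) \<partial>law_given_pos M W c) = (\<integral>\<omega>. exp (- (k * (c * W \<omega>))) \<partial>?U)"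
    unfolding law_given_pos_def by (subst integral_distr[OF m]) auto
  also have "\<dots> = (\<integral>\<omega>. indicator ?A \<omega> / prob ?A * exp (- (k * (c * W \<omega>))) \<partial>M)"
  proof -
    have "?U = density M (\<lambda>\<omega>. ennreal (indicator ?A \<omega> / prob ?A))"
      unfolding uniform_measure_def using pos
      by (intro arg_cong[where f = "density M"] ext)
        (auto simp: indicator_def emeasure_eq_measure divide_ennreal ennreal_1[symmetric] simp del: ennreal_1)
    then show ?thesis using pos by (simp only:) (subst integral_density, auto)
  qed
  \<comment> \<open>Off \<open>?A\<close> the variable is almost surely 0 and the exponential is 1,
    so restricting to \<open>?A\<close> means subtracting an indicator.\<close>
  also have "\<dots> = (\<integral>\<omega>. (exp (- (k * (c * W \<omega>))) - indicator (space M - ?A) \<omega>) / prob ?A \<partial>M)"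
  proof (rule integral_cong_AE)
    show "AE \<omega> in M. indicator ?A \<omega> / prob ?A * exp (- (k * (c * W \<omega>)))
        = (exp (- (k * (c * W \<omega>))) - indicator (space M - ?A) \<omega>) / prob ?A"
      using nn AE_space by eventually_elim (auto simp: indicator_def not_less)
  qed (use A in measurable)
  also have "\<dots> = ((\<integral>\<omega>. exp (- (k * (c * W \<omega>))) \<partial>M) - prob (space M - ?A)) / prob ?A"
    using int i2 A by (simp add: Int_absorb1)
  also have "prob (space M - ?A) = 1 - prob ?A" using A by (rule prob_compl)
  finally show "(\<integral>x. exp (- (k * x)) \<partial>law_given_pos M W c) =
      ((\<integral>\<omega>. exp (- (k * (c * W \<omega>))) \<partial>M) - (1 - prob ?A)) / prob ?A" .
qed

end

text \<open>Monotonicity in the argument replaces locally uniform convergence: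
  \<open>F n (vs n)\<close> is eventually caught between the values at \<open>v - d / 2\<close> and
  \<open>v + d / 2\<close>, where pointwise convergence is known.\<close>

lemma tendsto_compose_mono:
  fixes F :: "nat \<Rightarrow> real \<Rightarrow> real"
  assumes mono: "\<And>n u v. u \<le> v \<Longrightarrow> F n u \<le> F n v"
    and lim: "\<And>u. (\<lambda>n. F n u) \<longlonglongrightarrow> L u" and cont: "isCont L v" and v: "vs \<longlonglongrightarrow> v"
  shows "(\<lambda>n. F n (vs n)) \<longlonglongrightarrow> L v"
proof (rule LIMSEQ_I)
  fix r :: real assume r: "r > 0"
  obtain d where d: "d > 0" "\<And>u. \<bar>u - v\<bar> < d \<Longrightarrow> \<bar>L u - L v\<bar> < r / 2"
    using cont r unfolding continuous_at_eps_delta dist_real_def by (metis half_gt_zero)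
  have "\<forall>\<^sub>F n in sequentially. \<bar>F n (v - d / 2) - L (v - d / 2)\<bar> < r / 2"
    "\<forall>\<^sub>F n in sequentially. \<bar>F n (v + d / 2) - L (v + d / 2)\<bar> < r / 2"
    "\<forall>\<^sub>F n in sequentially. \<bar>vs n - v\<bar> < d / 2"
    using tendstoD[OF lim, of "r / 2"] tendstoD[OF v, of "d / 2"] r d(1) by (auto simp: dist_real_def)
  then have "\<forall>\<^sub>F n in sequentially. norm (F n (vs n) - L v) < r"
  proof eventually_elim
    case (elim n)
    have "F n (v - d / 2) \<le> F n (vs n)" "F n (vs n) \<le> F n (v + d / 2)"
      by (intro mono; use elim in linarith)+
    moreover have "\<bar>L (v - d / 2) - L v\<bar> < r / 2" "\<bar>L (v + d / 2) - L v\<bar> < r / 2"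
      by (intro d(2); use d(1) in simp)+
    ultimately show ?case using elim unfolding real_norm_def by linarith
  qed
  then show "\<exists>no. \<forall>n\<ge>no. norm (F n (vs n) - L v) < r" by (simp add: eventually_sequentially)
qed

section \<open>Passage to the limit\<close>

definition max_test :: "nat \<Rightarrow> nat \<Rightarrow> real \<Rightarrow> (vertex \<Rightarrow> real) \<Rightarrow> real" where
  "max_test b n m h = (if \<forall>x\<in>leaves b n. sqrt (h x) \<le> m then 1 else 0)"

definition laplace_test :: "nat \<Rightarrow> nat \<Rightarrow> real \<Rightarrow> (vertex \<Rightarrow> real) \<Rightarrow> real" where
  "laplace_test b n c h = exp (- (c * leaf_functional b n h))"

lemma leaf_functional_nonneg: "0 \<le> leaf_functional b n h"
  unfolding leaf_functional_def by (intro mult_nonneg_nonneg sum_nonneg) auto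

lemma measurable_leaf_functional:
  assumes [measurable]: "\<And>x. (\<lambda>\<omega>. H \<omega> x) \<in> borel_measurable N"
  shows "(\<lambda>\<omega>. leaf_functional b n (H \<omega>)) \<in> borel_measurable N"
  unfolding leaf_functional_def by measurable

lemma replicate_in_leaves: "b \<ge> 1 \<Longrightarrow> replicate n 0 \<in> leaves b n"
  by (auto simp: leaves_def tree_vertices_def)

lemma leaf_test_max_test: "leaf_test b n (max_test b n m)"
  unfolding leaf_test_def
proof (intro conjI allI impI)
  show "max_test b n m \<in> borel_measurable (PiM UNIV (\<lambda>_. borel))"
    unfolding max_test_def by (intro measurable_If pred_intros_finite) measurable
qed (simp_all add: max_test_def)

lemma leaf_test_laplace_test:
  assumes "c \<ge> 0"
  shows "leaf_test b n (laplace_test b n c)"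
  unfolding leaf_test_def
proof (intro conjI allI impI)
  have "(\<lambda>h. leaf_functional b n h) \<in> borel_measurable (PiM UNIV (\<lambda>_. borel))"
    by (intro measurable_leaf_functional) measurable
  then show "laplace_test b n c \<in> borel_measurable (PiM UNIV (\<lambda>_. borel))"
    unfolding laplace_test_def by measurable
next
  fix h h' :: "vertex \<Rightarrow> real" assume "\<forall>x\<in>leaves b n. h x = h' x"
  then show "laplace_test b n c h = laplace_test b n c h'"
    by (simp add: laplace_test_def leaf_functional_def cong: sum.cong)
qed (use assms leaf_functional_nonneg in \<open>auto simp: laplace_test_def\<close>)

lemma max_test_symmetric:
  assumes "bij_betw \<sigma> (leaves b n) (leaves b n)"
  shows "max_test b n m (h \<circ> \<sigma>) = max_test b n m h"
proof -
  have "(\<forall>x\<in>leaves b n. sqrt (h (\<sigma> x)) \<le> m) \<longleftrightarrow> (\<forall>y\<in>\<sigma> ` leaves b n. sqrt (h y) \<le> m)" by blast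
  also have "\<sigma> ` leaves b n = leaves b n" using assms by (simp add: bij_betw_def)
  finally show ?thesis unfolding max_test_def comp_def by (simp only:)
qed

lemma laplace_test_symmetric:
  assumes "bij_betw \<sigma> (leaves b n) (leaves b n)"
  shows "laplace_test b n c (h \<circ> \<sigma>) = laplace_test b n c h"
proof -
  have "leaf_functional b n (h \<circ> \<sigma>) = leaf_functional b n h"
    unfolding leaf_functional_def comp_def
    using sum.reindex_bij_betw[OF assms, of "\<lambda>x. max 0 (real n * sqrt (ln (real b)) - sqrt (h x)) *
        h x powr (1 / 4) * exp (2 * sqrt (ln (real b)) * sqrt (h x))"] by simp
  then show ?thesis by (simp add: laplace_test_def)
qed

lemma prob_max_sqrt_leaves:
  assumes "b \<ge> 1"
  shows "measure M {\<omega> \<in> space M. max_sqrt_leaves b n (H \<omega>) \<le> m} = (\<integral>\<omega>. max_test b n m (H \<omega>) \<partial>M)"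
proof -
  have "max_sqrt_leaves b n h \<le> m \<longleftrightarrow> (\<forall>x\<in>leaves b n. sqrt (h x) \<le> m)" for h
    unfolding max_sqrt_leaves_def using replicate_in_leaves[OF assms, of n]
    by (subst Max_le_iff) auto
  then have "(\<integral>\<omega>. max_test b n m (H \<omega>) \<partial>M)
      = (\<integral>\<omega>. indicator {\<omega> \<in> space M. max_sqrt_leaves b n (H \<omega>) \<le> m} \<omega> \<partial>M)"
    by (intro Bochner_Integration.integral_cong) (auto simp: max_test_def indicator_def)
  also have "\<dots> = measure M {\<omega> \<in> space M. max_sqrt_leaves b n (H \<omega>) \<le> m}"
    by (simp add: Int_absorb1 Int_commute)
  finally show ?thesis ..
qed

text \<open>The weight \<open>g 1\<close> of \<open>stopped_mean_harmonic\<close>: the probability,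
  from a child of the root, of reaching the leaves before the root.\<close>

definition escape_prob :: "nat \<Rightarrow> nat \<Rightarrow> real" where
  "escape_prob b n = (1 - 1 / real b) / (1 - (1 / real b) ^ n)"

lemma escape_prob_tendsto:
  assumes "b \<ge> 2"
  shows "escape_prob b \<longlonglongrightarrow> 1 - 1 / real b"
proof -
  have "(\<lambda>n. (1 / real b) ^ n) \<longlonglongrightarrow> 0"
    using assms by (intro LIMSEQ_realpow_zero) auto
  then have "(\<lambda>n. (1 - 1 / real b) / (1 - (1 / real b) ^ n)) \<longlonglongrightarrow> (1 - 1 / real b) / (1 - 0)"
    using assms by (intro tendsto_intros) auto
  then show ?thesis by (simp add: escape_prob_def[abs_def])
qed

text \<open>The walk either returns to the root with all leaves untouched, where \<open>f\<close> is
  1, or reaches some leaf first; symmetry gives every leaf the mean found at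
  \<open>x\<close>.\<close>

lemma stopped_mean_child:
  assumes n: "n \<ge> 1" and b: "b \<ge> 2" and f: "leaf_test b n f"
    and sym: "\<And>h \<sigma>. bij_betw \<sigma> (leaves b n) (leaves b n) \<Longrightarrow> f (h \<circ> \<sigma>) = f h"
    and f0: "f (\<lambda>_. 0) = 1" and x: "x \<in> leaves b n" and i: "i < b"
  shows "stopped_mean b n f [i] 0 (\<lambda>_. 0) =
    1 - escape_prob b n * (1 - (\<integral>\<omega>. f (hitting_field b n x \<omega>) \<partial>walk_space b n))"
proof -
  have b1: "b \<ge> 1" using b by simp
  let ?\<theta> = "\<integral>\<omega>. f (hitting_field b n x \<omega>) \<partial>walk_space b n"
  have leaf: "stopped_mean b n f y 0 (\<lambda>_. 0) = ?\<theta>" if "y \<in> leaves b n" for y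
    using stopped_mean_leaf_symmetric[OF n b1 f sym that x]
      integral_hitting_field[OF n b1 leaves_subset_tree[OF x] f] by simp
  have "[i] \<in> tree_vertices b n" using i n by (simp add: Cons_in_tree)
  from stopped_mean_harmonic[OF n b f leaf this]
  have "stopped_mean b n f [i] 0 (\<lambda>_. 0) = (1 - escape_prob b n) * 1 + escape_prob b n * ?\<theta>"
    by (simp add: f0 escape_prob_def)
  then show ?thesis by (simp add: algebra_simps)
qed

text \<open>All children of the root have the same mean, which makes the average in
  \<open>stopped_mean_small_time\<close> explicit. The bound depends on \<open>b\<close> and
  \<open>t\<close> but on neither the depth nor the test.\<close>

theorem small_time_expansion:
  assumes n: "n \<ge> 1" and b: "b \<ge> 2" and t: "t \<ge> 0" and f: "leaf_test b n f"
    and sym: "\<And>h \<sigma>. bij_betw \<sigma> (leaves b n) (leaves b n) \<Longrightarrow> f (h \<circ> \<sigma>) = f h"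
    and f0: "f (\<lambda>_. 0) = 1" and x: "x \<in> leaves b n"
  defines "a \<equiv> 1 - exp (- real b * t)"
  shows "\<bar>(\<integral>\<omega>. f (root_time_field b n t \<omega>) \<partial>walk_space b n) -
    (1 - a * (escape_prob b n * (1 - (\<integral>\<omega>. f (hitting_field b n x \<omega>) \<partial>walk_space b n))))\<bar> \<le> a\<^sup>2"
proof -
  have b1: "b \<ge> 1" using b by simp
  let ?q = "escape_prob b n * (1 - (\<integral>\<omega>. f (hitting_field b n x \<omega>) \<partial>walk_space b n))"
  have "nbr_avg b n [] (\<lambda>w. stopped_mean b n f w 0 (\<lambda>_. 0)) = nbr_avg b n [] (\<lambda>_. 1 - ?q)"
    using n stopped_mean_child[OF n b f sym f0 x]
    by (intro nbr_avg_cong) (auto simp: neighbours_root)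
  also have "\<dots> = 1 - ?q" by (rule nbr_avg_const[OF n b1 root_in_tree])
  finally have avg: "nbr_avg b n [] (\<lambda>w. stopped_mean b n f w 0 (\<lambda>_. 0)) = 1 - ?q" .
  have "(1 - a) * 1 + a * (1 - ?q) = 1 - a * ?q" by (simp add: algebra_simps)
  then show ?thesis
    using stopped_mean_small_time[OF n b1 t f, of "\<lambda>_. 0"]
    unfolding integral_root_time_field[OF n b1 t f] a_def[symmetric] f0 avg by (simp only:)
qed

lemma filterlim_max_level:
  assumes "b \<ge> 2"
  shows "filterlim (\<lambda>n. max_level b n u) at_top sequentially"
proof -
  define s where "s = sqrt (ln (real b))"
  have "s > 0" using assms by (simp add: s_def)
  then have "filterlim (\<lambda>n. s * real n - ln (real n) / s + u) at_top sequentially"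
    by real_asymp
  then show ?thesis by (simp add: max_level_def s_def)
qed

section \<open>Laplace transforms of the limit variables\<close>

locale leaf_limits =
  fixes b :: nat
    and P :: "real \<Rightarrow> 'p measure" and Z :: "real \<Rightarrow> 'p \<Rightarrow> real"
    and C_star :: real
    and Q :: "'q measure" and \<Z> :: "'q \<Rightarrow> real"
  assumes b: "b \<ge> 2"
    and Z_rv: "\<And>t. t > 0 \<Longrightarrow> prob_space (P t) \<and> Z t \<in> borel_measurable (P t)"
    and Z_nonneg: "\<And>t. t > 0 \<Longrightarrow> AE \<omega> in P t. 0 \<le> Z t \<omega>"
    and Z_limit: "\<And>t. t > 0 \<Longrightarrow>
      weak_conv_m
        (\<lambda>n. distr (walk_space b n) borel (\<lambda>\<omega>. leaf_functional b n (root_time_field b n t \<omega>)))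
        (distr (P t) borel (Z t))"
    and C_pos: "C_star > 0"
    and C_max: "\<And>t u. t > 0 \<Longrightarrow>
      (\<lambda>n. \<P>(\<omega> in walk_space b n.
              max_sqrt_leaves b n (root_time_field b n t \<omega>) \<le> max_level b n u))
      \<longlonglongrightarrow> (\<integral>\<omega>. exp (- C_star * Z t \<omega> * exp (- 2 * u * sqrt (ln (real b)))) \<partial>P t)"
    and ZZ_rv: "prob_space Q" "\<Z> \<in> borel_measurable Q"
    and ZZ_pos: "AE \<omega> in Q. 0 < \<Z> \<omega>"
    and ZZ_max: "\<And>x u. (\<And>n. x n \<in> leaves b n) \<Longrightarrow>
      (\<lambda>n. \<P>(\<omega> in walk_space b n.
              max_sqrt_leaves b n (hitting_field b n (x n) \<omega>) \<le> max_level b n u))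
      \<longlonglongrightarrow> (\<integral>\<omega>. exp (- \<Z> \<omega> * exp (- 2 * u * sqrt (ln (real b)))) \<partial>Q)"
begin

interpretation Q: prob_space Q by (rule ZZ_rv(1))

definition Z_laplace :: "real \<Rightarrow> real \<Rightarrow> real" where
  "Z_laplace t l = (\<integral>\<omega>. exp (- (C_star * Z t \<omega> * l)) \<partial>P t)"

definition ZZ_laplace :: "real \<Rightarrow> real" where
  "ZZ_laplace l = (\<integral>\<omega>. exp (- (\<Z> \<omega> * l)) \<partial>Q)"

definition p_inf :: real where
  "p_inf = 1 - 1 / real b"

lemma b1: "b \<ge> 1"
  using b by simp

lemma p_inf_pos: "0 < p_inf"
  using b by (simp add: p_inf_def)

lemma sqrt_ln_pos: "0 < sqrt (ln (real b))"
  using b by simp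

lemma exists_level: "l > 0 \<Longrightarrow> \<exists>u. exp (- 2 * u * sqrt (ln (real b))) = l"
  using sqrt_ln_pos by (intro exI[of _ "- ln l / (2 * sqrt (ln (real b)))"]) simp

text \<open>The zero field passes the test only at a nonnegative level; this supplies the condition
  \<open>f0\<close> of \<open>small_time_expansion\<close> for large depth.\<close>

lemma max_test_zero: "\<forall>\<^sub>F n in sequentially. max_test b n (max_level b n u) (\<lambda>_. 0) = 1"
proof -
  have "\<forall>\<^sub>F n in sequentially. 0 \<le> max_level b n u"
    using filterlim_max_level[OF b, of u] by (simp add: filterlim_at_top)
  then show ?thesis by (rule eventually_mono) (simp add: max_test_def)
qed

lemma root_time_limit:
  assumes "t > 0"
  shows "(\<lambda>n. \<integral>\<omega>. max_test b n (max_level b n u) (root_time_field b n t \<omega>) \<partial>walk_space b n)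
    \<longlonglongrightarrow> Z_laplace t (exp (- 2 * u * sqrt (ln (real b))))"
  using C_max[OF assms, of u] unfolding prob_max_sqrt_leaves[OF b1] Z_laplace_def by simp

lemma hitting_limit:
  "(\<lambda>n. \<integral>\<omega>. max_test b n (max_level b n u) (hitting_field b n (replicate n 0) \<omega>) \<partial>walk_space b n)
    \<longlonglongrightarrow> ZZ_laplace (exp (- 2 * u * sqrt (ln (real b))))"
  using ZZ_max[of "\<lambda>n. replicate n 0" u, OF replicate_in_leaves[OF b1]]
  unfolding prob_max_sqrt_leaves[OF b1] ZZ_laplace_def by simp

lemma escape_hitting_limit:
  assumes "l > 0" and u: "exp (- 2 * u * sqrt (ln (real b))) = l"
  shows "(\<lambda>n. escape_prob b n * (1 - (\<integral>\<omega>. max_test b n (max_level b n u)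
      (hitting_field b n (replicate n 0) \<omega>) \<partial>walk_space b n))) \<longlonglongrightarrow> p_inf * (1 - ZZ_laplace l)"
  using escape_prob_tendsto[OF b] hitting_limit[of u] unfolding u p_inf_def
  by (intro tendsto_intros)

lemma Z_laplace_small_time:
  assumes t: "t > 0" and l: "l > 0"
  defines "a \<equiv> 1 - exp (- real b * t)"
  shows "\<bar>Z_laplace t l - (1 - a * (p_inf * (1 - ZZ_laplace l)))\<bar> \<le> a\<^sup>2"
proof -
  obtain u where u: "exp (- 2 * u * sqrt (ln (real b))) = l" using exists_level[OF l] by blast
  let ?E = "\<lambda>n. \<integral>\<omega>. max_test b n (max_level b n u) (root_time_field b n t \<omega>) \<partial>walk_space b n"
  let ?q = "\<lambda>n. escape_prob b n * (1 - (\<integral>\<omega>. max_test b n (max_level b n u)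
      (hitting_field b n (replicate n 0) \<omega>) \<partial>walk_space b n))"
  have "(\<lambda>n. \<bar>?E n - (1 - a * ?q n)\<bar>) \<longlonglongrightarrow> \<bar>Z_laplace t l - (1 - a * (p_inf * (1 - ZZ_laplace l)))\<bar>"
    by (intro tendsto_rabs tendsto_diff tendsto_const tendsto_mult_left
        root_time_limit[OF t, of u, unfolded u] escape_hitting_limit[OF l u])
  moreover have "\<forall>\<^sub>F n in sequentially. \<bar>?E n - (1 - a * ?q n)\<bar> \<le> a\<^sup>2"
    using max_test_zero[of u] eventually_ge_at_top[of 1]
  proof eventually_elim
    case (elim n)
    show ?case
      unfolding a_def using t
      by (intro small_time_expansion[OF elim(2) b _ leaf_test_max_test max_test_symmetric elim(1)
            replicate_in_leaves[OF b1]]) auto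
  qed
  ultimately show ?thesis by (rule tendsto_upperbound) simp
qed

lemma ZZ_laplace_at_infinity: "(\<lambda>m. ZZ_laplace (real m)) \<longlonglongrightarrow> 0"
proof -
  have "Q.prob {\<omega> \<in> space Q. 0 < \<Z> \<omega>} = 1"
    using ZZ_pos ZZ_rv by (intro Q.prob_Collect_eq_1[THEN iffD2]) measurable
  then show ?thesis
    using Q.laplace_at_infinity[OF ZZ_rv(2), of 1] ZZ_pos
    by (simp add: ZZ_laplace_def eventually_mono less_imp_le)
qed

lemma ZZ_laplace_le_1: "l \<ge> 0 \<Longrightarrow> ZZ_laplace l \<le> 1" "0 \<le> ZZ_laplace l"
proof -
  show "0 \<le> ZZ_laplace l" unfolding ZZ_laplace_def by (intro integral_nonneg_AE) simp
  assume l: "l \<ge> 0"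
  have le: "AE \<omega> in Q. exp (- (\<Z> \<omega> * l)) \<le> 1" using ZZ_pos by (rule eventually_mono) (use l in simp)
  have "integrable Q (\<lambda>\<omega>. exp (- (\<Z> \<omega> * l)))"
    by (rule Q.integrable_const_bound[of _ 1]) (use le ZZ_rv in auto)
  then have "ZZ_laplace l \<le> (\<integral>\<omega>. 1 \<partial>Q)"
    unfolding ZZ_laplace_def using le by (intro integral_mono_AE) auto
  then show "ZZ_laplace l \<le> 1" using Q.prob_space by simp
qed

lemma ZZ_law:
  shows "real_distribution (distr Q borel \<Z>)" "AE x in distr Q borel \<Z>. 0 \<le> x"
    "(\<integral>x. exp (- (k * x)) \<partial>distr Q borel \<Z>) = ZZ_laplace k"
proof -
  note [measurable] = ZZ_rv(2)
  show "real_distribution (distr Q borel \<Z>)"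
    using Q.prob_space_distr[OF ZZ_rv(2)] by (simp add: real_distribution_def real_distribution_axioms_def)
  show "AE x in distr Q borel \<Z>. 0 \<le> x"
    by (subst AE_distr_iff) (auto intro: eventually_mono[OF ZZ_pos])
  show "(\<integral>x. exp (- (k * x)) \<partial>distr Q borel \<Z>) = ZZ_laplace k"
    by (subst integral_distr) (auto simp: ZZ_laplace_def mult.commute)
qed

lemma survival_small_time:
  assumes t: "t > 0"
  defines "a \<equiv> 1 - exp (- real b * t)"
  shows "\<bar>\<P>(\<omega> in P t. 0 < Z t \<omega>) - a * p_inf\<bar> \<le> a\<^sup>2"
proof -
  interpret Pt: prob_space "P t" using Z_rv[OF t] by blast
  have "(\<lambda>m. \<bar>Z_laplace t (real m) - (1 - a * (p_inf * (1 - ZZ_laplace (real m))))\<bar>)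
      \<longlonglongrightarrow> \<bar>(1 - Pt.prob {\<omega> \<in> space (P t). 0 < Z t \<omega>}) - (1 - a * (p_inf * (1 - 0)))\<bar>"
    unfolding Z_laplace_def
    by (intro tendsto_intros ZZ_laplace_at_infinity Pt.laplace_at_infinity Z_nonneg t C_pos)
      (use Z_rv t in auto)
  moreover have "\<forall>\<^sub>F m in sequentially. \<bar>Z_laplace t (real m) - (1 - a * (p_inf * (1 - ZZ_laplace (real m))))\<bar> \<le> a\<^sup>2"
    unfolding a_def by (rule eventually_mono[OF eventually_gt_at_top[of 0]]) (intro Z_laplace_small_time t, simp)
  ultimately have "\<bar>(1 - Pt.prob {\<omega> \<in> space (P t). 0 < Z t \<omega>}) - (1 - a * (p_inf * (1 - 0)))\<bar> \<le> a\<^sup>2"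
    by (rule tendsto_upperbound) simp
  then show ?thesis by (simp add: abs_minus_commute)
qed

section \<open>The law conditional on survival at small time\<close>

theorem conditional_limit:
  assumes t: "filterlim t (at_right 0) sequentially"
    and Z_pos: "\<And>s. s > 0 \<Longrightarrow> \<P>(\<omega> in P s. 0 < Z s \<omega>) > 0"
  shows "weak_conv_m (\<lambda>k. law_given_pos (P (t k)) (Z (t k)) C_star) (distr Q borel \<Z>)"
proof -
  \<comment> \<open>Finitely many \<open>t k\<close> may be nonpositive, where nothing is known
    about \<open>P\<close> and \<open>Z\<close>; they are replaced by 1 and restored at the
    end.\<close>
  define s where "s k = (if t k > 0 then t k else 1)" for k
  have s: "s k > 0" for k by (simp add: s_def)
  have ev: "\<forall>\<^sub>F k in sequentially. s k = t k"
  proof -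
    have "\<forall>\<^sub>F k in sequentially. t k > 0"
      using t eventually_at_right_less[of "0::real"] by (rule filterlim_iff[THEN iffD1, rule_format])
    then show ?thesis by (rule eventually_mono) (simp add: s_def)
  qed
  have s0: "s \<longlonglongrightarrow> 0"
    using t filterlim_cong[OF refl refl ev] by (simp add: filterlim_at)
  define a where "a k = 1 - exp (- real b * s k)" for k
  have apos: "a k > 0" for k using s[of k] b by (simp add: a_def)
  have a0: "a \<longlonglongrightarrow> 0"
    unfolding a_def using s0 by (auto intro!: tendsto_eq_intros)
  note law = prob_space.law_given_pos[OF conjunct1[OF Z_rv[OF s]] conjunct2[OF Z_rv[OF s]] Z_nonneg[OF s] C_pos Z_pos[OF s]]
  have "weak_conv_m (\<lambda>k. law_given_pos (P (s k)) (Z (s k)) C_star) (distr Q borel \<Z>)"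
  proof (rule laplace_conv_imp_weak_conv[OF law(1) ZZ_law(1) law(2) ZZ_law(2)])
    fix j :: nat assume j: "j > 0"
    let ?\<phi> = "ZZ_laplace (real j)"
    have \<phi>: "0 \<le> ?\<phi>" "?\<phi> \<le> 1" using ZZ_laplace_le_1 by auto
    let ?L = "\<lambda>k. \<integral>x. exp (- (real j * x)) \<partial>law_given_pos (P (s k)) (Z (s k)) C_star"
    \<comment> \<open>The first-order terms of \<open>G\<close> and \<open>\<pi>\<close> match, so
      they cancel in \<open>G - (1 - \<pi>) - \<pi> * ?\<phi>\<close> and leave two errors of size
      \<open>(a k) ^ 2\<close>. Division by \<open>\<pi>\<close>, which is at least
      \<open>a k * (p_inf - a k)\<close>, leaves an error of order \<open>a k\<close>.\<close>
    have bound: "\<bar>?L k - ?\<phi>\<bar> \<le> 2 * a k / (p_inf - a k)" if ak: "a k < p_inf" for k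
    proof -
      define G \<pi> where "G = Z_laplace (s k) (real j)" and "\<pi> = \<P>(\<omega> in P (s k). 0 < Z (s k) \<omega>)"
      have L: "?L k = (G - (1 - \<pi>)) / \<pi>"
        using law(3)[of "real j" k] by (simp add: G_def \<pi>_def Z_laplace_def mult_ac)
      have 1: "\<bar>G - (1 - a k * (p_inf * (1 - ?\<phi>)))\<bar> \<le> (a k)\<^sup>2"
        unfolding G_def a_def using j by (intro Z_laplace_small_time s) simp
      have 2: "\<bar>\<pi> - a k * p_inf\<bar> \<le> (a k)\<^sup>2"
        unfolding \<pi>_def a_def by (intro survival_small_time s)
      have 3: "\<bar>(\<pi> - a k * p_inf) * (1 - ?\<phi>)\<bar> \<le> (a k)\<^sup>2 * 1"
        unfolding abs_mult using 2 \<phi> by (intro mult_mono) auto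
      have \<pi>: "a k * (p_inf - a k) \<le> \<pi>"
        using 2 by (simp add: power2_eq_square algebra_simps abs_le_iff)
      have den: "0 < a k * (p_inf - a k)" using apos[of k] ak by simp
      have "G - (1 - \<pi>) - \<pi> * ?\<phi> = (G - (1 - a k * (p_inf * (1 - ?\<phi>)))) + (\<pi> - a k * p_inf) * (1 - ?\<phi>)"
        by (simp add: algebra_simps)
      also have "\<bar>\<dots>\<bar> \<le> (a k)\<^sup>2 + (a k)\<^sup>2 * 1"
        using 1 3 by (intro order.trans[OF abs_triangle_ineq] add_mono)
      finally have num: "\<bar>G - (1 - \<pi>) - \<pi> * ?\<phi>\<bar> \<le> 2 * (a k)\<^sup>2" by simp
      have "?L k - ?\<phi> = (G - (1 - \<pi>) - \<pi> * ?\<phi>) / \<pi>"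
        unfolding L using \<pi> den by (simp add: field_simps)
      then have "\<bar>?L k - ?\<phi>\<bar> = \<bar>G - (1 - \<pi>) - \<pi> * ?\<phi>\<bar> / \<pi>" using \<pi> den by simp
      also have "\<dots> \<le> (2 * (a k)\<^sup>2) / (a k * (p_inf - a k))"
        using num \<pi> den by (intro frac_le) auto
      also have "\<dots> = 2 * a k / (p_inf - a k)"
        using apos[of k] by (simp add: power2_eq_square)
      finally show ?thesis .
    qed
    have "(\<lambda>k. 2 * a k / (p_inf - a k)) \<longlonglongrightarrow> 2 * 0 / (p_inf - 0)"
      using a0 p_inf_pos by (intro tendsto_intros) auto
    then have lim0: "(\<lambda>k. 2 * a k / (p_inf - a k)) \<longlonglongrightarrow> 0" by simp
    have "\<forall>\<^sub>F k in sequentially. norm (?L k - ?\<phi>) \<le> 2 * a k / (p_inf - a k)"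
      using order_tendstoD(2)[OF a0 p_inf_pos] by (rule eventually_mono) (use bound in simp)
    from this lim0 have "(\<lambda>k. ?L k - ?\<phi>) \<longlonglongrightarrow> 0" by (rule Lim_null_comparison)
    then show "?L \<longlonglongrightarrow> (\<integral>x. exp (- (real j * x)) \<partial>distr Q borel \<Z>)"
      unfolding ZZ_law(3) by (simp add: LIM_zero_iff)
  qed
  then show ?thesis
    unfolding weak_conv_m_def weak_conv_def
  proof (intro allI impI)
    fix x
    assume *: "\<forall>x. isCont (cdf (distr Q borel \<Z>)) x \<longrightarrow>
        (\<lambda>k. cdf (law_given_pos (P (s k)) (Z (s k)) C_star) x) \<longlonglongrightarrow> cdf (distr Q borel \<Z>) x"
      and "isCont (cdf (distr Q borel \<Z>)) x"
    then have "(\<lambda>k. cdf (law_given_pos (P (s k)) (Z (s k)) C_star) x) \<longlonglongrightarrow> cdf (distr Q borel \<Z>) x"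
      by blast
    then show "(\<lambda>k. cdf (law_given_pos (P (t k)) (Z (t k)) C_star) x) \<longlonglongrightarrow> cdf (distr Q borel \<Z>) x"
      by (rule Lim_transform_eventually) (rule eventually_mono[OF ev], simp)
  qed
qed

section \<open>The leaf functional at the hitting time of the root\<close>

lemma root_functional_limit:
  assumes t: "t > 0" and l: "l \<ge> 0"
  shows "(\<lambda>n. \<integral>\<omega>. laplace_test b n (C_star * l) (root_time_field b n t \<omega>) \<partial>walk_space b n) \<longlonglongrightarrow> Z_laplace t l"
proof -
  interpret Pt: prob_space "P t" using Z_rv[OF t] by blast
  have [measurable]: "Z t \<in> borel_measurable (P t)" using Z_rv[OF t] by blast
  have [measurable]: "(\<lambda>\<omega>. leaf_functional b n (root_time_field b n t \<omega>)) \<in> borel_measurable (walk_space b n)" for n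
    by (intro measurable_leaf_functional) measurable
  \<comment> \<open>The absolute value makes the test function bounded on the whole line, as weak
    convergence requires; on the nonnegative variables concerned it changes nothing.\<close>
  let ?f = "\<lambda>x::real. exp (- (C_star * l * \<bar>x\<bar>))"
  have "(\<lambda>n. \<integral>x. ?f x \<partial>distr (walk_space b n) borel (\<lambda>\<omega>. leaf_functional b n (root_time_field b n t \<omega>)))
      \<longlonglongrightarrow> (\<integral>x. ?f x \<partial>distr (P t) borel (Z t))"
  proof (rule weak_conv_imp_integral_bdd_continuous_conv[where B = 1])
    show "real_distribution (distr (walk_space b n) borel (\<lambda>\<omega>. leaf_functional b n (root_time_field b n t \<omega>)))" for n
      unfolding real_distribution_def real_distribution_axioms_def
      by (auto intro!: walk_space.prob_space_distr)
    show "real_distribution (distr (P t) borel (Z t))"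
      unfolding real_distribution_def real_distribution_axioms_def
      by (auto intro!: Pt.prob_space_distr)
    show "isCont ?f x" for x by (intro continuous_intros)
    show "norm (?f x) \<le> 1" for x using C_pos l by simp
  qed (rule Z_limit[OF t])
  moreover have "(\<integral>x. ?f x \<partial>distr (walk_space b n) borel (\<lambda>\<omega>. leaf_functional b n (root_time_field b n t \<omega>)))
      = (\<integral>\<omega>. laplace_test b n (C_star * l) (root_time_field b n t \<omega>) \<partial>walk_space b n)" for n
    by (subst integral_distr) (simp_all add: laplace_test_def leaf_functional_nonneg)
  moreover have "(\<integral>x. ?f x \<partial>distr (P t) borel (Z t)) = Z_laplace t l"
    unfolding Z_laplace_def
  proof (subst integral_distr; (intro integral_cong_AE)?)
    show "AE \<omega> in P t. ?f (Z t \<omega>) = exp (- (C_star * Z t \<omega> * l))"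
      using Z_nonneg[OF t] by (rule eventually_mono) (simp add: mult_ac)
  qed measurable
  ultimately show ?thesis by simp
qed

theorem hitting_functional_limit:
  assumes x: "\<And>n. x n \<in> leaves b n"
  shows "weak_conv_m
    (\<lambda>n. distr (walk_space b n) borel (\<lambda>\<omega>. C_star * leaf_functional b n (hitting_field b n (x n) \<omega>)))
    (distr Q borel \<Z>)"
proof -
  have [measurable]: "(\<lambda>\<omega>. leaf_functional b n (hitting_field b n (x n) \<omega>)) \<in> borel_measurable (walk_space b n)" for n
    by (intro measurable_leaf_functional) measurable
  show ?thesis
  proof (rule laplace_conv_imp_weak_conv[OF _ ZZ_law(1) _ ZZ_law(2)])
    show "real_distribution (distr (walk_space b n) borel (\<lambda>\<omega>. C_star * leaf_functional b n (hitting_field b n (x n) \<omega>)))" for n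
      unfolding real_distribution_def real_distribution_axioms_def
      by (auto intro!: walk_space.prob_space_distr)
    show "AE y in distr (walk_space b n) borel (\<lambda>\<omega>. C_star * leaf_functional b n (hitting_field b n (x n) \<omega>)). 0 \<le> y" for n
      using C_pos by (subst AE_distr_iff) (auto simp: leaf_functional_nonneg)
    fix k :: nat assume k: "k > 0"
    define c where "c = C_star * real k"
    have c: "c \<ge> 0" using C_pos by (simp add: c_def)
    define \<theta> where "\<theta> n = (\<integral>\<omega>. laplace_test b n c (hitting_field b n (x n) \<omega>) \<partial>walk_space b n)" for n
    define D where "D = p_inf * (1 - ZZ_laplace (real k))"
    have "(\<lambda>n. escape_prob b n * (1 - \<theta> n)) \<longlonglongrightarrow> D"
    proof (rule LIMSEQ_I)
      fix r :: real assume r: "r > 0"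
      \<comment> \<open>The small time is fixed before the depth: two expansion errors
        \<open>a ^ 2\<close> and a convergence error below \<open>a * (r / 4)\<close> remain below
        \<open>a * r\<close>, and \<open>a\<close> is then divided out. The bound
        \<open>1 / 2\<close> keeps \<open>1 - a\<close> positive, so that \<open>t\<close> can be
        solved from \<open>a\<close>.\<close>
      define a where "a = min (1 / 2) (r / 4)"
      have a: "0 < a" "a < 1" "a \<le> r / 4" using r by (auto simp: a_def)
      define t where "t = - ln (1 - a) / real b"
      have "ln (1 - a) < 0" using a by (intro ln_less_zero) auto
      then have t: "t > 0" using b by (simp add: t_def divide_neg_pos)
      have at: "1 - exp (- real b * t) = a" using a b by (simp add: t_def)
      let ?E = "\<lambda>n. \<integral>\<omega>. laplace_test b n c (root_time_field b n t \<omega>) \<partial>walk_space b n"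
      have "\<forall>\<^sub>F n in sequentially. \<bar>?E n - Z_laplace t (real k)\<bar> < a * (r / 4)"
        using tendstoD[OF root_functional_limit[OF t, of "real k"], of "a * (r / 4)"] a r
        by (simp add: c_def dist_real_def)
      then have "\<forall>\<^sub>F n in sequentially. norm (escape_prob b n * (1 - \<theta> n) - D) < r"
        using eventually_ge_at_top[of 1]
      proof eventually_elim
        case (elim n)
        have f0: "laplace_test b n c (\<lambda>_. 0) = 1"
          by (simp add: laplace_test_def leaf_functional_def)
        let ?q = "escape_prob b n * (1 - \<theta> n)"
        have "\<bar>?E n - (1 - a * ?q)\<bar> \<le> a\<^sup>2"
          using small_time_expansion[OF elim(2) b less_imp_le[OF t] leaf_test_laplace_test[OF c]
              laplace_test_symmetric f0 x]
          unfolding at \<theta>_def .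
        moreover have "\<bar>Z_laplace t (real k) - (1 - a * D)\<bar> \<le> a\<^sup>2"
          using Z_laplace_small_time[OF t, of "real k"] k unfolding at D_def by simp
        moreover have "\<bar>x - y - z\<bar> < s + s + w" if "\<bar>x\<bar> \<le> s" "\<bar>y\<bar> \<le> s" "\<bar>z\<bar> < w" for x y z s w :: real
          using that by linarith
        ultimately have lt: "\<bar>(?E n - (1 - a * ?q)) - (Z_laplace t (real k) - (1 - a * D)) - (?E n - Z_laplace t (real k))\<bar>
            < a\<^sup>2 + a\<^sup>2 + a * (r / 4)"
          using elim(1) by blast
        have eq: "(?E n - (1 - a * ?q)) - (Z_laplace t (real k) - (1 - a * D)) - (?E n - Z_laplace t (real k)) = a * (?q - D)"
          by (simp add: right_diff_distrib)
        have "\<bar>a * (?q - D)\<bar> < a\<^sup>2 + a\<^sup>2 + a * (r / 4)" using lt unfolding eq .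
        also have "\<dots> \<le> a * r"
        proof -
          have "a * a \<le> a * (r / 4)" using a by (intro mult_left_mono) auto
          moreover have "0 < a * r" using a r by simp
          ultimately show ?thesis unfolding power2_eq_square times_divide_eq_right by linarith
        qed
        finally show ?case using a by (simp add: abs_mult)
      qed
      then show "\<exists>no. \<forall>n\<ge>no. norm (escape_prob b n * (1 - \<theta> n) - D) < r"
        by (simp add: eventually_sequentially)
    qed
    then have "(\<lambda>n. 1 - escape_prob b n * (1 - \<theta> n) / escape_prob b n) \<longlonglongrightarrow> 1 - D / p_inf"
      using escape_prob_tendsto[OF b] p_inf_pos unfolding p_inf_def
      by (intro tendsto_diff tendsto_const tendsto_divide) auto
    moreover have "\<forall>\<^sub>F n in sequentially. 1 - escape_prob b n * (1 - \<theta> n) / escape_prob b n = \<theta> n"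
      using order_tendstoD(1)[OF escape_prob_tendsto[OF b], of 0] p_inf_pos
      by (auto simp: p_inf_def elim!: eventually_mono)
    ultimately have "\<theta> \<longlonglongrightarrow> 1 - D / p_inf" by (rule Lim_transform_eventually)
    moreover have "1 - D / p_inf = ZZ_laplace (real k)" using p_inf_pos by (simp add: D_def)
    moreover have "(\<integral>y. exp (- (real k * y)) \<partial>distr (walk_space b n) borel
        (\<lambda>\<omega>. C_star * leaf_functional b n (hitting_field b n (x n) \<omega>))) = \<theta> n" for n
      by (subst integral_distr) (auto simp: \<theta>_def laplace_test_def c_def mult_ac)
    ultimately show "(\<lambda>n. \<integral>y. exp (- (real k * y)) \<partial>distr (walk_space b n) borel
        (\<lambda>\<omega>. C_star * leaf_functional b n (hitting_field b n (x n) \<omega>)))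
        \<longlonglongrightarrow> (\<integral>y. exp (- (real k * y)) \<partial>distr Q borel \<Z>)"
      by (simp add: ZZ_law(3))
  qed
qed

section \<open>The exponential parameter\<close>

lemma isCont_Z_laplace:
  assumes t: "t > 0"
  shows "isCont (\<lambda>u. Z_laplace t (exp (- 2 * u * sqrt (ln (real b))))) v"
  unfolding continuous_at_sequentially
proof (intro allI impI)
  interpret Pt: prob_space "P t" using Z_rv[OF t] by blast
  have [measurable]: "Z t \<in> borel_measurable (P t)" using Z_rv[OF t] by blast
  fix vs assume v: "vs \<longlonglongrightarrow> v"
  show "((\<lambda>u. Z_laplace t (exp (- 2 * u * sqrt (ln (real b))))) \<circ> vs)
      \<longlonglongrightarrow> Z_laplace t (exp (- 2 * v * sqrt (ln (real b))))"
    unfolding comp_def Z_laplace_def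
  proof (rule integral_dominated_convergence[where w = "\<lambda>_. 1"])
    show "AE \<omega> in P t. (\<lambda>n. exp (- (C_star * Z t \<omega> * exp (- 2 * vs n * sqrt (ln (real b))))))
        \<longlonglongrightarrow> exp (- (C_star * Z t \<omega> * exp (- 2 * v * sqrt (ln (real b)))))"
      by (intro AE_I2 tendsto_intros v)
    show "AE \<omega> in P t. norm (exp (- (C_star * Z t \<omega> * exp (- 2 * vs n * sqrt (ln (real b)))))) \<le> 1" for n
      using Z_nonneg[OF t] by (rule eventually_mono) (use C_pos in simp)
  qed auto
qed

text \<open>The level of depth \<open>n + 1\<close> is a level of depth \<open>n\<close> with
  parameter \<open>vs n\<close>, which tends to \<open>u + sqrt (ln b)\<close> because the
  difference of logarithms vanishes. The shift divides \<open>l\<close> by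
  \<open>exp (2 * ln b)\<close>, that is by the square of \<open>b\<close>.\<close>

lemma root_time_limit_shifted:
  assumes t: "t > 0" and u: "exp (- 2 * u * sqrt (ln (real b))) = l"
  shows "(\<lambda>n. \<integral>\<omega>. max_test b n (max_level b (Suc n) u) (root_time_field b n t \<omega>) \<partial>walk_space b n)
    \<longlonglongrightarrow> Z_laplace t (l / (real b)\<^sup>2)"
proof -
  define s where "s = sqrt (ln (real b))"
  have s: "s > 0" "s * s = ln (real b)" using b by (auto simp: s_def)
  define F where "F n u = (\<integral>\<omega>. max_test b n (max_level b n u) (root_time_field b n t \<omega>) \<partial>walk_space b n)" for n u
  define vs where "vs n = u + (s - (ln (real (Suc n)) - ln (real n)) / s)" for n
  have "(\<lambda>n. ln (real (Suc n)) - ln (real n)) \<longlonglongrightarrow> 0" by real_asymp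
  then have "vs \<longlonglongrightarrow> u + (s - 0 / s)"
    unfolding vs_def using s by (intro tendsto_intros) auto
  then have vs: "vs \<longlonglongrightarrow> u + s" by simp
  have "(\<lambda>n. F n (vs n)) \<longlonglongrightarrow> Z_laplace t (exp (- 2 * (u + s) * sqrt (ln (real b))))"
  proof (rule tendsto_compose_mono[OF _ _ isCont_Z_laplace[OF t] vs])
    show "(\<lambda>n. F n u) \<longlonglongrightarrow> Z_laplace t (exp (- 2 * u * sqrt (ln (real b))))" for u
      unfolding F_def by (rule root_time_limit[OF t])
    show "F n u \<le> F n v" if "u \<le> v" for n u v
      unfolding F_def
    proof (intro integral_mono walk_space.integrable_unit_interval)
      show "max_test b n (max_level b n u) h \<le> max_test b n (max_level b n v) h" for h
        using that by (auto simp: max_test_def max_level_def intro: order.trans)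
    qed (auto simp: leaf_test_bounds[OF leaf_test_max_test] intro!: measurable_leaf_test[OF leaf_test_max_test])
  qed
  moreover have "F n (vs n) = (\<integral>\<omega>. max_test b n (max_level b (Suc n) u) (root_time_field b n t \<omega>) \<partial>walk_space b n)" for n
  proof -
    have "max_level b n (vs n) = max_level b (Suc n) u"
      unfolding max_level_def vs_def s_def[symmetric] using s(1) by (simp add: field_simps)
    then show ?thesis by (simp add: F_def)
  qed
  moreover have "exp (- 2 * (u + s) * sqrt (ln (real b))) = l / (real b)\<^sup>2"
  proof -
    have "- 2 * (u + s) * s = - 2 * u * s - (ln (real b) + ln (real b))"
      using s(2) by (simp add: algebra_simps)
    moreover have "exp (ln (real b) + ln (real b)) = real b * real b"
      unfolding exp_add using b by simp
    ultimately have "exp (- 2 * (u + s) * s) = exp (- 2 * u * s) / (real b * real b)"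
      by (simp only: exp_diff)
    then show ?thesis using u unfolding s_def by (simp add: power2_eq_square)
  qed
  ultimately show ?thesis by simp
qed

text \<open>Leaves outside the subtree carry the value 0 and pass the test because \<open>m\<close>
  is nonnegative.\<close>

lemma max_test_subtree:
  assumes "0 \<le> m" "b \<ge> 1"
  shows "max_test b (Suc n) m (\<lambda>y. 0 + subtree_field 0 h y) = max_test b n m h"
proof -
  have "x @ [0] \<in> leaves b (Suc n)" if "x \<in> leaves b n" for x
    using that assms(2) by (auto simp: leaves_def tree_vertices_def)
  then have "(\<forall>y\<in>leaves b (Suc n). sqrt (subtree_field 0 h y) \<le> m) \<Longrightarrow> \<forall>x\<in>leaves b n. sqrt (h x) \<le> m"
    by (fastforce simp: subtree_field_def)
  moreover have "\<forall>x\<in>leaves b n. sqrt (h x) \<le> m \<Longrightarrow> \<forall>y\<in>leaves b (Suc n). sqrt (subtree_field 0 h y) \<le> m"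
    using assms(1) butlast_in_leaves by (auto simp: subtree_field_def)
  ultimately show ?thesis unfolding max_test_def add_0_left by (intro if_cong) auto
qed

text \<open>The spaces \<open>P t\<close> for different \<open>t\<close> are unrelated, so
  measurability in \<open>t\<close> is obtained by exhibiting \<open>G\<close> as a limit of the
  measurable means at finite depth. These means, averaged over an exponential time, are means in
  depth \<open>n + 1\<close> from a child of the root, whose limit is known.\<close>

lemma Z_laplace_exponential_mixture:
  assumes l: "l > 0"
  shows "\<exists>G\<in>borel_measurable borel. (\<forall>t>0. G t = Z_laplace t (l / (real b)\<^sup>2)) \<and>
    (\<integral>t. G t \<partial>std_exp) = 1 - p_inf * (1 - ZZ_laplace l)"
proof -
  obtain u where u: "exp (- 2 * u * sqrt (ln (real b))) = l" using exists_level[OF l] by blast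
  \<comment> \<open>The level of depth \<open>n + 1\<close> is used in a test at depth
    \<open>n\<close>, since the tree of depth \<open>n\<close> is to be seen as a subtree below a
    child.\<close>
  define m where "m n = max_level b (Suc n) u" for n
  define S where "S n t = stopped_mean b n (max_test b n (m n)) [] t (\<lambda>_. 0)" for n t
  define G where "G t = (if t > 0 then Z_laplace t (l / (real b)\<^sup>2) else 0)" for t
  have Sm: "S n \<in> borel_measurable borel" for n
    unfolding S_def by (intro measurable_stopped_mean leaf_test_max_test) auto
  have lim: "(\<lambda>n. S n t) \<longlonglongrightarrow> G t" if t: "t > 0" for t
  proof (rule Lim_transform_eventually)
    show "(\<lambda>n. \<integral>\<omega>. max_test b n (m n) (root_time_field b n t \<omega>) \<partial>walk_space b n) \<longlonglongrightarrow> G t"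
      using root_time_limit_shifted[OF t u] t by (simp add: G_def m_def)
    show "\<forall>\<^sub>F n in sequentially. (\<integral>\<omega>. max_test b n (m n) (root_time_field b n t \<omega>) \<partial>walk_space b n) = S n t"
      using eventually_ge_at_top[of 1]
    proof (rule eventually_mono)
      fix n :: nat assume n: "n \<ge> 1"
      show "(\<integral>\<omega>. max_test b n (m n) (root_time_field b n t \<omega>) \<partial>walk_space b n) = S n t"
        unfolding S_def by (rule integral_root_time_field[OF n b1 less_imp_le[OF t] leaf_test_max_test])
    qed
  qed
  have G: "G \<in> borel_measurable borel"
  proof (rule borel_measurable_LIMSEQ_real)
    show "(\<lambda>n. if t > 0 then S n t else 0) \<longlonglongrightarrow> G t" for t
      using lim[of t] by (cases "t > 0") (auto simp: G_def)
    show "(\<lambda>t. if t > 0 then S n t else 0) \<in> borel_measurable borel" for n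
      using Sm[of n] by measurable
  qed
  have "(\<lambda>n. \<integral>t. S n t \<partial>std_exp) \<longlonglongrightarrow> (\<integral>t. G t \<partial>std_exp)"
  proof (rule integral_dominated_convergence[where w = "\<lambda>_. 1"])
    show "AE t in std_exp. (\<lambda>n. S n t) \<longlonglongrightarrow> G t"
      using AE_std_exp_pos by (rule eventually_mono) (rule lim)
    show "AE t in std_exp. norm (S n t) \<le> 1" for n
      using stopped_mean_bounds[OF leaf_test_max_test] by (auto simp: S_def)
  qed (use G Sm in auto)
  moreover have "(\<lambda>n. \<integral>t. S n t \<partial>std_exp) \<longlonglongrightarrow> 1 - p_inf * (1 - ZZ_laplace l)"
  proof (rule Lim_transform_eventually)
    show "(\<lambda>n. 1 - escape_prob b (Suc n) * (1 - (\<integral>\<omega>. max_test b (Suc n) (m n)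
        (hitting_field b (Suc n) (replicate (Suc n) 0) \<omega>) \<partial>walk_space b (Suc n)))) \<longlonglongrightarrow> 1 - p_inf * (1 - ZZ_laplace l)"
      unfolding m_def by (intro tendsto_diff tendsto_const LIMSEQ_Suc[OF escape_hitting_limit[OF l u]])
    show "\<forall>\<^sub>F n in sequentially. 1 - escape_prob b (Suc n) * (1 - (\<integral>\<omega>. max_test b (Suc n) (m n)
        (hitting_field b (Suc n) (replicate (Suc n) 0) \<omega>) \<partial>walk_space b (Suc n))) = (\<integral>t. S n t \<partial>std_exp)"
      using eventually_ge_at_top[of 1]
        filterlim_compose[OF filterlim_max_level[OF b, of u] filterlim_Suc, unfolded filterlim_at_top, rule_format, of 0]
    proof eventually_elim
      case (elim n)
      then have m: "0 \<le> m n" by (simp add: m_def)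
      have f: "leaf_test b (Suc n) (max_test b (Suc n) (m n))" by (rule leaf_test_max_test)
      have f0: "max_test b (Suc n) (m n) (\<lambda>_. 0) = 1" using m by (simp add: max_test_def)
      have i: "0 < b" using b by simp
      have "stopped_mean b (Suc n) (max_test b (Suc n) (m n)) [0] 0 (\<lambda>_. 0) = (\<integral>t. S n t \<partial>std_exp)"
        using stopped_mean_exponential_time[OF elim(1) b1 i f root_in_tree, of "\<lambda>_. 0"]
        unfolding max_test_subtree[OF m b1] by (simp add: S_def)
      then show ?case
        using stopped_mean_child[OF _ b f max_test_symmetric f0 replicate_in_leaves[OF b1] i] by simp
    qed
  qed
  ultimately have "(\<integral>t. G t \<partial>std_exp) = 1 - p_inf * (1 - ZZ_laplace l)" by (rule LIMSEQ_unique)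
  then show ?thesis using G by (intro bexI[of _ G]) (auto simp: G_def)
qed

text \<open>The transform of the mixture is \<open>1 - p_inf * (1 - ZZ_laplace l)\<close> with no
  error term: an atom of mass \<open>1 - p_inf\<close> at 0 and the law of \<Z> with weight
  \<open>p_inf\<close>. Conditioning on positivity removes the atom.\<close>

theorem exponential_parameter_law:
  assumes U: "distributed N lborel U (exponential_density 1)" and c: "coupled_at P Z N U ZU"
  shows "law_given_pos N ZU (C_star / (real b)\<^sup>2) = distr Q borel \<Z>"
proof -
  interpret N: prob_space N using c by (simp add: coupled_at_def)
  have [measurable]: "ZU \<in> borel_measurable N" using c by (simp add: coupled_at_def)
  have nn: "AE \<omega> in N. 0 \<le> ZU \<omega>"
    by (rule coupled_nonneg[OF c]) (use Z_rv Z_nonneg in auto)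
  have distr: "distr N borel U = std_exp"
    using distributed_distr_eq_density[OF U] distr_cong[of N N borel lborel U U] by simp
  define C where "C = C_star / (real b)\<^sup>2"
  have C: "C > 0" using C_pos b by (simp add: C_def)
  have laplace: "(\<integral>\<omega>. exp (- (C * ZU \<omega> * l)) \<partial>N) = 1 - p_inf * (1 - ZZ_laplace l)" if l: "l > 0" for l
  proof -
    obtain G where G: "G \<in> borel_measurable borel" "\<forall>t>0. G t = Z_laplace t (l / (real b)\<^sup>2)"
      "(\<integral>t. G t \<partial>std_exp) = 1 - p_inf * (1 - ZZ_laplace l)"
      using Z_laplace_exponential_mixture[OF l] by blast
    \<comment> \<open>Truncation at 0 keeps \<open>g\<close> in the unit interval on the whole line,
      as \<open>coupled_integral\<close> demands; the variables are almost surely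
      nonnegative.\<close>
    define g where "g x = exp (- (C * max 0 x * l))" for x
    have "(\<integral>\<omega>. exp (- (C * ZU \<omega> * l)) \<partial>N) = (\<integral>\<omega>. g (ZU \<omega>) \<partial>N)"
    proof (rule integral_cong_AE)
      show "AE \<omega> in N. exp (- (C * ZU \<omega> * l)) = g (ZU \<omega>)"
        using nn by (rule eventually_mono) (simp add: g_def)
    qed (auto simp: g_def)
    also have "\<dots> = (\<integral>t. G t \<partial>distr N borel U)"
    proof (rule coupled_integral[OF c Z_rv])
      fix t :: real assume t: "t > 0"
      have [measurable]: "Z t \<in> borel_measurable (P t)" using Z_rv[OF t] by blast
      have "Z_laplace t (l / (real b)\<^sup>2) = (\<integral>\<omega>. g (Z t \<omega>) \<partial>P t)"
        unfolding Z_laplace_def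
      proof (rule integral_cong_AE)
        show "AE \<omega> in P t. exp (- (C_star * Z t \<omega> * (l / (real b)\<^sup>2))) = g (Z t \<omega>)"
          using Z_nonneg[OF t] by (rule eventually_mono) (simp add: g_def C_def mult_ac)
      qed (auto simp: g_def)
      then show "G t = (\<integral>\<omega>. g (Z t \<omega>) \<partial>P t)" using G(2) t by simp
    qed (use C l G(1) in \<open>auto simp: g_def\<close>)
    finally show ?thesis using G(3) distr by simp
  qed
  have "(\<lambda>m. \<integral>\<omega>. exp (- (C * ZU \<omega> * real m)) \<partial>N) \<longlonglongrightarrow> 1 - p_inf * (1 - 0)"
  proof (rule Lim_transform_eventually)
    show "(\<lambda>m. 1 - p_inf * (1 - ZZ_laplace (real m))) \<longlonglongrightarrow> 1 - p_inf * (1 - 0)"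
      by (intro tendsto_intros ZZ_laplace_at_infinity)
    show "\<forall>\<^sub>F m in sequentially. 1 - p_inf * (1 - ZZ_laplace (real m)) = (\<integral>\<omega>. exp (- (C * ZU \<omega> * real m)) \<partial>N)"
      by (rule eventually_mono[OF eventually_gt_at_top[of 0]]) (simp add: laplace)
  qed
  from LIMSEQ_unique[OF this N.laplace_at_infinity[OF _ nn C]]
  have pos: "N.prob {\<omega> \<in> space N. 0 < ZU \<omega>} = p_inf" by simp
  note law = N.law_given_pos[of ZU C, OF _ nn C, unfolded pos, OF _ p_inf_pos]
  show ?thesis
    unfolding C_def[symmetric]
  proof (rule laplace_eq_imp_eq[OF law(1) ZZ_law(1) law(2) ZZ_law(2)])
    fix k :: nat assume k: "k > 0"
    have "(\<integral>x. exp (- (real k * x)) \<partial>law_given_pos N ZU C)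
        = ((\<integral>\<omega>. exp (- (C * ZU \<omega> * real k)) \<partial>N) - (1 - p_inf)) / p_inf"
      using law(3)[of "real k"] by (simp add: mult_ac)
    also have "\<dots> = ZZ_laplace (real k)"
      using laplace[of "real k"] k p_inf_pos by (simp add: field_simps)
    finally show "(\<integral>x. exp (- (real k * x)) \<partial>law_given_pos N ZU C) = (\<integral>x. exp (- (real k * x)) \<partial>distr Q borel \<Z>)"
      by (simp add: ZZ_law(3))
  qed simp_all
qed

end

theorem theorem1p5:
  fixes b :: nat
    and P :: "real \<Rightarrow> 'p measure" and Z :: "real \<Rightarrow> 'p \<Rightarrow> real"
    and C_star :: real
    and Q :: "'q measure" and \<Z> :: "'q \<Rightarrow> real"
  assumes b: "b \<ge> 2"
    and Z_rv: "\<And>t. t > 0 \<Longrightarrow> prob_space (P t) \<and> Z t \<in> borel_measurable (P t)"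
    and Z_nonneg: "\<And>t. t > 0 \<Longrightarrow> AE \<omega> in P t. 0 \<le> Z t \<omega>"
    and Z_limit: "\<And>t. t > 0 \<Longrightarrow>
      weak_conv_m
        (\<lambda>n. distr (walk_space b n) borel (\<lambda>\<omega>. leaf_functional b n (root_time_field b n t \<omega>)))
        (distr (P t) borel (Z t))"
    and Z_pos: "\<And>t. t > 0 \<Longrightarrow> \<P>(\<omega> in P t. Z t \<omega> > 0) \<in> {0<..<1}"
    and C_pos: "C_star > 0"
    and C_max: "\<And>t u. t > 0 \<Longrightarrow>
      (\<lambda>n. \<P>(\<omega> in walk_space b n.
              max_sqrt_leaves b n (root_time_field b n t \<omega>) \<le> max_level b n u))
      \<longlonglongrightarrow> (\<integral>\<omega>. exp (- C_star * Z t \<omega> * exp (- 2 * u * sqrt (ln (real b)))) \<partial>P t)"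
    and ZZ_rv: "prob_space Q" "\<Z> \<in> borel_measurable Q"
    and ZZ_pos: "AE \<omega> in Q. 0 < \<Z> \<omega>"
    and ZZ_max: "\<And>x u. (\<And>n. x n \<in> leaves b n) \<Longrightarrow>
      (\<lambda>n. \<P>(\<omega> in walk_space b n.
              max_sqrt_leaves b n (hitting_field b n (x n) \<omega>) \<le> max_level b n u))
      \<longlonglongrightarrow> (\<integral>\<omega>. exp (- \<Z> \<omega> * exp (- 2 * u * sqrt (ln (real b)))) \<partial>Q)"
  shows
    \<comment> \<open>(1), with the limit as \<open>t\<close> decreases to \<open>0\<close> taken along arbitrary sequences\<close>
    "(\<forall>t. filterlim t (at_right 0) sequentially \<longrightarrow>
        weak_conv_m (\<lambda>k. law_given_pos (P (t k)) (Z (t k)) C_star) (distr Q borel \<Z>)) \<and>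
     \<comment> \<open>(2), with \<open>ZU\<close> standing for \<open>Z(U)\<close>\<close>
     (\<forall>(N :: 'c measure) U ZU.
        distributed N lborel U (exponential_density 1) \<and> coupled_at P Z N U ZU \<longrightarrow>
        law_given_pos N ZU (C_star / (real b)\<^sup>2) = distr Q borel \<Z>) \<and>
     (\<forall>x. (\<forall>n. x n \<in> leaves b n) \<longrightarrow>
        weak_conv_m
          (\<lambda>n. distr (walk_space b n) borel
                 (\<lambda>\<omega>. C_star * leaf_functional b n (hitting_field b n (x n) \<omega>)))
          (distr Q borel \<Z>))"
proof -
  interpret leaf_limits b P Z C_star Q \<Z>
    by (rule leaf_limits.intro)
      (fact b Z_rv Z_nonneg Z_limit C_pos C_max ZZ_rv ZZ_pos ZZ_max)+
  have pos: "\<P>(\<omega> in P s. 0 < Z s \<omega>) > 0" if "s > 0" for s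
    using Z_pos[OF that] by simp
  show ?thesis
    using conditional_limit[OF _ pos] exponential_parameter_law hitting_functional_limit by blast
qed

end
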